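(* Fix integers $t\ge 2$ and $1\le r\le t-1$. Let $X_t,X_{t-r}\subset\mathbb{P}^n$ be two arithmetically Cohen-Macaulay codimension $2$ subschemes defined by the maximal minors of a $t\times(t+1)$ (respectively $(t-r)\times(t-r+1)$) matrix with linear entries $M_t$ (respectively $M_{t-r}$). Assume that $$M_{t-r}=\begin{pmatrix} L_1^1&L_1^2&\cdots&L_1^{t-r+1}\\ L_2^1&L_2^2&\cdots&L_2^{t-r+1}\\ \vdots&\vdots&&\vdots\\ L_{t-r}^1&L_{t-r}^2&\cdots&L_{t-r}^{t-r+1}\end{pmatrix}$$ and $$M_t=\begin{pmatrix} M_1^1&M_1^2&\cdots&M_1^{r+1}&L_1^1&\cdots&L_{t-r}^1\\ M_2^1&M_2^2&\cdots&M_2^{r+1}&L_1^2&\cdots&L_{t-r}^2\\ \vdots&\vdots&&\vdots&\vdots&&\vdots\\ M_{t-r+1}^1&M_{t-r+1}^2&\cdots&M_{t-r+1}^{r+1}&L_1^{t-r+1}&\cdots&L_{t-r}^{t-r+1}\\ M_{t-r+2}^1&M_{t-r+2}^2&\cdots&M_{t-r+2}^{r+1}&0&\cdots&0\\ \vdots&\vdots&&\vdots&\vdots&&\vdots\\ M_t^1&M_t^2&\cdots&M_t^{r+1}&0&\cdots&0\end{pmatrix}.$$ Then $Y_{t,r}=X_t\cap X_{t-r}\subset\mathbb{P}^n$ is an arithmetically Gorenstein subscheme of codimension $3$. Moreover, the $h$-vector of $Y_{t,r}$ is $$\Big(1,3,6,\ldots,\tbinom{t-r}{2},\underbrace{\tbinom{t-r+1}{2},\ldots,\tbinom{t-r+1}{2}}_{r+1},\tbinom{t-r}{2},\ldots,6,3,1\Big),$$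 and $\deg(Y_{t,r})=2\binom{t+2-r}{3}+(r-1)\binom{t+1-r}{2}$.
   Context: $\mathbb{P}^n$ is projective space over an algebraically closed field $K$ of characteristic zero and $R=K[X_0,\ldots,X_n]$; linear entries are homogeneous linear forms in $R$. A subscheme means an equidimensional closed subscheme, with saturated homogeneous ideal $I(X)$; "defined by the maximal minors" means that $I(X)$ is generated by them. $X$ is arithmetically Cohen-Macaulay if $R/I(X)$ is a Cohen-Macaulay ring. A closed subscheme $X$ of codimension $c$ is arithmetically Gorenstein if $I(X)$ has a minimal free graded $R$-resolution $0\to R(-m)\to F_{c-1}\to\cdots\to F_1\to I(X)\to 0$ for some integer $m$, i.e. $X$ is arithmetically Cohen-Macaulay and the last module in the resolution has rank one. The $h$-vector of an arithmetically Cohen-Macaulay $X$ of dimension $d$ is the Hilbert function of the Artinian reduction of $R/I(X)$, i.e. of its quotient by a regular sequence of $d+1$ general linear forms.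
   Formalization: Two hypotheses are added: X_t and X_{t-r} have no common irreducible component, and n ≥ 3. Without the first the intersection can have codimension 2; for n = 2 it is empty or has codimension 2. Both conditions follow from the claimed conclusion. *)

theory Defs
  imports
    "HOL-Algebra.Ring_Divisibility"
    "HOL-Algebra.QuotRing"
    "HOL-Library.Poly_Mapping"
    "HOL-Library.Extended_Nat"
    "HOL-Library.Cardinality"
    "HOL-Computational_Algebra.Polynomial"
    "Jordan_Normal_Form.VS_Connect"
    "Jordan_Normal_Form.DL_Submatrix"
begin

section \<open>Commutative rings\<close>

text \<open>For the zero ring the supremum is over the empty set, so its dimension is \<open>0\<close> here.\<close>

definition krull_dim :: "('a, 'b) ring_scheme \<Rightarrow> enat" where
  "krull_dim S = Sup {enat k | k. \<exists>P :: nat \<Rightarrow> 'a set.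
     (\<forall>i\<le>k. primeideal (P i) S) \<and> (\<forall>i<k. P i \<subset> P (Suc i))}"

definition prime_height :: "('a, 'b) ring_scheme \<Rightarrow> 'a set \<Rightarrow> enat" where
  "prime_height S Q = Sup {enat k | k. \<exists>P :: nat \<Rightarrow> 'a set.
     (\<forall>i\<le>k. primeideal (P i) S) \<and> (\<forall>i<k. P i \<subset> P (Suc i)) \<and> P k = Q}"

definition regular_sequence :: "('a, 'b) ring_scheme \<Rightarrow> 'a list \<Rightarrow> bool" where
  "regular_sequence S fs \<longleftrightarrow>
     set fs \<subseteq> carrier S \<and>
     (\<forall>i<length fs. \<forall>a\<in>carrier S.
        a \<otimes>\<^bsub>S\<^esub> fs ! i \<in> Idl\<^bsub>S\<^esub> (set (take i fs)) \<longrightarrow> a \<in> Idl\<^bsub>S\<^esub> (set (take i fs))) \<and>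
     Idl\<^bsub>S\<^esub> (set fs) \<noteq> carrier S"

definition ideal_depth :: "('a, 'b) ring_scheme \<Rightarrow> 'a set \<Rightarrow> enat" where
  "ideal_depth S J = Sup {enat (length fs) | fs. set fs \<subseteq> J \<and> regular_sequence S fs}"

text \<open>This is the definition of Eisenbud, \<^emph>\<open>Commutative Algebra\<close>, Section 18.2: depth
  equals codimension at every maximal ideal. It needs no localization.\<close>

definition cohen_macaulay :: "('a, 'b) ring_scheme \<Rightarrow> bool" where
  "cohen_macaulay S \<longleftrightarrow>
     cring S \<and> noetherian_ring S \<and> (\<forall>M. maximalideal M S \<longrightarrow> ideal_depth S M = prime_height S M)"


section \<open>The homogeneous coordinate ring of projective space\<close>

text \<open>The variables are indexed by a finite type \<open>'n\<close>, so that \<open>('n, 'k) mpoly\<close> is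
  \<open>K[X\<^sub>0,\<dots>,X\<^sub>n]\<close> when \<open>'n\<close> has \<open>n + 1\<close> elements. The multiplication of
  \<^theory>\<open>HOL-Library.Poly_Mapping\<close> is convolution, and
  \<^term>\<open>class_ring\<close> turns the type into a ring in the sense of HOL-Algebra.\<close>

type_synonym ('n, 'k) mpoly = "('n \<Rightarrow>\<^sub>0 nat) \<Rightarrow>\<^sub>0 'k"

definition Var :: "'n \<Rightarrow> ('n, 'k::comm_ring_1) mpoly" where
  "Var i = Poly_Mapping.single (Poly_Mapping.single i 1) 1"

text \<open>The zero polynomial is homogeneous of every degree.\<close>

definition homogeneous :: "nat \<Rightarrow> ('n::finite, 'k::comm_ring_1) mpoly \<Rightarrow> bool" where
  "homogeneous d p \<longleftrightarrow> (\<forall>m\<in>Poly_Mapping.keys p. (\<Sum>i\<in>UNIV. Poly_Mapping.lookup m i) = d)"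

definition homogeneous_ideal :: "('n::finite, 'k::comm_ring_1) mpoly set \<Rightarrow> bool" where
  "homogeneous_ideal I \<longleftrightarrow> (\<exists>S. (\<forall>p\<in>S. \<exists>d. homogeneous d p) \<and> I = Idl\<^bsub>class_ring\<^esub> S)"

definition irrelevant_ideal :: "('n::finite, 'k::comm_ring_1) mpoly set" where
  "irrelevant_ideal = Idl\<^bsub>class_ring\<^esub> (range Var)"

definition saturation :: "('n::finite, 'k::comm_ring_1) mpoly set \<Rightarrow> ('n, 'k) mpoly set" where
  "saturation I = {p. \<forall>i. \<exists>k. Var i ^ k * p \<in> I}"

definition minimal_primes :: "('n::finite, 'k::comm_ring_1) mpoly set \<Rightarrow> ('n, 'k) mpoly set set" where
  "minimal_primes I = {P. primeideal P class_ring \<and> I \<subseteq> P \<and>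
     (\<forall>Q. primeideal Q class_ring \<and> I \<subseteq> Q \<and> Q \<subseteq> P \<longrightarrow> Q = P)}"


section \<open>Closed subschemes of projective space\<close>

text \<open>A closed subscheme \<open>X\<close> is represented by its saturated homogeneous ideal \<open>I(X)\<close>; this is
  a bijection between closed subschemes and saturated homogeneous ideals, under which the
  irreducible components of \<open>X\<close> correspond to the minimal primes of \<open>I(X)\<close>, and the
  scheme-theoretic intersection to the saturation of the sum. The empty scheme is represented by
  the unit ideal.\<close>

definition closed_subscheme :: "('n::finite, 'k::field) mpoly set \<Rightarrow> bool" where
  "closed_subscheme X \<longleftrightarrow> homogeneous_ideal X \<and> saturation X = X"

definition equidimensional :: "('n::finite, 'k::field) mpoly set \<Rightarrow> bool" where
  "equidimensional X \<longleftrightarrow> (\<forall>P\<in>minimal_primes X. \<forall>Q\<in>minimal_primes X.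
     krull_dim (class_ring Quot P) = krull_dim (class_ring Quot Q))"

definition subscheme :: "('n::finite, 'k::field) mpoly set \<Rightarrow> bool" where
  "subscheme X \<longleftrightarrow> closed_subscheme X \<and> equidimensional X"

definition scheme_inter ::
  "('n::finite, 'k::field) mpoly set \<Rightarrow> ('n, 'k) mpoly set \<Rightarrow> ('n, 'k) mpoly set" where
  "scheme_inter X Z = saturation (X <+>\<^bsub>class_ring\<^esub> Z)"

definition no_common_component ::
  "('n::finite, 'k::field) mpoly set \<Rightarrow> ('n, 'k) mpoly set \<Rightarrow> bool" where
  "no_common_component X Z \<longleftrightarrow> minimal_primes X \<inter> minimal_primes Z = {}"

text \<open>The codimension is \<open>n - dim X\<close> with \<open>dim X = krull_dim (R/I(X)) - 1\<close>. It is written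
  with \<open>n + 1 = CARD('n)\<close> because the subtraction is truncated: the empty scheme gets codimension
  \<open>n + 1\<close>, although its dimension is truncated to \<open>0\<close>.\<close>

definition scheme_dim :: "('n::finite, 'k::field) mpoly set \<Rightarrow> enat" where
  "scheme_dim X = krull_dim (class_ring Quot X) - 1"

definition scheme_codim :: "('n::finite, 'k::field) mpoly set \<Rightarrow> enat" where
  "scheme_codim X = enat CARD('n) - krull_dim (class_ring Quot X)"

definition arithmetically_CM :: "('n::finite, 'k::field) mpoly set \<Rightarrow> bool" where
  "arithmetically_CM X \<longleftrightarrow> cohen_macaulay (class_ring Quot X)"


section \<open>Minimal graded free resolutions\<close>

text \<open>A list \<open>[a\<^sub>1,\<dots>,a\<^sub>k]\<close> of integers stands for the graded free module
  \<open>R(-a\<^sub>1) \<oplus> \<dots> \<oplus> R(-a\<^sub>k)\<close>. A matrix, acting on column vectors, is a degree-preserving map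
  from the module of \<open>bs\<close> to the module of \<open>as\<close> iff its entry \<open>(i,j)\<close> is homogeneous of degree
  \<open>bs ! j - as ! i\<close>, and zero if that number is negative.\<close>

definition graded_map :: "int list \<Rightarrow> int list \<Rightarrow> ('n::finite, 'k::field) mpoly mat \<Rightarrow> bool" where
  "graded_map bs as A \<longleftrightarrow> A \<in> carrier_mat (length as) (length bs) \<and>
     (\<forall>i<length as. \<forall>j<length bs.
        A $$ (i, j) = 0 \<or> (\<exists>d. int d = bs ! j - as ! i \<and> homogeneous d (A $$ (i, j))))"

text \<open>The resolution \<open>0 \<rightarrow> F\<^sub>c \<rightarrow> \<dots> \<rightarrow> F\<^sub>1 \<rightarrow> I \<rightarrow> 0\<close> is given by \<open>F i\<close> for \<open>1 \<le> i \<le> c\<close> and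
  \<open>\<phi> i : F\<^sub>i \<rightarrow> F\<^sub>i\<^sub>-\<^sub>1\<close>, where \<open>F 0 = [0]\<close> stands for \<open>R\<close>, the target of
  \<open>F\<^sub>1 \<rightarrow> I \<subseteq> R\<close>. It is minimal iff the maps \<open>\<phi> i\<close> between the free modules
  \<open>F\<^sub>i\<close> with \<open>i \<ge> 1\<close> have all entries in the irrelevant ideal.\<close>

definition minimal_graded_free_resolution ::
  "('n::finite, 'k::field) mpoly set \<Rightarrow> nat \<Rightarrow> (nat \<Rightarrow> int list) \<Rightarrow> (nat \<Rightarrow> ('n, 'k) mpoly mat) \<Rightarrow> bool" where
  "minimal_graded_free_resolution I c F \<phi> \<longleftrightarrow>
     1 \<le> c \<and> F 0 = [0] \<and>
     (\<forall>i\<in>{1..c}. graded_map (F i) (F (i - 1)) (\<phi> i)) \<and>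
     {(\<phi> 1 *\<^sub>v v) $ 0 | v. v \<in> carrier_vec (length (F 1))} = I \<and>
     (\<forall>i\<in>{1..<c}. {v \<in> carrier_vec (length (F i)). \<phi> i *\<^sub>v v = 0\<^sub>v (length (F (i - 1)))}
        = {\<phi> (Suc i) *\<^sub>v w | w. w \<in> carrier_vec (length (F (Suc i)))}) \<and>
     (\<forall>v\<in>carrier_vec (length (F c)).
        \<phi> c *\<^sub>v v = 0\<^sub>v (length (F (c - 1))) \<longrightarrow> v = 0\<^sub>v (length (F c))) \<and>
     (\<forall>i\<in>{2..c}. elements_mat (\<phi> i) \<subseteq> irrelevant_ideal)"

definition arithmetically_Gorenstein :: "('n::finite, 'k::field) mpoly set \<Rightarrow> bool" where
  "arithmetically_Gorenstein X \<longleftrightarrow>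
     (\<exists>c F \<phi> m. scheme_codim X = enat c \<and> minimal_graded_free_resolution X c F \<phi> \<and> F c = [m])"


section \<open>Hilbert function, h-vector, degree\<close>

text \<open>\<open>hilbert_function I i = dim\<^sub>K (R/I)\<^sub>i\<close> for a homogeneous ideal \<open>I\<close>.\<close>

definition hilbert_function :: "('n::finite, 'k::field) mpoly set \<Rightarrow> nat \<Rightarrow> nat" where
  "hilbert_function I i =
     vector_space.dim (\<lambda>c p. Poly_Mapping.single 0 c * p) {p :: ('n, 'k) mpoly. homogeneous i p} -
     vector_space.dim (\<lambda>c p. Poly_Mapping.single 0 c * p) {p \<in> I. homogeneous i p}"

definition hilbert_polynomial :: "('n::finite, 'k::field) mpoly set \<Rightarrow> rat poly" where
  "hilbert_polynomial X =
     (THE P. \<forall>\<^sub>F i in sequentially. of_nat (hilbert_function X i) = poly P (of_nat i))"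

definition scheme_degree :: "('n::finite, 'k::field) mpoly set \<Rightarrow> rat" where
  "scheme_degree X = fact (the_enat (scheme_dim X)) * lead_coeff (hilbert_polynomial X)"

text \<open>Linear forms \<open>l\<^sub>0,\<dots>,l\<^sub>d\<close>, \<open>d = dim X\<close>, whose classes form a regular sequence on
  \<open>R/I(X)\<close>. Their number \<open>d + 1\<close> is the Krull dimension of \<open>R/I(X)\<close>.\<close>

definition linear_regular_sequence ::
  "('n::finite, 'k::field) mpoly set \<Rightarrow> ('n, 'k) mpoly list \<Rightarrow> bool" where
  "linear_regular_sequence X ls \<longleftrightarrow>
     (\<forall>l\<in>set ls. homogeneous 1 l) \<and>
     enat (length ls) = krull_dim (class_ring Quot X) \<and>
     regular_sequence (class_ring Quot X) (map (\<lambda>l. X +>\<^bsub>class_ring\<^esub> l) ls)"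

text \<open>General linear forms are used in the definition of the h-vector to obtain a regular
  sequence; the Hilbert function of the Artinian reduction does not depend on the choice. So
  \<open>h\<close> is required to be the Hilbert function for every regular sequence of \<open>d + 1\<close> linear
  forms, and such a sequence has to exist. The list \<open>h\<close> is continued by zeros.\<close>

definition has_h_vector :: "('n::finite, 'k::field) mpoly set \<Rightarrow> nat list \<Rightarrow> bool" where
  "has_h_vector X h \<longleftrightarrow>
     (\<exists>ls. linear_regular_sequence X ls) \<and>
     (\<forall>ls. linear_regular_sequence X ls \<longrightarrow>
        (\<forall>i. hilbert_function (Idl\<^bsub>class_ring\<^esub> (X \<union> set ls)) i = (if i < length h then h ! i else 0)))"


section \<open>Determinantal subschemes\<close>

definition linear_entries :: "('n::finite, 'k::field) mpoly mat \<Rightarrow> bool" where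
  "linear_entries A \<longleftrightarrow> (\<forall>p\<in>elements_mat A. homogeneous 1 p)"

definition maximal_minors :: "'a::comm_ring_1 mat \<Rightarrow> 'a set" where
  "maximal_minors A = {det (submatrix A I J) | I J. I \<subseteq> {..<dim_row A} \<and> J \<subseteq> {..<dim_col A} \<and>
     card I = min (dim_row A) (dim_col A) \<and> card J = min (dim_row A) (dim_col A)}"

definition defined_by_maximal_minors ::
  "('n::finite, 'k::field) mpoly set \<Rightarrow> ('n, 'k) mpoly mat \<Rightarrow> bool" where
  "defined_by_maximal_minors X A \<longleftrightarrow> X = Idl\<^bsub>class_ring\<^esub> (maximal_minors A)"

end

theory Submission
  imports Defs "HOL-Library.Function_Algebras"
begin

text \<open>Let \<open>f\<close> be the vector of signed maximal minors of \<open>N = M\<^sub>t\<^sub>-\<^sub>r\<^sup>T\<close> and \<open>g\<close> the vector of signed maximal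
  minors of \<open>M\<^sub>t\<close> that omit a column of \<open>N\<close>. The other maximal minors of \<open>M\<^sub>t\<close> lie in the ideal \<open>(f)\<close>
  of \<open>X\<^sub>t\<^sub>-\<^sub>r\<close>, so the sum of the two ideals is \<open>(f, g)\<close>, and \<open>(f, g)\<close> is the vector of submaximal
  Pfaffians of a skew-symmetric matrix with blocks \<open>S, N, - N\<^sup>T, 0\<close>. Since \<open>X\<^sub>t\<close> and \<open>X\<^sub>t\<^sub>-\<^sub>r\<close> have no
  common component, this ideal has codimension at least 3 and contains a regular sequence \<open>p, q, w\<close>
  with \<open>p, q \<in> (f)\<close>; explicit homotopies show that \<open>p\<close>, \<open>q\<close> and \<open>w\<close> annihilate the homology,
  and a Koszul argument then gives the exactness, of the Buchsbaum-Eisenbud complex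
  \<open>0 \<rightarrow> R(-t-s-1) \<rightarrow> R(-t-1)\<^sup>s\<^sup>+\<^sup>1 \<oplus> R(-s-1)\<^sup>s \<rightarrow> R(-s)\<^sup>s\<^sup>+\<^sup>1 \<oplus> R(-t)\<^sup>s \<rightarrow> R\<close> with \<open>s = t - r\<close>.
  The same argument modulo the first \<open>i \<le> n - 2\<close> members of a general sequence of linear forms shows
  that these form a regular sequence on \<open>R/(f, g)\<close>. Hence \<open>(f, g)\<close> is saturated and unmixed of
  codimension 3, and its Hilbert function, read off from the resolution, determines the h-vector
  and the degree.\<close>

section \<open>Ideals of a commutative ring given by a type class\<close>

text \<open>The complex contains the Hilbert-Burch complex of N and its dual, which can be
  contracted by hand. Bordering N by a column c gives a square matrix with determinant p = f.c; its
  adjugate contracts both complexes up to the factor p, which is why p and q are taken in (f). Only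
  the map induced by g on the cokernel of the transpose of N escapes these homotopies; elements of
  (f, g) annihilate its kernel, which calls for the third element w. The absence of common
  components only bounds prime chains. The bound becomes a regular sequence through linear forms: n
  + 1 independent ones are regular by a comparison of Hilbert functions, and powers of three of them
  are congruent to p, q and w modulo earlier ones. Reordering regular elements rests on a graded
  form of Krull's intersection theorem, so ideals are kept homogeneous. Everything is written in R
  modulo an ideal L instead of in quotient modules: one proof of exactness serves L = 0 and the
  ideals of initial linear forms, and exactness modulo (L, l) makes l regular on R/(L + (f,
  g)).\<close>

definition rideal :: "'a::comm_ring_1 set \<Rightarrow> bool" where
  "rideal I \<longleftrightarrow> 0 \<in> I \<and> (\<forall>a\<in>I. \<forall>b\<in>I. a + b \<in> I) \<and> (\<forall>r. \<forall>a\<in>I. r * a \<in> I)"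

definition rprime :: "'a::comm_ring_1 set \<Rightarrow> bool" where
  "rprime P \<longleftrightarrow> rideal P \<and> 1 \<notin> P \<and> (\<forall>a b. a * b \<in> P \<longrightarrow> a \<in> P \<or> b \<in> P)"

definition adjoin :: "'a::comm_ring_1 set \<Rightarrow> 'a \<Rightarrow> 'a set" where
  "adjoin I a = {x + r * a | x r. x \<in> I}"

definition adjoins :: "'a::comm_ring_1 set \<Rightarrow> 'a list \<Rightarrow> 'a set" where
  "adjoins I as = foldl adjoin I as"

definition colon :: "'a::comm_ring_1 set \<Rightarrow> 'a \<Rightarrow> 'a set" where
  "colon I a = {x. a * x \<in> I}"

text \<open>Injectivity of multiplication by \<open>a\<close> on the quotient by \<open>I\<close>.
  Properness of \<open>I\<close> is not demanded, so every element is regular modulo the unit ideal;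
  the induction in \<open>regular_mod_adjoin_power\<close> starts from that case.\<close>

definition regular_mod :: "'a::comm_ring_1 set \<Rightarrow> 'a \<Rightarrow> bool" where
  "regular_mod I a \<longleftrightarrow> (\<forall>c. a * c \<in> I \<longrightarrow> c \<in> I)"

lemma rideal_zero: "rideal I \<Longrightarrow> 0 \<in> I"
  and rideal_add: "rideal I \<Longrightarrow> a \<in> I \<Longrightarrow> b \<in> I \<Longrightarrow> a + b \<in> I"
  and rideal_mult_left: "rideal I \<Longrightarrow> a \<in> I \<Longrightarrow> r * a \<in> I"
  by (auto simp: rideal_def)

lemma rideal_mult_right: "rideal I \<Longrightarrow> a \<in> I \<Longrightarrow> a * r \<in> I"
  using rideal_mult_left[of I a r] by (simp add: mult.commute)

lemma rideal_uminus: "rideal I \<Longrightarrow> a \<in> I \<Longrightarrow> - a \<in> I"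
  using rideal_mult_left[of I a "-1"] by simp

lemma rideal_diff: "rideal I \<Longrightarrow> a \<in> I \<Longrightarrow> b \<in> I \<Longrightarrow> a - b \<in> I"
  using rideal_add[of I a "-b"] rideal_uminus[of I b] by simp

lemma rideal_sum: "rideal I \<Longrightarrow> (\<And>i. i \<in> A \<Longrightarrow> f i \<in> I) \<Longrightarrow> sum f A \<in> I"
  by (induction A rule: infinite_finite_induct) (auto simp: rideal_zero rideal_add)

lemma rideal_one_iff: "rideal I \<Longrightarrow> 1 \<in> I \<longleftrightarrow> I = UNIV"
  using rideal_mult_left[of I 1] by auto

lemma ideal_class_ring_iff: "ideal I (class_ring :: 'a::comm_ring_1 ring) \<longleftrightarrow> rideal I"
proof
  assume "ideal I (class_ring :: 'a ring)"
  then interpret ideal I "class_ring :: 'a ring" .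
  show "rideal I"
    using a_closed I_l_closed additive_subgroup.zero_closed[OF is_additive_subgroup]
    by (auto simp: rideal_def)
next
  assume I: "rideal I"
  show "ideal I (class_ring :: 'a ring)"
  proof (rule idealI)
    show "ring (class_ring :: 'a ring)" by (rule class_ring.ring_axioms)
    have "inv\<^bsub>add_monoid (class_ring :: 'a ring)\<^esub> a = - a" for a
    proof -
      have "\<ominus>\<^bsub>class_ring :: 'a ring\<^esub> a = - a" by (simp add: class_ring_simps)
      then show ?thesis by (simp add: a_inv_def)
    qed
    then show "subgroup I (add_monoid (class_ring :: 'a ring))"
      using I
      by (intro group.subgroupI[OF abelian_group.a_group[OF class_ring.abelian_group_axioms]])
         (auto simp: rideal_add rideal_uminus dest: rideal_zero)
    show "\<And>a x. a \<in> I \<Longrightarrow> x \<in> carrier class_ring \<Longrightarrow> x \<otimes>\<^bsub>class_ring\<^esub> a \<in> I"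
      using rideal_mult_left[OF I] by simp
    show "\<And>a x. a \<in> I \<Longrightarrow> x \<in> carrier class_ring \<Longrightarrow> a \<otimes>\<^bsub>class_ring\<^esub> x \<in> I"
      using rideal_mult_right[OF I] by simp
  qed
qed

lemma primeideal_class_ring_iff: "primeideal P (class_ring :: 'a::comm_ring_1 ring) \<longleftrightarrow> rprime P"
proof
  assume "primeideal P (class_ring :: 'a ring)"
  then interpret primeideal P "class_ring :: 'a ring" .
  show "rprime P"
    using I_notcarr I_prime is_ideal rideal_one_iff[of P] by (auto simp: rprime_def ideal_class_ring_iff)
next
  assume P: "rprime P"
  then have "ideal P (class_ring :: 'a ring)" by (simp add: ideal_class_ring_iff rprime_def)
  then show "primeideal P (class_ring :: 'a ring)"
    by (rule primeidealI) (use P class_cring.is_cring in \<open>auto simp: rprime_def\<close>)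
qed

lemma rprime_rideal: "rprime P \<Longrightarrow> rideal P"
  by (simp add: rprime_def)

lemma rideal_Idl: "rideal (Idl\<^bsub>class_ring\<^esub> S)"
  using ring.genideal_ideal[OF class_ring.ring_axioms, of S] by (simp add: ideal_class_ring_iff)

lemma subset_Idl: "(S :: 'a::comm_ring_1 set) \<subseteq> Idl\<^bsub>class_ring\<^esub> S"
  using ring.genideal_self[OF class_ring.ring_axioms, of S] by simp

lemma Idl_least: "rideal I \<Longrightarrow> S \<subseteq> I \<Longrightarrow> Idl\<^bsub>class_ring\<^esub> S \<subseteq> I"
  using ring.genideal_minimal[OF class_ring.ring_axioms, of I S] by (simp add: ideal_class_ring_iff)

lemma set_add_class_ring: "A <+>\<^bsub>class_ring\<^esub> B = {a + b | a b. a \<in> A \<and> b \<in> B}"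
  by (auto simp: set_add_def set_mult_def)

lemma a_r_coset_class_ring: "I +>\<^bsub>class_ring\<^esub> a = {x + a | x. x \<in> I}"
  by (auto simp: a_r_coset_def r_coset_def)

lemma rideal_set_add:
  assumes "rideal I" "rideal J" shows "rideal {a + b | a b. a \<in> I \<and> b \<in> J}"
  unfolding rideal_def
proof (intro conjI ballI allI)
  show "0 \<in> {a + b | a b. a \<in> I \<and> b \<in> J}"
    using rideal_zero[OF assms(1)] rideal_zero[OF assms(2)] by (metis (mono_tags, lifting) add_0 mem_Collect_eq)
next
  fix x y assume "x \<in> {a + b | a b. a \<in> I \<and> b \<in> J}" "y \<in> {a + b | a b. a \<in> I \<and> b \<in> J}"
  then obtain a b c d where *: "x = a + b" "y = c + d" "a \<in> I" "b \<in> J" "c \<in> I" "d \<in> J" by blast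
  have "x + y = (a + c) + (b + d)" by (simp add: * algebra_simps)
  then show "x + y \<in> {a + b | a b. a \<in> I \<and> b \<in> J}"
    using * rideal_add assms by blast
next
  fix r x assume "x \<in> {a + b | a b. a \<in> I \<and> b \<in> J}"
  then obtain a b where *: "x = a + b" "a \<in> I" "b \<in> J" by blast
  have "r * x = r * a + r * b" by (simp add: * algebra_simps)
  then show "r * x \<in> {a + b | a b. a \<in> I \<and> b \<in> J}"
    using * rideal_mult_left assms by blast
qed

lemma adjoin_alt: "adjoin I a = {x + y | x y. x \<in> I \<and> y \<in> range (\<lambda>r. r * a)}"
  by (auto simp: adjoin_def)

lemma rideal_principal: "rideal (range (\<lambda>r. r * a))"
  unfolding rideal_def
proof (intro conjI ballI allI)
  show "0 \<in> range (\<lambda>r. r * a)" by (rule range_eqI[of _ _ 0]) simp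
next
  fix x y assume "x \<in> range (\<lambda>r. r * a)" "y \<in> range (\<lambda>r. r * a)"
  then obtain r s where "x = r * a" "y = s * a" by blast
  then have "x + y = (r + s) * a" by (simp add: algebra_simps)
  then show "x + y \<in> range (\<lambda>r. r * a)" by blast
next
  fix r x assume "x \<in> range (\<lambda>r. r * a)"
  then obtain s where "x = s * a" by blast
  then have "r * x = (r * s) * a" by (simp add: algebra_simps)
  then show "r * x \<in> range (\<lambda>r. r * a)" by blast
qed

lemma rideal_adjoin: "rideal I \<Longrightarrow> rideal (adjoin I a)"
  unfolding adjoin_alt by (rule rideal_set_add[OF _ rideal_principal])

lemma adjoinE:
  assumes "b \<in> adjoin I a" obtains r where "b - r * a \<in> I"
proof -
  from assms obtain x r where "b = x + r * a" "x \<in> I" unfolding adjoin_def by blast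
  then show thesis using that[of r] by simp
qed

lemma adjoinI: "b - r * a \<in> I \<Longrightarrow> b \<in> adjoin I a"
  unfolding adjoin_def by (rule CollectI, rule exI[of _ "b - r * a"], rule exI[of _ r]) simp

lemma adjoin_self: "rideal I \<Longrightarrow> a \<in> adjoin I a"
  by (rule adjoinI[of _ 1]) (simp add: rideal_zero)

lemma adjoin_superset: "I \<subseteq> adjoin I a"
  using adjoinI[of _ 0 a I] by auto

lemma adjoin_least: "rideal K \<Longrightarrow> I \<subseteq> K \<Longrightarrow> a \<in> K \<Longrightarrow> adjoin I a \<subseteq> K"
  unfolding adjoin_def by (auto intro!: rideal_add rideal_mult_left)

lemma adjoin_mono: "I \<subseteq> J \<Longrightarrow> adjoin I a \<subseteq> adjoin J a"
  unfolding adjoin_def by blast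

lemma adjoin_cong:
  assumes "rideal I" "a - b \<in> I" shows "adjoin I a = adjoin I b"
proof -
  have *: "adjoin I a \<subseteq> adjoin I b" if "a - b \<in> I" for a b
    using that assms(1) rideal_adjoin[OF assms(1), of b] adjoin_superset[of I b]
    by (intro adjoin_least) (auto intro: adjoinI[of _ 1])
  show ?thesis using *[OF assms(2)] *[of b a] rideal_uminus[OF assms] by auto
qed

lemma adjoin_commute:
  assumes "rideal I" shows "adjoin (adjoin I a) b = adjoin (adjoin I b) a"
proof -
  have *: "adjoin (adjoin I a) b \<subseteq> adjoin (adjoin I b) a" for a b
  proof (intro adjoin_least)
    show "rideal (adjoin (adjoin I b) a)" using assms by (intro rideal_adjoin)
    then show "rideal (adjoin (adjoin I b) a)" .
    show "I \<subseteq> adjoin (adjoin I b) a" using adjoin_superset by (metis subset_trans)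
    show "a \<in> adjoin (adjoin I b) a" using assms by (intro adjoin_self rideal_adjoin)
    show "b \<in> adjoin (adjoin I b) a" using adjoin_superset adjoin_self[OF assms] by blast
  qed
  show ?thesis using * by blast
qed

lemma adjoins_Nil [simp]: "adjoins I [] = I"
  and adjoins_Cons: "adjoins I (a # as) = adjoins (adjoin I a) as"
  and adjoins_snoc: "adjoins I (as @ [a]) = adjoin (adjoins I as) a"
  by (simp_all add: adjoins_def)

lemma rideal_adjoins: "rideal I \<Longrightarrow> rideal (adjoins I as)"
  by (induction as arbitrary: I) (auto simp: adjoins_Cons rideal_adjoin)

lemma adjoins_superset: "rideal I \<Longrightarrow> I \<subseteq> adjoins I as"
proof (induction as arbitrary: I)
  case (Cons a as)
  then show ?case using adjoin_superset[of I a] rideal_adjoin[of I a] by (auto simp: adjoins_Cons)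
qed simp

lemma adjoins_mem: "rideal I \<Longrightarrow> a \<in> set as \<Longrightarrow> a \<in> adjoins I as"
proof (induction as arbitrary: I)
  case (Cons b as)
  then show ?case using adjoins_superset[OF rideal_adjoin[OF Cons.prems(1)], of b as] adjoin_self
    by (auto simp: adjoins_Cons rideal_adjoin)
qed simp

lemma adjoins_least: "rideal K \<Longrightarrow> I \<subseteq> K \<Longrightarrow> set as \<subseteq> K \<Longrightarrow> adjoins I as \<subseteq> K"
  by (induction as arbitrary: I) (auto simp: adjoins_Cons adjoin_least)

lemma adjoins_mono: "I \<subseteq> J \<Longrightarrow> adjoins I as \<subseteq> adjoins J as"
  by (induction as arbitrary: I J) (auto simp: adjoins_Cons adjoin_mono)

lemma Idl_Un_eq_adjoins:
  assumes "rideal I" shows "Idl\<^bsub>class_ring\<^esub> (I \<union> set as) = adjoins I as"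
proof
  show "Idl\<^bsub>class_ring\<^esub> (I \<union> set as) \<subseteq> adjoins I as"
    using assms by (intro Idl_least rideal_adjoins) (auto intro: adjoins_mem dest: adjoins_superset)
  show "adjoins I as \<subseteq> Idl\<^bsub>class_ring\<^esub> (I \<union> set as)"
    using subset_Idl by (intro adjoins_least rideal_Idl) blast+
qed

lemma rideal_colon: "rideal I \<Longrightarrow> rideal (colon I a)"
  unfolding rideal_def colon_def by (auto simp: algebra_simps)

lemma colon_superset: "rideal I \<Longrightarrow> I \<subseteq> colon I a"
  unfolding colon_def by (auto intro: rideal_mult_left)

lemma regular_modD: "regular_mod I a \<Longrightarrow> a * c \<in> I \<Longrightarrow> c \<in> I"
  by (simp add: regular_mod_def)

lemma regular_mod_cong:
  assumes "rideal I" "a - b \<in> I" "regular_mod I a" shows "regular_mod I b"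
  unfolding regular_mod_def
proof (intro allI impI)
  fix c assume "b * c \<in> I"
  moreover have "(a - b) * c \<in> I" using assms by (intro rideal_mult_right)
  ultimately have "(a - b) * c + b * c \<in> I" using assms by (intro rideal_add)
  then have "a * c \<in> I" by (simp add: left_diff_distrib)
  then show "c \<in> I" using assms(3) by (simp add: regular_mod_def)
qed

lemma regular_mod_power: "regular_mod I a \<Longrightarrow> regular_mod I (a ^ k)"
proof (induction k)
  case 0
  show ?case by (simp add: regular_mod_def)
next
  case (Suc k)
  show ?case
    unfolding regular_mod_def
  proof (intro allI impI)
    fix c assume "a ^ Suc k * c \<in> I"
    then have "a * (a ^ k * c) \<in> I" by (simp add: mult.assoc)
    then show "c \<in> I" using regular_modD Suc by blast
  qed
qed

section \<open>Chain condition, associated primes and minimal primes\<close>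

definition acc :: "'a::comm_ring_1 itself \<Rightarrow> bool" where
  "acc _ \<longleftrightarrow> wf {(J, I) | I J :: 'a set. rideal I \<and> rideal J \<and> I \<subset> J}"

lemma acc_maximal:
  assumes "acc TYPE('a::comm_ring_1)" "\<And>I. I \<in> \<I> \<Longrightarrow> rideal (I::'a set)" "\<I> \<noteq> {}"
  shows "\<exists>M\<in>\<I>. \<forall>J\<in>\<I>. M \<subseteq> J \<longrightarrow> J = M"
proof -
  obtain I where "I \<in> \<I>" using assms(3) by blast
  from wfE_min[OF assms(1)[unfolded acc_def] this]
  obtain M where M: "M \<in> \<I>" "\<And>J. (J, M) \<in> {(J, I) | I J :: 'a set. rideal I \<and> rideal J \<and> I \<subset> J} \<Longrightarrow> J \<notin> \<I>"
    by blast
  show ?thesis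
  proof (intro bexI[OF _ M(1)] ballI impI)
    fix J assume "J \<in> \<I>" "M \<subseteq> J"
    then show "J = M" using M(2)[of J] assms(2) M(1) by blast
  qed
qed

lemma acc_induct [consumes 2, case_names step]:
  assumes "acc TYPE('a::comm_ring_1)" "rideal (I::'a set)"
    and "\<And>I. rideal I \<Longrightarrow> (\<And>J. rideal J \<Longrightarrow> I \<subset> J \<Longrightarrow> P J) \<Longrightarrow> P I"
  shows "P I"
  using assms(2)
proof (induction I rule: wf_induct_rule[OF assms(1)[unfolded acc_def]])
  case (1 I)
  show ?case
  proof (rule assms(3)[OF 1(2)])
    fix J assume J: "rideal J" "I \<subset> J"
    show "P J" by (rule 1(1)) (use J 1(2) in auto)
  qed
qed

text \<open>A largest annihilator among those of the nonzero multiples of \<open>x\<close> modulo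
  \<open>I\<close> is prime. Starting from a prescribed \<open>x\<close> matters later: whatever
  annihilates \<open>x\<close> lies in the prime found.\<close>

lemma prime_colon_exists:
  fixes I :: "'a::comm_ring_1 set"
  assumes acc: "acc TYPE('a)" and I: "rideal I" and x: "x \<notin> I"
  obtains y where "x * y \<notin> I" "rprime (colon I (x * y))"
proof -
  let ?C = "{colon I (x * y) | y. x * y \<notin> I}"
  have "colon I (x * 1) \<in> ?C" by (rule CollectI, rule exI[of _ 1]) (simp add: x)
  then have ne: "?C \<noteq> {}" by blast
  have id: "rideal J" if "J \<in> ?C" for J using that I rideal_colon by auto
  obtain M where M: "M \<in> ?C" "\<And>J. J \<in> ?C \<Longrightarrow> M \<subseteq> J \<Longrightarrow> J = M"
    using acc_maximal[OF acc id ne] by meson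
  then obtain y where y: "M = colon I (x * y)" "x * y \<notin> I" by blast
  have "rprime M"
    unfolding rprime_def
  proof (intro conjI allI impI)
    show "rideal M" using id M(1) by blast
    show "1 \<notin> M" using y by (simp add: colon_def)
    fix a b assume ab: "a * b \<in> M"
    show "a \<in> M \<or> b \<in> M"
    proof (rule disjCI)
      assume b: "b \<notin> M"
      then have "x * (y * b) \<notin> I" by (simp add: y colon_def mult.assoc)
      then have "colon I (x * (y * b)) \<in> ?C" by blast
      moreover have "M \<subseteq> colon I (x * (y * b))"
      proof
        fix z assume "z \<in> M"
        then have "b * (x * y * z) \<in> I" using I by (simp add: y colon_def rideal_mult_left)
        moreover have "b * (x * y * z) = x * (y * b) * z" by (simp add: ac_simps)
        ultimately show "z \<in> colon I (x * (y * b))" by (simp add: colon_def)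
      qed
      ultimately have "colon I (x * (y * b)) = M" using M(2) by blast
      moreover have "x * (y * b) * a = x * y * (a * b)" by (simp add: ac_simps)
      with ab have "a \<in> colon I (x * (y * b))" by (simp only: colon_def y mem_Collect_eq)
      ultimately show "a \<in> M" by simp
    qed
  qed
  then show thesis using that y by blast
qed

text \<open>Minimal primes are associated, shown without localization: a largest
  \<open>colon I s\<close> with \<open>s\<close> outside \<open>P\<close> is not enlarged by
  dividing by further elements outside \<open>P\<close>. Hence every prime annihilator modulo it
  lies in \<open>P\<close>, and minimality gives equality.\<close>

lemma minimal_prime_is_colon:
  fixes I :: "'a::comm_ring_1 set"
  assumes acc: "acc TYPE('a)" and I: "rideal I" and P: "rprime P" "I \<subseteq> P"
    and min: "\<And>Q. rprime Q \<Longrightarrow> I \<subseteq> Q \<Longrightarrow> Q \<subseteq> P \<Longrightarrow> Q = P"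
  obtains y where "y \<notin> I" "P = colon I y"
proof -
  let ?C = "{colon I s | s. s \<notin> P}"
  have "colon I 1 \<in> ?C" by (rule CollectI, rule exI[of _ 1]) (use P(1) in \<open>simp add: rprime_def\<close>)
  then have ne: "?C \<noteq> {}" by blast
  have id: "rideal J" if "J \<in> ?C" for J using that I rideal_colon by auto
  obtain Q where Q: "Q \<in> ?C" "\<And>J. J \<in> ?C \<Longrightarrow> Q \<subseteq> J \<Longrightarrow> J = Q"
    using acc_maximal[OF acc id ne] by meson
  then obtain s where s: "Q = colon I s" "s \<notin> P" by blast
  have QP: "Q \<subseteq> P" using s P by (auto simp: colon_def rprime_def)
  then have "1 \<notin> Q" using P(1) by (auto simp: rprime_def)
  then obtain b where b: "1 * b \<notin> Q" "rprime (colon Q (1 * b))"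
    using prime_colon_exists[OF acc id[OF Q(1)]] by blast
  have eq: "colon Q s' = Q" if "s' \<notin> P" for s'
  proof -
    have "s * s' \<notin> P" using s(2) that P(1) by (auto simp: rprime_def)
    moreover have "colon Q s' = colon I (s * s')" by (simp add: s colon_def mult.assoc)
    ultimately show ?thesis using Q colon_superset[OF id[OF Q(1)], of s'] by blast
  qed
  have "colon Q b \<subseteq> P"
  proof
    fix x assume "x \<in> colon Q b"
    then have bx: "b \<in> colon Q x" by (simp add: colon_def mult.commute)
    show "x \<in> P"
    proof (rule ccontr)
      assume "x \<notin> P" from eq[OF this] bx b(1) show False by simp
    qed
  qed
  moreover have "I \<subseteq> colon Q b"
    using colon_superset[OF id[OF Q(1)], of b] colon_superset[OF I, of s] s by blast
  ultimately have "colon Q b = P" using min b(2) by simp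
  moreover have "colon Q b = colon I (s * b)" by (simp add: s colon_def mult.assoc)
  moreover have "s * b \<notin> I" using b(1) by (simp add: s colon_def)
  ultimately show thesis using that by blast
qed

text \<open>Noetherian induction: if \<open>a * b\<close> is in \<open>I\<close> but neither factor
  is, the lists for \<open>adjoin I a\<close> and \<open>adjoin I b\<close> concatenate to one for
  \<open>I\<close>. This finite list, possibly with repetitions, does the work of a primary
  decomposition; the empty list serves the unit ideal.\<close>

lemma primes_product_in_ideal:
  fixes I :: "'a::comm_ring_1 set"
  assumes acc: "acc TYPE('a)" and I: "rideal I"
  shows "\<exists>Ps. (\<forall>P\<in>set Ps. rprime P \<and> I \<subseteq> P) \<and>
    (\<forall>xs. length xs = length Ps \<longrightarrow> (\<forall>i<length Ps. xs ! i \<in> Ps ! i) \<longrightarrow> prod_list xs \<in> I)"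
  using acc I
proof (induction I rule: acc_induct)
  case (step I)
  show ?case
  proof (cases "1 \<in> I \<or> rprime I")
    case True
    then show ?thesis
    proof
      assume "1 \<in> I" then show ?thesis by (intro exI[of _ "[]"]) auto
    next
      assume "rprime I" then show ?thesis
        by (intro exI[of _ "[I]"]) (auto simp: length_Suc_conv)
    qed
  next
    case False
    then obtain a b where ab: "a * b \<in> I" "a \<notin> I" "b \<notin> I" using step(1) by (auto simp: rprime_def)
    have "I \<subset> adjoin I a" "I \<subset> adjoin I b"
      using ab adjoin_self[OF step(1)] adjoin_superset[of I] by blast+
    note IH = step(2)[OF rideal_adjoin[OF step(1)] this(1)] step(2)[OF rideal_adjoin[OF step(1)] this(2)]
    from IH(1) obtain Ps where
      Ps: "\<forall>P\<in>set Ps. rprime P \<and> adjoin I a \<subseteq> P"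
        "\<And>xs. length xs = length Ps \<Longrightarrow> (\<forall>i<length Ps. xs ! i \<in> Ps ! i) \<Longrightarrow> prod_list xs \<in> adjoin I a"
      by blast
    from IH(2) obtain Qs where
      Qs: "\<forall>P\<in>set Qs. rprime P \<and> adjoin I b \<subseteq> P"
        "\<And>xs. length xs = length Qs \<Longrightarrow> (\<forall>i<length Qs. xs ! i \<in> Qs ! i) \<Longrightarrow> prod_list xs \<in> adjoin I b"
      by blast
    show ?thesis
    proof (intro exI[of _ "Ps @ Qs"] conjI allI impI)
      show "\<forall>P\<in>set (Ps @ Qs). rprime P \<and> I \<subseteq> P"
        using Ps(1) Qs(1) adjoin_superset[of I] by fastforce
      fix xs assume xs: "length xs = length (Ps @ Qs)" "\<forall>i<length (Ps @ Qs). xs ! i \<in> (Ps @ Qs) ! i"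
      define us vs where "us = take (length Ps) xs" and "vs = drop (length Ps) xs"
      have "prod_list us \<in> adjoin I a"
      proof (rule Ps(2))
        show "\<forall>i<length Ps. us ! i \<in> Ps ! i"
        proof (intro allI impI)
          fix i assume i: "i < length Ps"
          then have "xs ! i \<in> (Ps @ Qs) ! i" using xs(2) by simp
          then show "us ! i \<in> Ps ! i" using i by (simp add: us_def nth_append)
        qed
      qed (use xs in \<open>simp add: us_def\<close>)
      moreover have "prod_list vs \<in> adjoin I b"
      proof (rule Qs(2))
        show "\<forall>i<length Qs. vs ! i \<in> Qs ! i"
        proof (intro allI impI)
          fix i assume i: "i < length Qs"
          then have "xs ! (length Ps + i) \<in> (Ps @ Qs) ! (length Ps + i)"
            using spec[OF xs(2), of "length Ps + i"] by simp
          then show "vs ! i \<in> Qs ! i" using xs(1) i by (simp add: vs_def)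
        qed
      qed (use xs in \<open>simp add: vs_def\<close>)
      ultimately obtain r s where rs: "prod_list us - r * a \<in> I" "prod_list vs - s * b \<in> I"
        by (meson adjoinE)
      have "prod_list us * prod_list vs = (prod_list us - r * a) * prod_list vs
          + (prod_list vs - s * b) * (r * a) + (r * s) * (a * b)" by (simp add: algebra_simps)
      also have "\<dots> \<in> I" using rs ab(1) rideal_add rideal_mult_right rideal_mult_left step(1) by metis
      finally show "prod_list xs \<in> I"
        unfolding us_def vs_def by (metis append_take_drop_id prod_list.append)
    qed
  qed
qed

section \<open>Quotient rings\<close>

abbreviation coset :: "'a::comm_ring_1 set \<Rightarrow> 'a \<Rightarrow> 'a set" where
  "coset I a \<equiv> I +>\<^bsub>class_ring\<^esub> a"

lemma coset_hom:
  assumes "rideal (I::'a::comm_ring_1 set)"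
  shows "ring_hom_ring class_ring (class_ring Quot I) (coset I)"
  using ideal.rcos_ring_hom_ring[of I "class_ring :: 'a ring"] assms by (simp add: ideal_class_ring_iff)

lemma carrier_Quot: "carrier (class_ring Quot I) = range (coset (I::'a::comm_ring_1 set))"
  by (auto simp: FactRing_def A_RCOSETS_def RCOSETS_def a_r_coset_def)

lemma coset_mult:
  assumes "rideal (I::'a::comm_ring_1 set)"
  shows "coset I a \<otimes>\<^bsub>class_ring Quot I\<^esub> coset I b = coset I (a * b)"
  using ring_hom_mult[OF ring_hom_ring.homh[OF coset_hom[OF assms]], of a b] by simp

lemma coset_eq_iff:
  assumes "rideal (I::'a::comm_ring_1 set)"
  shows "coset I a = coset I b \<longleftrightarrow> a - b \<in> I"
proof
  assume "coset I a = coset I b"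
  moreover have "a \<in> coset I a" using rideal_zero[OF assms] by (force simp: a_r_coset_class_ring)
  ultimately obtain x where "a = x + b" "x \<in> I" by (auto simp: a_r_coset_class_ring)
  then show "a - b \<in> I" by simp
next
  have *: "coset I a \<subseteq> coset I b" if "a - b \<in> I" for a b
  proof
    fix y assume "y \<in> coset I a"
    then obtain x where x: "x \<in> I" "y = x + a" by (auto simp: a_r_coset_class_ring)
    then have "y = (x + (a - b)) + b" "x + (a - b) \<in> I" using that rideal_add[OF assms] by auto
    then show "y \<in> coset I b" unfolding a_r_coset_class_ring by blast
  qed
  assume "a - b \<in> I"
  then show "coset I a = coset I b" using *[of a b] *[of b a] rideal_uminus[OF assms, of "a - b"] by auto
qed

lemma coset_mem_image_iff:
  assumes "rideal (I::'a::comm_ring_1 set)" "rideal P" "I \<subseteq> P"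
  shows "coset I a \<in> coset I ` P \<longleftrightarrow> a \<in> P"
proof
  assume "coset I a \<in> coset I ` P"
  then obtain b where "b \<in> P" "coset I a = coset I b" by blast
  then have "a - b \<in> P" "b \<in> P" using coset_eq_iff[OF assms(1)] assms(3) by auto
  then have "(a - b) + b \<in> P" by (rule rideal_add[OF assms(2)])
  then show "a \<in> P" by simp
qed simp

lemma ideal_Quot_image:
  assumes "rideal (I::'a::comm_ring_1 set)" "rideal P"
  shows "ideal (coset I ` P) (class_ring Quot I)"
  using ring.ring_ideal_imp_quot_ideal[OF class_ring.ring_axioms, of I P] assms
  by (simp add: ideal_class_ring_iff)

lemma rideal_vimage_coset:
  assumes "rideal (I::'a::comm_ring_1 set)" "ideal Q (class_ring Quot I)"
  shows "rideal {a. coset I a \<in> Q}" "I \<subseteq> {a. coset I a \<in> Q}"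
proof -
  show "rideal {a. coset I a \<in> Q}"
    using ring_hom_ring.ideal_vimage[OF coset_hom[OF assms(1)] assms(2)]
    by (simp add: ideal_class_ring_iff)
  have "coset I 0 \<in> Q"
    using additive_subgroup.zero_closed[OF ideal.axioms(1)[OF assms(2)]]
      ring_hom_zero[OF ring_hom_ring.homh[OF coset_hom[OF assms(1)]] class_ring.ring_axioms
        ring_hom_ring.axioms(2)[OF coset_hom[OF assms(1)]]] by simp
  then show "I \<subseteq> {a. coset I a \<in> Q}"
    using coset_eq_iff[OF assms(1), of _ 0] by (metis (mono_tags, lifting) diff_zero mem_Collect_eq subsetI)
qed

lemma cring_Quot: "rideal (I::'a::comm_ring_1 set) \<Longrightarrow> cring (class_ring Quot I)"
  using ideal.quotient_is_cring[of I "class_ring :: 'a ring"] class_cring.is_cring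
  by (simp add: ideal_class_ring_iff)

lemma primeideal_Quot_image:
  assumes "rideal (I::'a::comm_ring_1 set)" "rprime P" "I \<subseteq> P"
  shows "primeideal (coset I ` P) (class_ring Quot I)"
proof (rule primeidealI[OF ideal_Quot_image cring_Quot])
  have P: "rideal P" using assms(2) by (simp add: rprime_def)
  note mem = coset_mem_image_iff[OF assms(1) P assms(3)]
  have "coset I 1 \<in> carrier (class_ring Quot I)" by (simp add: carrier_Quot)
  moreover have "coset I 1 \<notin> coset I ` P" using assms(2) mem by (auto simp: rprime_def)
  ultimately show "carrier (class_ring Quot I) \<noteq> coset I ` P" by blast
  fix A B assume "A \<in> carrier (class_ring Quot I)" "B \<in> carrier (class_ring Quot I)"
    and AB: "A \<otimes>\<^bsub>class_ring Quot I\<^esub> B \<in> coset I ` P"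
  then obtain a b where "A = coset I a" "B = coset I b" by (auto simp: carrier_Quot)
  then show "A \<in> coset I ` P \<or> B \<in> coset I ` P"
    using AB mem assms(2) unfolding rprime_def by (metis coset_mult[OF assms(1)])
qed (use assms in \<open>auto simp: rprime_def\<close>)

lemma rprime_vimage_coset:
  assumes "rideal (I::'a::comm_ring_1 set)" "primeideal Q (class_ring Quot I)"
  shows "rprime {a. coset I a \<in> Q}"
  using ring_hom_ring.primeideal_vimage[OF coset_hom[OF assms(1)] class_cring.is_cring assms(2)]
  by (simp add: primeideal_class_ring_iff)

section \<open>Chains of primes and the Krull dimension of a quotient\<close>

definition prime_chain :: "'a::comm_ring_1 set \<Rightarrow> nat \<Rightarrow> bool" where
  "prime_chain I k \<longleftrightarrow> (\<exists>P :: nat \<Rightarrow> 'a set.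
     (\<forall>i\<le>k. rprime (P i) \<and> I \<subseteq> P i) \<and> (\<forall>i<k. P i \<subset> P (Suc i)))"

text \<open>Primes of the quotient correspond to primes above \<open>I\<close>, so chains can stay
  in the ring itself. The index of \<open>prime_chain\<close> counts strict inclusions; the negation
  of \<open>prime_chain I 1\<close> therefore means dimension at most 0 and includes the unit
  ideal.\<close>

lemma krull_dim_Quot:
  assumes I: "rideal (I::'a::comm_ring_1 set)"
  shows "krull_dim (class_ring Quot I) = Sup {enat k | k. prime_chain I k}"
proof -
  have "(\<exists>P :: nat \<Rightarrow> 'a set set. (\<forall>i\<le>k. primeideal (P i) (class_ring Quot I)) \<and> (\<forall>i<k. P i \<subset> P (Suc i)))
      \<longleftrightarrow> prime_chain I k" for k
  proof
    assume "\<exists>P. (\<forall>i\<le>k. primeideal (P i) (class_ring Quot I)) \<and> (\<forall>i<k. P i \<subset> P (Suc i))"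
    then obtain P where P: "\<And>i. i \<le> k \<Longrightarrow> primeideal (P i) (class_ring Quot I)"
      "\<And>i. i < k \<Longrightarrow> P i \<subset> P (Suc i)" by blast
    show "prime_chain I k"
      unfolding prime_chain_def
    proof (intro exI[of _ "\<lambda>i. {a. coset I a \<in> P i}"] conjI allI impI)
      fix i assume "i \<le> k"
      then show "rprime {a. coset I a \<in> P i}" "I \<subseteq> {a. coset I a \<in> P i}"
        using rprime_vimage_coset[OF I P(1)] rideal_vimage_coset[OF I primeideal.axioms(1)[OF P(1)]] by blast+
    next
      fix i assume i: "i < k"
      then obtain A where A: "A \<in> P (Suc i)" "A \<notin> P i" using P(2) by blast
      have "A \<in> carrier (class_ring Quot I)"
        using ideal.Icarr[OF primeideal.axioms(1)[OF P(1)] A(1)] i by simp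
      then obtain a where "A = coset I a" by (auto simp: carrier_Quot)
      then show "{a. coset I a \<in> P i} \<subset> {a. coset I a \<in> P (Suc i)}" using A P(2)[OF i] by blast
    qed
  next
    assume "prime_chain I k"
    then obtain P where P: "\<And>i. i \<le> k \<Longrightarrow> rprime (P i)" "\<And>i. i \<le> k \<Longrightarrow> I \<subseteq> P i"
      "\<And>i. i < k \<Longrightarrow> P i \<subset> P (Suc i)" unfolding prime_chain_def by blast
    show "\<exists>P. (\<forall>i\<le>k. primeideal (P i) (class_ring Quot I)) \<and> (\<forall>i<k. P i \<subset> P (Suc i))"
    proof (intro exI[of _ "\<lambda>i. coset I ` P i"] conjI allI impI)
      fix i assume "i \<le> k"
      then show "primeideal (coset I ` P i) (class_ring Quot I)"
        using primeideal_Quot_image[OF I] P by blast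
    next
      fix i assume i: "i < k"
      then obtain a where a: "a \<in> P (Suc i)" "a \<notin> P i" using P(3) by blast
      then have "coset I a \<notin> coset I ` P i"
        using coset_mem_image_iff[OF I rprime_rideal[OF P(1)] P(2)] i by simp
      then show "coset I ` P i \<subset> coset I ` P (Suc i)" using a P(3)[OF i] by blast
    qed
  qed
  then show ?thesis unfolding krull_dim_def by simp
qed

lemma prime_chain_mono: "prime_chain J k \<Longrightarrow> I \<subseteq> J \<Longrightarrow> prime_chain I k"
  unfolding prime_chain_def by (meson subset_trans)

lemma prime_chain_le: "prime_chain I k \<Longrightarrow> j \<le> k \<Longrightarrow> prime_chain I j"
  unfolding prime_chain_def by (meson dual_order.trans order_less_le_trans)

text \<open>Positivity of \<open>d\<close> sets the unit ideal apart, which has no chain at all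
  although the supremum of the empty set is 0.\<close>

lemma krull_dim_Quot_eq_iff:
  assumes I: "rideal (I::'a::comm_ring_1 set)" and d: "0 < d"
  shows "krull_dim (class_ring Quot I) = enat d \<longleftrightarrow> prime_chain I d \<and> \<not> prime_chain I (Suc d)"
proof
  assume eq: "krull_dim (class_ring Quot I) = enat d"
  have le: "k \<le> d" if "prime_chain I k" for k
  proof -
    have "enat k \<le> Sup {enat k | k. prime_chain I k}" by (rule Sup_upper) (use that in blast)
    then show ?thesis using eq krull_dim_Quot[OF I] by simp
  qed
  have "prime_chain I d"
  proof (rule ccontr)
    assume n: "\<not> prime_chain I d"
    have "Sup {enat k | k. prime_chain I k} \<le> enat (d - 1)"
    proof (rule Sup_least)
      fix x assume "x \<in> {enat k | k. prime_chain I k}"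
      then obtain k where "x = enat k" "prime_chain I k" by blast
      then show "x \<le> enat (d - 1)" using le[of k] n by (cases "k = d") auto
    qed
    then show False using eq krull_dim_Quot[OF I] d by simp
  qed
  then show "prime_chain I d \<and> \<not> prime_chain I (Suc d)" using le by fastforce
next
  assume *: "prime_chain I d \<and> \<not> prime_chain I (Suc d)"
  have "Sup {enat k | k. prime_chain I k} = enat d"
  proof (rule antisym)
    show "Sup {enat k | k. prime_chain I k} \<le> enat d"
    proof (rule Sup_least)
      fix x assume "x \<in> {enat k | k. prime_chain I k}"
      then obtain k where "x = enat k" "prime_chain I k" by blast
      then show "x \<le> enat d" using * prime_chain_le[of I k "Suc d"] by (cases "k \<le> d") auto
    qed
    show "enat d \<le> Sup {enat k | k. prime_chain I k}" by (rule Sup_upper) (use * in blast)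
  qed
  then show "krull_dim (class_ring Quot I) = enat d" using krull_dim_Quot[OF I] by simp
qed

lemma Idl_Quot_coset:
  assumes I: "rideal (I::'a::comm_ring_1 set)"
  shows "Idl\<^bsub>class_ring Quot I\<^esub> (coset I ` set as) = coset I ` adjoins I as"
proof -
  interpret Q: cring "class_ring Quot I" by (rule cring_Quot[OF I])
  have sub: "coset I ` set as \<subseteq> carrier (class_ring Quot I)" by (auto simp: carrier_Quot)
  show ?thesis
  proof
    show "Idl\<^bsub>class_ring Quot I\<^esub> (coset I ` set as) \<subseteq> coset I ` adjoins I as"
      using adjoins_mem[OF I] by (intro Q.genideal_minimal ideal_Quot_image I rideal_adjoins) blast
    let ?K = "{a. coset I a \<in> Idl\<^bsub>class_ring Quot I\<^esub> (coset I ` set as)}"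
    have "adjoins I as \<subseteq> ?K"
      using rideal_vimage_coset[OF I Q.genideal_ideal[OF sub]] Q.genideal_self[OF sub]
      by (intro adjoins_least) auto
    then show "coset I ` adjoins I as \<subseteq> Idl\<^bsub>class_ring Quot I\<^esub> (coset I ` set as)" by blast
  qed
qed

section \<open>Regular sequences modulo an ideal\<close>

definition weakly_regular :: "'a::comm_ring_1 set \<Rightarrow> 'a list \<Rightarrow> bool" where
  "weakly_regular I as \<longleftrightarrow> (\<forall>i<length as. regular_mod (adjoins I (take i as)) (as ! i))"

lemma weakly_regular_Nil [simp]: "weakly_regular I []"
  by (simp add: weakly_regular_def)

lemma weakly_regular_Cons:
  "weakly_regular I (a # as) \<longleftrightarrow> regular_mod I a \<and> weakly_regular (adjoin I a) as"
  by (auto simp: weakly_regular_def All_less_Suc2 adjoins_Cons)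

text \<open>\<open>weakly_regular\<close> holds only the cancellation conditions. Properness is a
  separate conjunct because it is checked differently, by inclusion in the irrelevant ideal.\<close>

lemma regular_sequence_Quot:
  assumes I: "rideal (I::'a::comm_ring_1 set)"
  shows "regular_sequence (class_ring Quot I) (map (coset I) as) \<longleftrightarrow>
    weakly_regular I as \<and> adjoins I as \<noteq> UNIV"
proof -
  have mem: "coset I a \<in> coset I ` adjoins I bs \<longleftrightarrow> a \<in> adjoins I bs" for a bs
    by (rule coset_mem_image_iff[OF I rideal_adjoins[OF I] adjoins_superset[OF I]])
  have idl: "Idl\<^bsub>class_ring Quot I\<^esub> (set (map (coset I) bs)) = coset I ` adjoins I bs" for bs
    using Idl_Quot_coset[OF I] by simp
  have "(coset I ` adjoins I as = carrier (class_ring Quot I)) \<longleftrightarrow> adjoins I as = UNIV"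
    using mem[of _ as] by (auto simp: carrier_Quot)
  moreover have "(\<forall>A\<in>carrier (class_ring Quot I). A \<otimes>\<^bsub>class_ring Quot I\<^esub> coset I b \<in> coset I ` adjoins I bs
      \<longrightarrow> A \<in> coset I ` adjoins I bs) \<longleftrightarrow> regular_mod (adjoins I bs) b" for b bs
    by (simp add: carrier_Quot coset_mult[OF I] mem regular_mod_def mult.commute)
  ultimately show ?thesis
    unfolding regular_sequence_def weakly_regular_def
    by (auto simp: take_map idl carrier_Quot simp del: set_map) auto
qed

section \<open>The grading of the polynomial ring\<close>

definition mdeg :: "('n::finite \<Rightarrow>\<^sub>0 nat) \<Rightarrow> nat" where
  "mdeg m = (\<Sum>i\<in>UNIV. Poly_Mapping.lookup m i)"

lemma mdeg_zero [simp]: "mdeg 0 = 0"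
  and mdeg_add: "mdeg (a + b) = mdeg a + mdeg b"
  by (simp_all add: mdeg_def lookup_add sum.distrib)

lemma mdeg_single [simp]: "mdeg (Poly_Mapping.single i k) = k"
  unfolding mdeg_def lookup_single when_def by simp

lemma mdeg_eq_0_iff: "mdeg m = 0 \<longleftrightarrow> m = 0"
  by (auto simp: mdeg_def intro: poly_mapping_eqI)

lemma homogeneous_iff: "homogeneous d p \<longleftrightarrow> (\<forall>m\<in>Poly_Mapping.keys p. mdeg m = d)"
  by (simp add: homogeneous_def mdeg_def)

lift_definition hcomp :: "nat \<Rightarrow> ('n::finite, 'k::comm_ring_1) mpoly \<Rightarrow> ('n, 'k) mpoly"
  is "\<lambda>d p m. if mdeg m = d then p m else 0"
  by (rule finite_subset) auto

lemma lookup_hcomp: "Poly_Mapping.lookup (hcomp d p) m = (if mdeg m = d then Poly_Mapping.lookup p m else 0)"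
  by transfer simp

lemma homogeneous_alt: "homogeneous d p \<longleftrightarrow> (\<forall>m. Poly_Mapping.lookup p m \<noteq> 0 \<longrightarrow> mdeg m = d)"
  by (auto simp: homogeneous_iff in_keys_iff)

lemma homogeneous_hcomp [simp]: "homogeneous d (hcomp d p)"
  by (auto simp: homogeneous_alt lookup_hcomp)

lemma hcomp_homogeneous: "homogeneous d p \<Longrightarrow> hcomp e p = (if e = d then p else 0)"
  by (auto simp: homogeneous_alt lookup_hcomp intro!: poly_mapping_eqI)

lemma hcomp_zero [simp]: "hcomp d 0 = 0"
  and hcomp_add: "hcomp d (p + q) = hcomp d p + hcomp d q"
  and hcomp_diff: "hcomp d (p - q) = hcomp d p - hcomp d q"
  by (auto simp: lookup_hcomp lookup_add lookup_minus intro!: poly_mapping_eqI)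

lemma hcomp_sum: "hcomp d (sum f A) = (\<Sum>a\<in>A. hcomp d (f a))"
  by (induction A rule: infinite_finite_induct) (auto simp: hcomp_add)

lemma sum_hcomp:
  assumes "\<And>m. m \<in> Poly_Mapping.keys p \<Longrightarrow> mdeg m < D"
  shows "p = (\<Sum>d<D. hcomp d p)"
proof (rule poly_mapping_eqI)
  fix m
  show "Poly_Mapping.lookup p m = Poly_Mapping.lookup (\<Sum>d<D. hcomp d p) m"
    using assms[of m] by (auto simp: lookup_sum lookup_hcomp in_keys_iff sum.delta')
qed

lemma sum_hcomp_ex: "\<exists>D. p = (\<Sum>d<D. hcomp d p)"
proof -
  have "mdeg m < Suc (Max (mdeg ` Poly_Mapping.keys p))" if "m \<in> Poly_Mapping.keys p" for m
    using that by (simp add: le_imp_less_Suc)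
  then show ?thesis using sum_hcomp by blast
qed

lemma homogeneous_zero [simp]: "homogeneous d 0"
  by (simp add: homogeneous_alt)

lemma homogeneous_add: "homogeneous d p \<Longrightarrow> homogeneous d q \<Longrightarrow> homogeneous d (p + q)"
  by (auto simp: homogeneous_alt lookup_add) (metis add.right_neutral)

lemma homogeneous_uminus: "homogeneous d p \<Longrightarrow> homogeneous d (- p)"
  by (auto simp: homogeneous_alt)

lemma homogeneous_sum: "(\<And>a. a \<in> A \<Longrightarrow> homogeneous d (f a)) \<Longrightarrow> homogeneous d (sum f A)"
  by (induction A rule: infinite_finite_induct) (auto intro: homogeneous_add)

lemma homogeneous_mult: "homogeneous d p \<Longrightarrow> homogeneous e q \<Longrightarrow> homogeneous (d + e) (p * q)"
  using keys_mult[of p q] by (fastforce simp: homogeneous_iff mdeg_add)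

lemma homogeneous_one [simp]: "homogeneous 0 1"
  by (simp add: homogeneous_iff)

lemma homogeneous_single [simp]: "homogeneous (mdeg m) (Poly_Mapping.single m c)"
  by (auto simp: homogeneous_iff)

lemma homogeneous_Var [simp]: "homogeneous 1 (Var i)"
  unfolding Var_def by (metis homogeneous_single mdeg_single)

lemma homogeneous_power: "homogeneous d p \<Longrightarrow> homogeneous (k * d) (p ^ k)"
  by (induction k) (auto intro: homogeneous_mult)

lemma homogeneous_prod:
  "(\<And>a. a \<in> A \<Longrightarrow> homogeneous (d a) (f a)) \<Longrightarrow> homogeneous (sum d A) (prod f A)"
  by (induction A rule: infinite_finite_induct) (auto intro: homogeneous_mult)

lemma homogeneous_const: "homogeneous 0 (Poly_Mapping.single 0 c)"
  using homogeneous_single[of 0 c] by simp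

lemma homogeneous_scale: "homogeneous d p \<Longrightarrow> homogeneous d (Poly_Mapping.single 0 c * p)"
  using homogeneous_mult[OF homogeneous_const, of d p c] by simp

lemma hcomp_mult_homogeneous:
  assumes "homogeneous d p"
  shows "hcomp e (p * q) = (if d \<le> e then p * hcomp (e - d) q else 0)"
proof -
  obtain D where D: "q = (\<Sum>i<D. hcomp i q)" using sum_hcomp_ex by blast
  have "hcomp e (p * hcomp i q) = (if e = d + i then p * hcomp i q else 0)" for i
    using hcomp_homogeneous[OF homogeneous_mult[OF assms homogeneous_hcomp]] by simp
  then have "hcomp e (p * q) = (\<Sum>i<D. if e = d + i then p * hcomp i q else 0)"
    by (subst D) (simp add: sum_distrib_left hcomp_sum)
  also have "\<dots> = (if d \<le> e then p * hcomp (e - d) q else 0)"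
  proof (cases "d \<le> e")
    case True
    have "hcomp i q = 0" if "D \<le> i" for i
      using that by (subst D) (simp add: hcomp_sum hcomp_homogeneous[OF homogeneous_hcomp])
    moreover have "(e = d + i) = (i = e - d)" for i using True by auto
    ultimately show ?thesis using True by (auto simp: sum.delta)
  qed auto
  finally show ?thesis .
qed

text \<open>Closure under homogeneous components, instead of generation by homogeneous elements, is
  the form in which membership can be tested degree by degree; \<open>homogeneous_ideal_iff\<close>
  shows that the two agree.\<close>

definition hideal :: "('n::finite, 'k::comm_ring_1) mpoly set \<Rightarrow> bool" where
  "hideal I \<longleftrightarrow> rideal I \<and> (\<forall>p\<in>I. \<forall>d. hcomp d p \<in> I)"

lemma hideal_rideal: "hideal I \<Longrightarrow> rideal I"
  by (simp add: hideal_def)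

lemma hideal_hcomp: "hideal I \<Longrightarrow> p \<in> I \<Longrightarrow> hcomp d p \<in> I"
  by (simp add: hideal_def)

lemma hideal_mem_iff:
  assumes "hideal I" shows "p \<in> I \<longleftrightarrow> (\<forall>d. hcomp d p \<in> I)"
proof
  assume *: "\<forall>d. hcomp d p \<in> I"
  obtain D where D: "p = (\<Sum>d<D. hcomp d p)" using sum_hcomp_ex by blast
  have "(\<Sum>d<D. hcomp d p) \<in> I" using assms * by (intro rideal_sum) (auto simp: hideal_def)
  then show "p \<in> I" using D by simp
qed (use assms in \<open>auto simp: hideal_def\<close>)

text \<open>The polynomials all of whose components lie in the ideal form an ideal themselves, and
  it contains the generators.\<close>

lemma hideal_Idl:
  assumes "\<And>p. p \<in> S \<Longrightarrow> \<exists>d. homogeneous d p"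
  shows "hideal (Idl\<^bsub>class_ring\<^esub> (S :: ('n::finite, 'k::comm_ring_1) mpoly set))"
proof -
  let ?I = "Idl\<^bsub>class_ring\<^esub> S" and ?K = "{p. \<forall>d. hcomp d p \<in> Idl\<^bsub>class_ring\<^esub> S}"
  note I = rideal_Idl[of S]
  have "rideal ?K"
    unfolding rideal_def
  proof (intro conjI ballI allI)
    show "0 \<in> ?K" using I by (simp add: rideal_zero)
    show "a + b \<in> ?K" if "a \<in> ?K" "b \<in> ?K" for a b
      using that I by (auto simp: hcomp_add rideal_add)
    fix r a assume a: "a \<in> ?K"
    show "r * a \<in> ?K"
    proof safe
      fix d
      obtain D where D: "r = (\<Sum>i<D. hcomp i r)" using sum_hcomp_ex by blast
      have "hcomp d (r * a) = (\<Sum>i<D. hcomp d (hcomp i r * a))"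
        by (subst D) (simp add: sum_distrib_right hcomp_sum)
      also have "\<dots> \<in> ?I"
        using a I by (intro rideal_sum) (auto simp: hcomp_mult_homogeneous[OF homogeneous_hcomp] rideal_mult_left rideal_zero)
      finally show "hcomp d (r * a) \<in> ?I" .
    qed
  qed
  moreover have "S \<subseteq> ?K"
  proof safe
    fix p d assume "p \<in> S"
    then obtain e where "homogeneous e p" using assms by blast
    then show "hcomp d p \<in> ?I"
      using \<open>p \<in> S\<close> subset_Idl[of S] rideal_zero[OF I] by (auto simp: hcomp_homogeneous)
  qed
  ultimately have "?I \<subseteq> ?K" by (rule Idl_least)
  then show ?thesis using I by (auto simp: hideal_def)
qed

lemma homogeneous_ideal_iff: "homogeneous_ideal I \<longleftrightarrow> hideal I"
proof
  assume "homogeneous_ideal I" then show "hideal I"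
    unfolding homogeneous_ideal_def using hideal_Idl by blast
next
  assume I: "hideal I"
  let ?S = "{p\<in>I. \<exists>d. homogeneous d p}"
  have "p \<in> Idl\<^bsub>class_ring\<^esub> ?S" if "p \<in> I" for p
  proof -
    obtain D where D: "p = (\<Sum>d<D. hcomp d p)" using sum_hcomp_ex by blast
    have "hcomp d p \<in> ?S" for d using hideal_hcomp[OF I that] homogeneous_hcomp by blast
    then have "hcomp d p \<in> Idl\<^bsub>class_ring\<^esub> ?S" for d using subset_Idl[of ?S] by (meson subsetD)
    then have "(\<Sum>d<D. hcomp d p) \<in> Idl\<^bsub>class_ring\<^esub> ?S" by (rule rideal_sum[OF rideal_Idl])
    with D show ?thesis by metis
  qed
  moreover have "Idl\<^bsub>class_ring\<^esub> ?S \<subseteq> I" using I by (intro Idl_least) (auto simp: hideal_def)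
  ultimately have "I = Idl\<^bsub>class_ring\<^esub> ?S" by (meson subsetI subset_antisym)
  then show "homogeneous_ideal I" unfolding homogeneous_ideal_def by (intro exI[of _ ?S] conjI) auto
qed

lemma hideal_adjoin:
  assumes "hideal I" "homogeneous d a" shows "hideal (adjoin I a)"
  unfolding hideal_def
proof (intro conjI ballI allI)
  show "rideal (adjoin I a)" using assms(1) by (simp add: hideal_def rideal_adjoin)
  fix p e assume "p \<in> adjoin I a"
  then obtain r where r: "p - r * a \<in> I" by (rule adjoinE)
  have "hcomp e (p - a * r) \<in> I" using r assms(1) by (simp add: hideal_hcomp mult.commute)
  then show "hcomp e p \<in> adjoin I a"
    by (intro adjoinI[of _ "if d \<le> e then hcomp (e - d) r else 0"])
      (auto simp: hcomp_diff hcomp_mult_homogeneous[OF assms(2)] mult.commute split: if_splits)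
qed

lemma hideal_adjoins:
  "hideal I \<Longrightarrow> (\<And>a. a \<in> set as \<Longrightarrow> homogeneous 1 a) \<Longrightarrow> hideal (adjoins I as)"
proof (induction as arbitrary: I)
  case (Cons a as)
  then show ?case using hideal_adjoin[of I 1 a] by (simp add: adjoins_Cons)
qed simp

lemma hideal_set_add:
  assumes "hideal I" "hideal J" shows "hideal {a + b | a b. a \<in> I \<and> b \<in> J}"
proof -
  have "hcomp d p \<in> {a + b | a b. a \<in> I \<and> b \<in> J}" if "p \<in> {a + b | a b. a \<in> I \<and> b \<in> J}" for p d
    using that hideal_hcomp[OF assms(1)] hideal_hcomp[OF assms(2)] by (auto simp: hcomp_add) metis
  then show ?thesis using rideal_set_add assms by (auto simp: hideal_def)
qed

subsection \<open>The irrelevant ideal\<close>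

text \<open>Only the degree-0 components contribute to the constant term of a product. Taking
  constant terms is thus a ring homomorphism, and \<open>mmax\<close> is its kernel.\<close>

lemma lookup_mult_zero:
  "Poly_Mapping.lookup (p * q) 0 = Poly_Mapping.lookup p 0 * Poly_Mapping.lookup (q :: ('n::finite, 'k::comm_ring_1) mpoly) 0"
proof -
  obtain D where D: "p = (\<Sum>i<D. hcomp i p)" using sum_hcomp_ex by blast
  have h0: "hcomp 0 r = Poly_Mapping.single 0 (Poly_Mapping.lookup r 0)" for r :: "('n, 'k) mpoly"
    by (rule poly_mapping_eqI) (auto simp: lookup_hcomp mdeg_eq_0_iff lookup_single)
  have "hcomp 0 (p * q) = (\<Sum>i<D. hcomp 0 (hcomp i p * q))"
    by (subst D) (simp add: sum_distrib_right hcomp_sum)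
  also have "\<dots> = (\<Sum>i<D. if i = 0 then hcomp 0 p * hcomp 0 q else 0)"
    by (rule sum.cong) (auto simp: hcomp_mult_homogeneous[OF homogeneous_hcomp])
  also have "\<dots> = hcomp 0 p * hcomp 0 q"
    using D by (cases D) (auto simp: sum.delta)
  finally have "Poly_Mapping.single (0 :: 'n \<Rightarrow>\<^sub>0 nat) (Poly_Mapping.lookup (p * q) 0)
      = Poly_Mapping.single 0 (Poly_Mapping.lookup p 0 * Poly_Mapping.lookup q 0 :: 'k)"
    by (simp add: h0 mult_single)
  from arg_cong[OF this, of "\<lambda>f. Poly_Mapping.lookup f 0"] show ?thesis by simp
qed

definition mmax :: "('n::finite, 'k::comm_ring_1) mpoly set" where
  "mmax = {p. Poly_Mapping.lookup p 0 = 0}"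

lemma rideal_mmax: "rideal mmax"
  by (auto simp: rideal_def mmax_def lookup_add lookup_mult_zero)

lemma single_split: "Poly_Mapping.single (Poly_Mapping.single i 1 + m) c = Var i * Poly_Mapping.single m (c::'k::comm_ring_1)"
  by (simp add: Var_def mult_single)

lemma poly_mapping_sum_singles: "p = (\<Sum>m\<in>Poly_Mapping.keys p. Poly_Mapping.single m (Poly_Mapping.lookup p m))"
  by (rule poly_mapping_eqI) (auto simp: lookup_sum lookup_single when_def sum.delta' in_keys_iff)

lemma Var_in_mmax: "Var i \<in> mmax"
proof -
  have "Poly_Mapping.single i (1::nat) \<noteq> 0" by (metis lookup_single_eq lookup_zero zero_neq_one)
  then show ?thesis by (simp add: mmax_def Var_def lookup_single)
qed

lemma irrelevant_ideal_eq: "irrelevant_ideal = (mmax :: ('n::finite, 'k::comm_ring_1) mpoly set)"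
proof
  show "irrelevant_ideal \<subseteq> (mmax :: ('n, 'k) mpoly set)"
    unfolding irrelevant_ideal_def
    by (intro Idl_least rideal_mmax) (auto simp: Var_in_mmax)
  show "(mmax :: ('n, 'k) mpoly set) \<subseteq> irrelevant_ideal"
  proof
    fix p :: "('n, 'k) mpoly" assume p: "p \<in> mmax"
    have "Poly_Mapping.single m (Poly_Mapping.lookup p m) \<in> irrelevant_ideal" if "m \<in> Poly_Mapping.keys p" for m
    proof -
      have "m \<noteq> 0" using that p by (auto simp: mmax_def in_keys_iff)
      then obtain i where i: "Poly_Mapping.lookup m i \<noteq> 0" by (metis lookup_zero poly_mapping_eqI)
      then have "m = Poly_Mapping.single i 1 + (m - Poly_Mapping.single i 1)"
        by (intro poly_mapping_eqI) (auto simp: lookup_add lookup_minus lookup_single when_def)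
      then show ?thesis
        using single_split rideal_mult_right[OF rideal_Idl] subset_Idl[of "range Var"]
        unfolding irrelevant_ideal_def by (metis range_subsetD)
    qed
    then show "p \<in> irrelevant_ideal"
      using poly_mapping_sum_singles[of p] rideal_sum[OF rideal_Idl] unfolding irrelevant_ideal_def
      by (metis (no_types, lifting))
  qed
qed

lemma homogeneous_in_mmax: "homogeneous d p \<Longrightarrow> 0 < d \<Longrightarrow> p \<in> mmax"
  by (auto simp: mmax_def homogeneous_alt)

lemma mmax_subset_if_Vars: "rideal I \<Longrightarrow> range Var \<subseteq> I \<Longrightarrow> mmax \<subseteq> I"
  unfolding irrelevant_ideal_eq[symmetric] irrelevant_ideal_def by (rule Idl_least)

section \<open>Order at the origin, graded Krull intersection and permutation of regular
  elements\<close>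

definition order_ge :: "nat \<Rightarrow> ('n::finite, 'k::comm_ring_1) mpoly \<Rightarrow> bool" where
  "order_ge k p \<longleftrightarrow> (\<forall>m\<in>Poly_Mapping.keys p. k \<le> mdeg m)"

lemma order_ge_mult: "order_ge j p \<Longrightarrow> order_ge k q \<Longrightarrow> order_ge (j + k) (p * q)"
  using keys_mult[of p q] by (fastforce simp: order_ge_def mdeg_add intro: add_mono)

lemma order_ge_mmax: "p \<in> mmax \<Longrightarrow> order_ge 1 p"
  by (auto simp: mmax_def order_ge_def in_keys_iff Suc_le_eq neq0_conv[symmetric] mdeg_eq_0_iff simp del: neq0_conv)

lemma order_ge_power: "p \<in> mmax \<Longrightarrow> order_ge k (p ^ k)"
proof (induction k)
  case (Suc k)
  then show ?case using order_ge_mult[OF order_ge_mmax] by fastforce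
qed (simp add: order_ge_def)

lemma hcomp_order_ge: "order_ge k p \<Longrightarrow> d < k \<Longrightarrow> hcomp d p = 0"
  by (rule poly_mapping_eqI) (use leD in \<open>fastforce simp: order_ge_def lookup_hcomp not_in_keys_iff_lookup_eq_zero[symmetric]\<close>)

text \<open>A graded form of Krull's intersection theorem.\<close>

lemma hideal_mem_if_powers:
  assumes I: "hideal I" and v: "v \<in> mmax" and a: "\<And>k. \<exists>b. a - v ^ k * b \<in> I"
  shows "a \<in> I"
  unfolding hideal_mem_iff[OF I, of a]
proof
  fix d
  obtain b where "a - v ^ Suc d * b \<in> I" using a by blast
  then have "hcomp d (a - v ^ Suc d * b) \<in> I" by (rule hideal_hcomp[OF I])
  moreover have "order_ge (Suc d + 0) (v ^ Suc d * b)"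
    by (rule order_ge_mult[OF order_ge_power[OF v]]) (simp add: order_ge_def)
  then have "hcomp d (v ^ Suc d * b) = 0" by (intro hcomp_order_ge) auto
  ultimately show "hcomp d a \<in> I" by (simp add: hcomp_diff)
qed

text \<open>Modulo \<open>I\<close> one has \<open>a\<close> congruent to
  \<open>(1 - u) ^ k * a\<close> for every \<open>k\<close>, so the graded intersection theorem
  applies: elements with constant term 1 act like units modulo homogeneous ideals.\<close>

lemma hideal_cancel_unit:
  assumes I: "hideal I" and u: "1 - u \<in> mmax" and ua: "u * a \<in> I"
  shows "a \<in> I"
proof (rule hideal_mem_if_powers[OF I u])
  fix k
  have "a - (1 - u) ^ k * a \<in> I"
  proof (induction k)
    case 0
    show ?case using I by (simp add: hideal_def rideal_zero)
  next
    case (Suc k)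
    have "(1 - u) * (a - (1 - u) ^ k * a) + u * a \<in> I"
      using rideal_add[OF hideal_rideal[OF I] rideal_mult_left[OF hideal_rideal[OF I] Suc] ua] .
    then show ?case by (simp add: algebra_simps)
  qed
  then show "\<exists>b. a - (1 - u) ^ k * b \<in> I" by blast
qed

text \<open>If \<open>b * c\<close> vanishes modulo \<open>A\<close>, then \<open>c\<close> is
  \<open>a\<close> times an element that \<open>b\<close> kills again; iterating, \<open>c\<close>
  is divisible by all powers of \<open>a\<close> and vanishes by the graded intersection theorem.
  The second claim is formal.\<close>

lemma regular_mod_swap:
  assumes A: "hideal A" and a: "a \<in> mmax" and r: "regular_mod A a" "regular_mod (adjoin A a) b"
  shows "regular_mod A b" "regular_mod (adjoin A b) a"
proof -
  have RA: "rideal A" using A by (simp add: hideal_def)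
  have step: "\<exists>c'. c - a * c' \<in> A \<and> b * c' \<in> A" if "b * c \<in> A" for c
  proof -
    have "c \<in> adjoin A a" using r(2) that adjoin_superset[of A a] by (auto simp: regular_mod_def)
    then obtain c' where c': "c - c' * a \<in> A" by (rule adjoinE)
    have "b * c - b * (c - c' * a) \<in> A" by (rule rideal_diff[OF RA that rideal_mult_left[OF RA c']])
    then have "a * (b * c') \<in> A" by (simp add: algebra_simps)
    then have "b * c' \<in> A" using r(1) by (simp add: regular_mod_def)
    then show ?thesis using c' by (auto simp: mult.commute)
  qed
  show "regular_mod A b"
    unfolding regular_mod_def
  proof (intro allI impI)
    fix c assume bc: "b * c \<in> A"
    have "\<exists>b'. c - a ^ k * b' \<in> A \<and> b * b' \<in> A" for k
    proof (induction k)
      case 0 then show ?case using bc RA by (auto intro!: exI[of _ c] simp: rideal_zero)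
    next
      case (Suc k)
      then obtain b' where b': "c - a ^ k * b' \<in> A" "b * b' \<in> A" by blast
      obtain c' where c': "b' - a * c' \<in> A" "b * c' \<in> A" using step[OF b'(2)] by blast
      have "(c - a ^ k * b') + a ^ k * (b' - a * c') \<in> A"
        by (rule rideal_add[OF RA b'(1) rideal_mult_left[OF RA c'(1)]])
      then have "c - a ^ Suc k * c' \<in> A" by (simp add: algebra_simps)
      then show ?case using c' by blast
    qed
    then show "c \<in> A" using hideal_mem_if_powers[OF A a] by blast
  qed
  show "regular_mod (adjoin A b) a"
    unfolding regular_mod_def
  proof (intro allI impI)
    fix c assume "a * c \<in> adjoin A b"
    then obtain d where d: "a * c - d * b \<in> A" by (rule adjoinE)
    then have "b * d \<in> adjoin A a"
      using adjoinI[of "b * d" c a A] rideal_uminus[OF RA d] by (simp add: algebra_simps)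
    then have "d \<in> adjoin A a" using r(2) by (simp add: regular_mod_def)
    then obtain e where e: "d - e * a \<in> A" by (rule adjoinE)
    have "(a * c - d * b) + b * (d - e * a) \<in> A" by (rule rideal_add[OF RA d rideal_mult_left[OF RA e]])
    then have "a * (c - e * b) \<in> A" by (simp add: algebra_simps)
    then have "c - e * b \<in> A" using r(1) by (simp add: regular_mod_def)
    then show "c \<in> adjoin A b" by (rule adjoinI)
  qed
qed

text \<open>The induction hypothesis writes \<open>c\<close> as \<open>d * a ^ k\<close> modulo
  \<open>A\<close>; cancelling \<open>a ^ k\<close> then reduces the claim to \<open>d\<close> and
  the first power of \<open>a\<close>.\<close>

lemma regular_mod_adjoin_power:
  assumes A: "rideal A" and r: "regular_mod A a" "regular_mod (adjoin A a) b"
  shows "regular_mod (adjoin A (a ^ k)) b"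
proof (induction k)
  case 0
  have "1 \<in> adjoin A (a ^ 0)" using adjoin_self[OF A, of 1] by simp
  then show ?case using rideal_one_iff[OF rideal_adjoin[OF A]] by (auto simp: regular_mod_def)
next
  case (Suc k)
  show ?case
    unfolding regular_mod_def
  proof (intro allI impI)
    fix c assume c: "b * c \<in> adjoin A (a ^ Suc k)"
    then obtain e where e: "b * c - e * a ^ Suc k \<in> A" by (rule adjoinE)
    then have "b * c \<in> adjoin A (a ^ k)" by (intro adjoinI[of _ "e * a"]) (simp add: mult.assoc)
    then have "c \<in> adjoin A (a ^ k)" using Suc by (simp add: regular_mod_def)
    then obtain d where d: "c - d * a ^ k \<in> A" by (rule adjoinE)
    have "(b * c - e * a ^ Suc k) - b * (c - d * a ^ k) \<in> A"
      by (rule rideal_diff[OF A e rideal_mult_left[OF A d]])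
    then have "a ^ k * (b * d - e * a) \<in> A" by (simp add: algebra_simps)
    then have "b * d - e * a \<in> A" using regular_mod_power[OF r(1)] by (simp add: regular_mod_def)
    then have "b * d \<in> adjoin A a" by (rule adjoinI)
    then have "d \<in> adjoin A a" using r(2) by (simp add: regular_mod_def)
    then obtain f where f: "d - f * a \<in> A" by (rule adjoinE)
    have "(c - d * a ^ k) + a ^ k * (d - f * a) \<in> A" by (rule rideal_add[OF A d rideal_mult_left[OF A f]])
    then have "c - f * a ^ Suc k \<in> A" by (simp add: algebra_simps)
    then show "c \<in> adjoin A (a ^ Suc k)" by (rule adjoinI)
  qed
qed

section \<open>The ascending chain condition\<close>

text \<open>Weighting the variables by distinct primes turns monomials into natural numbers; the order
  of the natural numbers then is a monomial order.\<close>

lemma monomial_weight_exists: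
  obtains w :: "('n::finite \<Rightarrow>\<^sub>0 nat) \<Rightarrow> nat"
  where "inj w" "\<And>a b. w (a + b) = w a * w b" "\<And>a. 0 < w a"
proof -
  have "\<exists>e :: 'n \<Rightarrow> nat. inj e \<and> range e \<subseteq> {p. prime p}"
    using infinite_arbitrarily_large[OF primes_infinite, of "CARD('n)"]
    by (metis finite_UNIV card_le_inj finite subset_trans order_refl)
  then obtain e :: "'n \<Rightarrow> nat" where e: "inj e" "\<And>i. prime (e i)" by blast
  have e0: "e i \<noteq> 0" for i using e(2)[of i] by (metis not_prime_0)
  have other: "multiplicity (e i) (e j ^ k) = (if j = i then k else 0)" for i j k
  proof (cases "j = i")
    case True
    then show ?thesis using e(2)[of i] by (simp add: multiplicity_same_power not_prime_unit e0)
  next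
    case False
    then have "multiplicity (e i) (e j) = 0" using prime_multiplicity_other[OF e(2) e(2)] injD[OF e(1)] by metis
    then show ?thesis using False e(2)[of i] e0 by (simp add: prime_elem_multiplicity_power_distrib)
  qed
  define w where "w m = (\<Prod>i\<in>UNIV. e i ^ Poly_Mapping.lookup m i)" for m
  show thesis
  proof (rule that[of w])
    show "w (a + b) = w a * w b" for a b
      by (simp add: w_def lookup_add power_add prod.distrib)
    show pos: "0 < w a" for a
      using e0 by (auto simp: w_def)
    show "inj w"
    proof (rule injI, rule poly_mapping_eqI)
      fix a b i assume eq: "w a = w b"
      have "multiplicity (e i) (w m) = Poly_Mapping.lookup m i" for m
      proof -
        have "multiplicity (e i) (w m) = (\<Sum>j\<in>UNIV. multiplicity (e i) (e j ^ Poly_Mapping.lookup m j))"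
          unfolding w_def using e(2)[of i] e0
          by (subst prime_elem_multiplicity_prod_distrib) (auto simp del: neq0_conv)
        also have "\<dots> = (\<Sum>j\<in>UNIV. if j = i then Poly_Mapping.lookup m i else 0)"
          by (simp add: other)
        finally show ?thesis by simp
      qed
      then show "Poly_Mapping.lookup a i = Poly_Mapping.lookup b i" using eq by metis
    qed
  qed
qed

text \<open>A monotone subsequence exists; a decreasing one is constant from the place where its
  minimum is attained.\<close>

lemma nat_seq_good_subseq:
  obtains \<phi> :: "nat \<Rightarrow> nat" where "strict_mono \<phi>" "incseq (f \<circ> \<phi> :: nat \<Rightarrow> nat)"
proof -
  obtain \<phi> where \<phi>: "strict_mono \<phi>" "monoseq (f \<circ> \<phi>)"
    using seq_monosub[of f] by (auto simp: o_def)
  show thesis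
  proof (cases "incseq (f \<circ> \<phi>)")
    case False
    then have dec: "decseq (f \<circ> \<phi>)" using \<phi>(2) by (simp add: monoseq_iff)
    define N where "N = (LEAST v. v \<in> range (f \<circ> \<phi>))"
    have "N \<in> range (f \<circ> \<phi>)" unfolding N_def by (rule LeastI[of _ "(f \<circ> \<phi>) 0"]) simp
    then obtain k where k: "N = (f \<circ> \<phi>) k" by blast
    have "(f \<circ> \<phi>) (k + i) = N" for i
    proof (rule antisym)
      show "(f \<circ> \<phi>) (k + i) \<le> N" using decseqD[OF dec, of k "k + i"] k by simp
      show "N \<le> (f \<circ> \<phi>) (k + i)" unfolding N_def by (rule Least_le) simp
    qed
    then have "incseq (f \<circ> (\<lambda>i. \<phi> (k + i)))" by (simp add: incseq_def)
    moreover have "strict_mono (\<lambda>i. \<phi> (k + i))" using \<phi>(1) by (simp add: strict_mono_def)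
    ultimately show thesis using that by blast
  qed (use that \<phi>(1) in blast)
qed

text \<open>Passing to subsequences, one variable at a time, makes all exponents nondecreasing; then
  the first monomial divides the second.\<close>

lemma dickson:
  fixes m :: "nat \<Rightarrow> ('n::finite \<Rightarrow>\<^sub>0 nat)"
  obtains i j c where "i < j" "m j = m i + c"
proof -
  have "\<exists>\<phi>. strict_mono \<phi> \<and> (\<forall>v\<in>V. incseq (\<lambda>i. Poly_Mapping.lookup (m (\<phi> i)) v))" if "finite V" for V
    using that
  proof (induction V rule: finite_induct)
    case empty
    then show ?case by (auto intro: strict_mono_id[unfolded id_def])
  next
    case (insert v V)
    then obtain \<phi> where \<phi>: "strict_mono \<phi>" "\<forall>v\<in>V. incseq (\<lambda>i. Poly_Mapping.lookup (m (\<phi> i)) v)" by blast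
    obtain \<psi> where \<psi>: "strict_mono \<psi>" "incseq ((\<lambda>i. Poly_Mapping.lookup (m (\<phi> i)) v) \<circ> \<psi>)"
      by (rule nat_seq_good_subseq)
    have "incseq (\<lambda>i. Poly_Mapping.lookup (m (\<phi> (\<psi> i))) u)" if "u \<in> insert v V" for u
    proof (cases "u = v")
      case True then show ?thesis using \<psi>(2) by (simp add: o_def)
    next
      case False
      then have "incseq (\<lambda>i. Poly_Mapping.lookup (m (\<phi> i)) u)" using \<phi>(2) that by blast
      then show ?thesis using strict_mono_leD[OF \<psi>(1)] by (simp add: incseq_def)
    qed
    moreover have "strict_mono (\<lambda>i. \<phi> (\<psi> i))" using strict_mono_o[OF \<phi>(1) \<psi>(1)] by (simp add: o_def)
    ultimately show ?case by (intro exI[of _ "\<lambda>i. \<phi> (\<psi> i)"]) blast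
  qed
  from this[of UNIV] obtain \<phi> where \<phi>: "strict_mono \<phi>" "\<And>v. incseq (\<lambda>i. Poly_Mapping.lookup (m (\<phi> i)) v)" by auto
  show thesis
  proof (rule that)
    show "\<phi> 0 < \<phi> 1" using \<phi>(1) by (simp add: strict_mono_def)
    show "m (\<phi> 1) = m (\<phi> 0) + (m (\<phi> 1) - m (\<phi> 0))"
      using incseqD[OF \<phi>(2), of 0 1] by (intro poly_mapping_eqI) (simp add: lookup_add lookup_minus)
  qed
qed

lemma lookup_single_mult:
  "Poly_Mapping.lookup (Poly_Mapping.single c a * p) (c + m) = a * Poly_Mapping.lookup (p :: ('n, 'k::comm_ring_1) mpoly) m"
  by (simp add: lookup_mult lookup_single when_mult)

lemma keys_single_mult:
  "k \<in> Poly_Mapping.keys (Poly_Mapping.single c a * (p :: ('n, 'k::comm_ring_1) mpoly)) \<Longrightarrow> \<exists>m\<in>Poly_Mapping.keys p. k = c + m"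
  using keys_mult[of "Poly_Mapping.single c a" p] by (auto split: if_splits)

text \<open>Hilbert's basis theorem through leading monomials: each step of a strictly ascending
  chain contributes a new leading monomial, and by Dickson's lemma one of these divides a later one,
  which was then not new.\<close>

lemma acc_mpoly: "acc TYPE(('n::finite, 'k::field) mpoly)"
proof -
  obtain w :: "('n \<Rightarrow>\<^sub>0 nat) \<Rightarrow> nat"
    where w: "inj w" "\<And>a b. w (a + b) = w a * w b" "\<And>a. 0 < w a" using monomial_weight_exists by metis
  define lead where "lead I = {m. \<exists>p\<in>I. m \<in> Poly_Mapping.keys p \<and> (\<forall>k\<in>Poly_Mapping.keys p. w k \<le> w m)}"
    for I :: "('n, 'k) mpoly set"
  have lead_up: "m + c \<in> lead I" if I: "rideal I" and m: "m \<in> lead I" for I m c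
  proof -
    obtain p where p: "p \<in> I" "m \<in> Poly_Mapping.keys p" "\<forall>k\<in>Poly_Mapping.keys p. w k \<le> w m"
      using m by (auto simp: lead_def)
    have "Poly_Mapping.single c 1 * p \<in> I" using p(1) I by (simp add: rideal_mult_left)
    moreover have "c + m \<in> Poly_Mapping.keys (Poly_Mapping.single c 1 * p)"
      using p(2) by (simp add: in_keys_iff lookup_single_mult)
    moreover have "w k \<le> w (c + m)" if "k \<in> Poly_Mapping.keys (Poly_Mapping.single c 1 * p)" for k
      using keys_single_mult[OF that] p(3) w(2) by auto
    ultimately have "c + m \<in> lead I" unfolding lead_def by blast
    then show ?thesis by (simp add: add.commute)
  qed
  have lead_mono: "lead I \<subseteq> lead J" if "I \<subseteq> J" for I J using that by (auto simp: lead_def)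
  \<comment> \<open>The division algorithm: a multiple of an element of \<open>I\<close> cancels the
    leading term, and the weights of the remaining terms drop below \<open>N\<close>.\<close>
  have lead_inj: "J \<subseteq> I" if IJ: "rideal I" "rideal J" "I \<subseteq> J" "lead J \<subseteq> lead I" for I J
  proof -
    have "p \<in> I" if "p \<in> J" "\<forall>k\<in>Poly_Mapping.keys p. w k < N" for p N
      using that
    proof (induction N arbitrary: p)
      case 0
      then have "Poly_Mapping.keys p = {}" by auto
      then show ?case using IJ(1) by (simp add: rideal_zero)
    next
      case (Suc N)
      show ?case
      proof (cases "\<exists>m\<in>Poly_Mapping.keys p. w m = N")
        case False
        then have "\<forall>k\<in>Poly_Mapping.keys p. w k < N" using Suc.prems(2) less_antisym by blast
        then show ?thesis using Suc by blast
      next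
        case True
        then obtain m where m: "m \<in> Poly_Mapping.keys p" "w m = N" by blast
        then have "m \<in> lead J" using Suc.prems by (auto simp: lead_def less_Suc_eq_le)
        then have "m \<in> lead I" using IJ(4) by blast
        then obtain q where q: "q \<in> I" "m \<in> Poly_Mapping.keys q" "\<forall>k\<in>Poly_Mapping.keys q. w k \<le> w m"
          by (auto simp: lead_def)
        define u where "u = Poly_Mapping.single 0 (Poly_Mapping.lookup p m / Poly_Mapping.lookup q m) * q"
        have lu: "Poly_Mapping.lookup u k = Poly_Mapping.lookup p m / Poly_Mapping.lookup q m * Poly_Mapping.lookup q k" for k
          using lookup_single_mult[of 0 _ q k] by (simp add: u_def)
        have uI: "u \<in> I" using q(1) IJ(1) by (simp add: u_def rideal_mult_left)
        have "p - u \<in> I"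
        proof (rule Suc.IH)
          show "p - u \<in> J" using Suc.prems(1) uI IJ by (auto intro: rideal_diff)
          show "\<forall>k\<in>Poly_Mapping.keys (p - u). w k < N"
          proof
            fix k assume "k \<in> Poly_Mapping.keys (p - u)"
            then have k: "Poly_Mapping.lookup p k \<noteq> Poly_Mapping.lookup u k" by (simp add: in_keys_iff lookup_minus)
            have "k \<noteq> m" using k q(2) by (auto simp: lu in_keys_iff)
            then have ne: "w k \<noteq> N" using w(1) m(2) by (auto dest: injD)
            show "w k < N"
            proof (cases "k \<in> Poly_Mapping.keys p")
              case True then show ?thesis using Suc.prems(2) ne by fastforce
            next
              case False
              then have "k \<in> Poly_Mapping.keys q" using k by (auto simp: lu in_keys_iff)
              then show ?thesis using q(3) m(2) ne by fastforce
            qed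
          qed
        qed
        then have "(p - u) + u \<in> I" using uI IJ(1) by (intro rideal_add)
        then show ?thesis by simp
      qed
    qed
    moreover have "\<forall>k\<in>Poly_Mapping.keys p. w k < Suc (Max (w ` Poly_Mapping.keys p))" for p
      by (simp add: less_Suc_eq_le)
    ultimately show ?thesis by blast
  qed
  show ?thesis
    unfolding acc_def wf_iff_no_infinite_down_chain
  proof
    assume "\<exists>f. \<forall>i. (f (Suc i), f i) \<in> {(J, I) | I J :: ('n, 'k) mpoly set. rideal I \<and> rideal J \<and> I \<subset> J}"
    then obtain f :: "nat \<Rightarrow> ('n, 'k) mpoly set" where f: "\<And>i. rideal (f i)" "\<And>i. f i \<subset> f (Suc i)" by blast
    have mono: "f i \<subseteq> f j" if "i \<le> j" for i j using lift_Suc_mono_le[of f, OF _ that] f(2) by blast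
    have "\<exists>m. m \<in> lead (f (Suc i)) \<and> m \<notin> lead (f i)" for i
      using lead_inj[OF f(1) f(1), of i "Suc i"] f(2)[of i] by blast
    then obtain m where m: "\<And>i. m i \<in> lead (f (Suc i))" "\<And>i. m i \<notin> lead (f i)" by metis
    obtain i j c where ij: "i < j" "m j = m i + c" by (rule dickson)
    have "m i \<in> lead (f j)" using m(1)[of i] lead_mono[OF mono[of "Suc i" j]] ij(1) by auto
    then have "m j \<in> lead (f j)" using lead_up[OF f(1)] ij(2) by simp
    then show False using m(2) by blast
  qed
qed

section \<open>Dimensions of subspaces\<close>

lemma (in vector_space) dim_subspace_mono:
  assumes "S \<subseteq> T" "finite W" "T \<subseteq> span W"
  shows "dim S \<le> dim T"
proof -
  obtain B where B: "B \<subseteq> S" "independent B" "S \<subseteq> span B" "card B = dim S" by (rule basis_exists)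
  obtain C where C: "B \<subseteq> C" "C \<subseteq> T" "independent C" "T \<subseteq> span C"
    using maximal_independent_subset_extend[of B T] B assms(1) by blast
  have "finite C" using independent_span_bound[OF assms(2) C(3)] C(2) assms(3) by blast
  then have "card B \<le> card C" using C(1) card_mono by blast
  then show ?thesis using B(4) basis_card_eq_dim[OF C(2,4,3)] by simp
qed

lemma (in vector_space) dim_subspace_eq:
  assumes "subspace S" "S \<subseteq> T" "finite W" "T \<subseteq> span W" "dim T \<le> dim S"
  shows "S = T"
proof -
  obtain B where B: "B \<subseteq> S" "independent B" "S \<subseteq> span B" "card B = dim S" by (rule basis_exists)
  obtain C where C: "B \<subseteq> C" "C \<subseteq> T" "independent C" "T \<subseteq> span C"
    using maximal_independent_subset_extend[of B T] B assms(2) by blast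
  have "finite C" using independent_span_bound[OF assms(3) C(3)] C(2) assms(4) by blast
  moreover have "card C \<le> card B" using assms(5) B(4) basis_card_eq_dim[OF C(2,4,3)] by simp
  ultimately have "B = C" using C(1) card_seteq by blast
  then have "T \<subseteq> span B" using C by simp
  then show ?thesis using span_minimal[OF B(1) assms(1)] assms(2) by blast
qed

text \<open>For \<open>U = {0}\<close> this is the rank-nullity theorem; the general case computes dimensions of
  quotients without forming them.\<close>

lemma (in vector_space_pair) dim_add_image:
  assumes f: "Vector_Spaces.linear s1 s2 f" and V: "vs1.subspace V" and U: "vs2.subspace U"
    and fin: "finite W1" "V \<subseteq> vs1.span W1" "finite W2" "U \<subseteq> vs2.span W2"
  shows "vs2.dim {u + f v | u v. u \<in> U \<and> v \<in> V} + vs1.dim {v \<in> V. f v \<in> U} = vs2.dim U + vs1.dim V"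
proof -
  interpret f: Vector_Spaces.linear s1 s2 f by (rule f)
  let ?K = "{v \<in> V. f v \<in> U}"
  have K: "vs1.subspace ?K"
    using V U by (auto simp: vs1.subspace_def vs2.subspace_def f.add f.scale f.zero)
  obtain B where B: "B \<subseteq> ?K" "vs1.independent B" "?K \<subseteq> vs1.span B" "card B = vs1.dim ?K"
    by (rule vs1.basis_exists)
  obtain C where C: "B \<subseteq> C" "C \<subseteq> V" "vs1.independent C" "V \<subseteq> vs1.span C"
    using vs1.maximal_independent_subset_extend[of B V] B by blast
  have finC: "finite C" using vs1.independent_span_bound[OF fin(1) C(3)] C(2) fin(2) by blast
  have dimV: "card C = vs1.dim V" by (rule vs1.basis_card_eq_dim[OF C(2,4,3)])
  obtain D where D: "D \<subseteq> U" "vs2.independent D" "U \<subseteq> vs2.span D" "card D = vs2.dim U"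
    by (rule vs2.basis_exists)
  have finD: "finite D" using vs2.independent_span_bound[OF fin(3) D(2)] D(1) fin(4) by blast
  have spanD: "vs2.span D = U" using vs2.span_minimal[OF D(1) U] D(3) by blast
  have spanK: "vs1.span B = ?K" using vs1.span_minimal[OF B(1) K] B(3) by blast
  \<comment> \<open>The vectors that extend a basis of \<open>?K\<close> to one of \<open>V\<close>
    have images that are independent modulo \<open>U\<close>.\<close>
  have main: "vs2.independent (D \<union> f ` E) \<and> card (D \<union> f ` E) = card D + card E"
    if "finite E" "E \<subseteq> C - B" for E
    using that
  proof (induction E rule: finite_induct)
    case empty
    then show ?case using D by simp
  next
    case (insert e E)
    have notin: "f e \<notin> vs2.span (D \<union> f ` E)"
    proof
      assume "f e \<in> vs2.span (D \<union> f ` E)"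
      then obtain u x where ux: "f e = u + f x" "u \<in> U" "x \<in> vs1.span E"
        unfolding vs2.span_Un spanD f.span_image by blast
      have "vs1.span E \<subseteq> V" using insert.prems C(2) V by (intro vs1.span_minimal) auto
      then have "e - x \<in> V" using ux insert.prems C(2) V vs1.subspace_diff by blast
      moreover have "f (e - x) \<in> U" using ux by (simp add: f.diff)
      ultimately have "e - x \<in> vs1.span B" by (simp add: spanK)
      then have "e - x \<in> vs1.span (B \<union> E)" "x \<in> vs1.span (B \<union> E)"
        using ux(3) vs1.span_mono[of B "B \<union> E"] vs1.span_mono[of E "B \<union> E"] by auto
      then have "(e - x) + x \<in> vs1.span (B \<union> E)" by (rule vs1.span_add)
      then have "e \<in> vs1.span (B \<union> E)" by simp
      moreover have "B \<union> E \<subseteq> C - {e}" using insert C(1) by auto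
      ultimately have "e \<in> vs1.span (C - {e})" using vs1.span_mono by blast
      then show False using C(3) insert.prems unfolding vs1.dependent_def by blast
    qed
    have "E \<subseteq> C - B" using insert.prems by blast
    from insert.IH[OF this]
    have IH: "vs2.independent (D \<union> f ` E)" "card (D \<union> f ` E) = card D + card E" by simp_all
    have "f e \<notin> D \<union> f ` E" using notin by (metis vs2.span_base)
    then have "card (insert (f e) (D \<union> f ` E)) = Suc (card D + card E)"
      using IH(2) finD insert(1) by (subst card_insert_disjoint) auto
    then show ?case
      using vs2.independent_insertI[OF notin IH(1)] insert(1,2) by simp
  qed
  have fE: "finite (C - B)" using finC by simp
  let ?E = "f ` (C - B)"
  let ?S = "{u + f v | u v. u \<in> U \<and> v \<in> V}"
  have "vs2.dim ?S = card (D \<union> ?E)"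
  proof (rule vs2.basis_card_eq_dim[symmetric])
    show "D \<union> ?E \<subseteq> ?S"
    proof
      fix y assume "y \<in> D \<union> ?E"
      then consider "y \<in> U" | v where "v \<in> V" "y = f v" using D(1) C(2) by blast
      then show "y \<in> ?S"
      proof cases
        case 1
        then have "y = y + f 0 \<and> y \<in> U \<and> 0 \<in> V" using vs1.subspace_0[OF V] by (simp add: f.zero)
        then show ?thesis by blast
      next
        case 2
        then have "y = 0 + f v \<and> 0 \<in> U \<and> v \<in> V" using vs2.subspace_0[OF U] by simp
        then show ?thesis by blast
      qed
    qed
    show "?S \<subseteq> vs2.span (D \<union> ?E)"
    proof
      fix y assume "y \<in> ?S"
      then obtain u v where y: "y = u + f v" "u \<in> U" "v \<in> V" by blast
      have "v \<in> vs1.span (B \<union> (C - B))" using y(3) C(1,4) by (simp add: Un_absorb1) blast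
      then obtain a b where ab: "v = a + b" "a \<in> ?K" "b \<in> vs1.span (C - B)"
        unfolding vs1.span_Un spanK by blast
      have "y = (u + f a) + f b" by (simp add: y ab f.add)
      moreover have "u + f a \<in> U" using y(2) ab(2) U vs2.subspace_add by blast
      ultimately show "y \<in> vs2.span (D \<union> ?E)"
        unfolding vs2.span_Un spanD f.span_image using ab(3) by blast
    qed
    show "vs2.independent (D \<union> ?E)" using main[OF fE] by blast
  qed
  also have "\<dots> = card D + (card C - card B)"
    using main[OF fE] card_Diff_subset[OF finite_subset[OF C(1) finC] C(1)] by simp
  finally show ?thesis
    using D(4) B(4) dimV card_mono[OF finC C(1)] by simp
qed

section \<open>Hilbert functions\<close>

abbreviation pscale :: "'k::field \<Rightarrow> ('n, 'k) mpoly \<Rightarrow> ('n, 'k) mpoly" where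
  "pscale \<equiv> \<lambda>c p. Poly_Mapping.single 0 c * p"

interpretation mp: vector_space "pscale :: 'k::field \<Rightarrow> ('n, 'k) mpoly \<Rightarrow> ('n, 'k) mpoly"
  by unfold_locales (simp_all add: algebra_simps mult_single single_add)

interpretation mp2: vector_space_pair "pscale :: 'k::field \<Rightarrow> ('n, 'k) mpoly \<Rightarrow> ('n, 'k) mpoly" pscale ..

definition Rd :: "nat \<Rightarrow> ('n::finite, 'k::field) mpoly set" where
  "Rd d = {p. homogeneous d p}"

lemma subspace_Rd: "mp.subspace (Rd d)"
  by (auto simp: mp.subspace_def Rd_def homogeneous_add homogeneous_scale)

lemma subspace_rideal: "rideal I \<Longrightarrow> mp.subspace I"
  by (auto simp: mp.subspace_def rideal_zero rideal_add rideal_mult_left)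

definition monomials :: "nat \<Rightarrow> ('n::finite, 'k::field) mpoly set" where
  "monomials d = (\<lambda>m. Poly_Mapping.single m 1) ` {m. mdeg m = d}"

text \<open>Reading the exponents along an enumeration of the variables reduces the count to lists
  of given length and sum (stars and bars).\<close>

lemma card_mdeg:
  "finite {m :: 'n::finite \<Rightarrow>\<^sub>0 nat. mdeg m = d} \<and>
   card {m :: 'n::finite \<Rightarrow>\<^sub>0 nat. mdeg m = d} = (d + CARD('n) - 1) choose d"
proof -
  obtain xs :: "'n list" where xs: "set xs = UNIV" "distinct xs"
    using finite_distinct_list[OF finite[of "UNIV :: 'n set"]] by metis
  have len: "length xs = CARD('n)" using distinct_card[OF xs(2)] xs(1) by simp
  let ?L = "{l :: nat list. length l = CARD('n) \<and> sum_list l = d}"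
  have "bij_betw (\<lambda>m. map (Poly_Mapping.lookup m) xs) {m :: 'n \<Rightarrow>\<^sub>0 nat. mdeg m = d} ?L"
    unfolding bij_betw_def
  proof
    show "inj_on (\<lambda>m. map (Poly_Mapping.lookup m) xs) {m :: 'n \<Rightarrow>\<^sub>0 nat. mdeg m = d}"
      using xs(1) by (auto intro!: inj_onI poly_mapping_eqI)
    show "(\<lambda>m. map (Poly_Mapping.lookup m) xs) ` {m :: 'n \<Rightarrow>\<^sub>0 nat. mdeg m = d} = ?L"
    proof safe
      fix m :: "'n \<Rightarrow>\<^sub>0 nat"
      show "length (map (Poly_Mapping.lookup m) xs) = CARD('n)" by (simp add: len)
      show "sum_list (map (Poly_Mapping.lookup m) xs) = mdeg m"
        using sum_list_distinct_conv_sum_set[OF xs(2), of "Poly_Mapping.lookup m"] xs(1) by (simp add: mdeg_def)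
    next
      fix l :: "nat list" assume l: "length l = CARD('n)"
      obtain m :: "'n \<Rightarrow>\<^sub>0 nat" where m: "\<And>i. i < length xs \<Longrightarrow> Poly_Mapping.lookup m (xs ! i) = l ! i"
      proof
        fix i assume "i < length xs"
        then show "Poly_Mapping.lookup (Abs_poly_mapping (\<lambda>x. l ! (THE i. i < length xs \<and> xs ! i = x))) (xs ! i) = l ! i"
          using xs(2) by (subst lookup_Abs_poly_mapping)
            (auto simp: nth_eq_iff_index_eq intro!: arg_cong[where f = "nth l"] the_equality)
      qed
      then have "map (Poly_Mapping.lookup m) xs = l" using l len by (intro nth_equalityI) auto
      moreover from this have "mdeg m = sum_list l"
        using sum_list_distinct_conv_sum_set[OF xs(2), of "Poly_Mapping.lookup m"] xs(1) by (simp add: mdeg_def)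
      ultimately show "l \<in> (\<lambda>m. map (Poly_Mapping.lookup m) xs) ` {m :: 'n \<Rightarrow>\<^sub>0 nat. mdeg m = sum_list l}" by auto
    qed
  qed
  note bij = this
  have "finite ?L"
    by (rule finite_subset[OF _ finite_lists_length_eq[of "{..d}" "CARD('n)"]])
      (auto simp: member_le_sum_list)
  then show ?thesis
    using bij_betw_finite[OF bij] bij_betw_same_card[OF bij] card_length_sum_list[of "CARD('n)" d] by simp
qed

lemma finite_monomials: "finite (monomials d :: ('n::finite, 'k::field) mpoly set)"
  using card_mdeg[of d, where 'n = 'n] by (simp add: monomials_def)

lemma Rd_subset_span: "Rd d \<subseteq> mp.span (monomials d :: ('n::finite, 'k::field) mpoly set)"
proof
  fix p :: "('n, 'k) mpoly" assume p: "p \<in> Rd d"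
  have "Poly_Mapping.single m (Poly_Mapping.lookup p m) \<in> mp.span (monomials d)" if "m \<in> Poly_Mapping.keys p" for m
  proof -
    have "Poly_Mapping.single m (1::'k) \<in> monomials d" using p that by (auto simp: monomials_def Rd_def homogeneous_iff)
    then have "Poly_Mapping.single 0 (Poly_Mapping.lookup p m) * Poly_Mapping.single m 1 \<in> mp.span (monomials d)"
      by (intro mp.span_scale mp.span_base)
    then show ?thesis by (simp add: mult_single)
  qed
  then have "(\<Sum>m\<in>Poly_Mapping.keys p. Poly_Mapping.single m (Poly_Mapping.lookup p m)) \<in> mp.span (monomials d)"
    by (rule mp.span_sum)
  then show "p \<in> mp.span (monomials d)" using poly_mapping_sum_singles[of p] by argo
qed

lemma dim_Rd: "mp.dim (Rd d :: ('n::finite, 'k::field) mpoly set) = (d + CARD('n) - 1) choose d"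
proof -
  have inj: "inj (\<lambda>m. Poly_Mapping.single m (1::'k) :: ('n, 'k) mpoly)"
    by (rule injI) (metis keys_single singleton_inject zero_neq_one)
  have "card (monomials d :: ('n, 'k) mpoly set) = mp.dim (Rd d :: ('n, 'k) mpoly set)"
  proof (rule mp.basis_card_eq_dim[OF _ Rd_subset_span])
    show "monomials d \<subseteq> (Rd d :: ('n, 'k) mpoly set)" by (auto simp: monomials_def Rd_def)
    show "mp.independent (monomials d :: ('n, 'k) mpoly set)"
    proof (rule mp.independent_if_scalars_zero[OF finite_monomials])
      fix f :: "('n, 'k) mpoly \<Rightarrow> 'k" and x :: "('n, 'k) mpoly"
      assume sum: "(\<Sum>x\<in>monomials d. Poly_Mapping.single 0 (f x) * x) = 0" and "x \<in> monomials d"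
      then obtain m where m: "mdeg m = d" "x = Poly_Mapping.single m 1" by (auto simp: monomials_def)
      have "(\<Sum>x\<in>monomials d. Poly_Mapping.single 0 (f x) * x)
          = (\<Sum>k | mdeg k = d. Poly_Mapping.single k (f (Poly_Mapping.single k 1)))"
        unfolding monomials_def by (subst sum.reindex) (auto intro: inj_on_subset[OF inj] simp: mult_single)
      then have "0 = Poly_Mapping.lookup (\<Sum>k | mdeg k = d. Poly_Mapping.single k (f (Poly_Mapping.single k 1))) m"
        using sum by simp
      also have "\<dots> = (\<Sum>k | mdeg k = d. if k = m then f (Poly_Mapping.single k 1) else 0)"
        by (auto simp: lookup_sum lookup_single when_def intro!: sum.cong)
      also have "\<dots> = f x" using m card_mdeg[of d, where 'n = 'n] by (simp add: sum.delta)
      finally show "f x = 0" by simp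
    qed
  qed
  then show ?thesis
    using card_mdeg[of d, where 'n = 'n] card_image[OF inj_on_subset[OF inj]] by (simp add: monomials_def)
qed

lemma hilbert_function_alt:
  fixes I :: "('n::finite, 'k::field) mpoly set"
  shows "hilbert_function I i = mp.dim (Rd i :: ('n, 'k) mpoly set) - mp.dim (I \<inter> Rd i)"
proof -
  have "{p \<in> I. homogeneous i p} = I \<inter> Rd i" by (auto simp: Rd_def)
  then show ?thesis unfolding hilbert_function_def by (simp add: Rd_def)
qed

lemma hilbert_function_add:
  fixes I :: "('n::finite, 'k::field) mpoly set"
  shows "hilbert_function I i + mp.dim (I \<inter> Rd i) = mp.dim (Rd i :: ('n, 'k) mpoly set)"
  unfolding hilbert_function_alt
  using mp.dim_subspace_mono[of "I \<inter> Rd i" "Rd i", OF _ finite_monomials Rd_subset_span] by simp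

lemma linear_mult: "Vector_Spaces.linear pscale pscale ((*) (l :: ('n, 'k::field) mpoly))"
  by unfold_locales (simp_all add: algebra_simps)

text \<open>Dimension count in degree \<open>Suc i\<close> for multiplication by \<open>l\<close>,
  whose kernel into R/I is \<open>colon I l\<close> and whose cokernel is the quotient by
  \<open>adjoin I l\<close>. The terms are arranged so that no subtraction of naturals
  occurs.\<close>

lemma hilbert_function_adjoin_aux:
  assumes I: "hideal I" and l: "homogeneous 1 (l :: ('n::finite, 'k::field) mpoly)"
  shows "hilbert_function I (Suc i) + mp.dim (colon I l \<inter> Rd i)
    = hilbert_function (adjoin I l) (Suc i) + mp.dim (Rd i :: ('n, 'k) mpoly set)"
proof -
  have IR: "rideal I" using I by (simp add: hideal_def)
  have eq1: "{u + l * v | u v. u \<in> I \<inter> Rd (Suc i) \<and> v \<in> Rd i} = adjoin I l \<inter> Rd (Suc i)"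
  proof safe
    fix u v :: "('n, 'k) mpoly" assume u: "u \<in> I" "u \<in> Rd (Suc i)" and v: "v \<in> Rd i"
    show "u + l * v \<in> adjoin I l" using u(1) by (intro adjoinI[of _ v]) (simp add: mult.commute)
    show "u + l * v \<in> Rd (Suc i)" using u v homogeneous_mult[OF l, of i v] by (simp add: Rd_def homogeneous_add)
  next
    fix p assume p: "p \<in> adjoin I l" "p \<in> Rd (Suc i)"
    then obtain r where r: "p - r * l \<in> I" by (elim adjoinE)
    have "hcomp (Suc i) (p - l * r) \<in> I" using hideal_hcomp[OF I r] by (simp add: mult.commute)
    moreover have "hcomp (Suc i) (p - l * r) = p - l * hcomp i r"
      using p(2) by (simp add: hcomp_diff Rd_def hcomp_homogeneous[of "Suc i"] hcomp_mult_homogeneous[OF l])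
    ultimately have "p - l * hcomp i r \<in> I \<inter> Rd (Suc i)"
      using homogeneous_hcomp[of "Suc i" "p - l * r"] by (simp add: Rd_def)
    moreover have "hcomp i r \<in> Rd i" by (simp add: Rd_def)
    moreover have "p = (p - l * hcomp i r) + l * hcomp i r" by simp
    ultimately show "\<exists>u v. p = u + l * v \<and> u \<in> I \<inter> Rd (Suc i) \<and> v \<in> Rd i" by blast
  qed
  have eq2: "{v \<in> Rd i. l * v \<in> I \<inter> Rd (Suc i)} = colon I l \<inter> Rd i"
    using homogeneous_mult[OF l] by (auto simp: colon_def Rd_def)
  have "mp.subspace (I \<inter> Rd (Suc i))"
    by (intro mp.subspace_inter subspace_rideal IR subspace_Rd)
  moreover have "I \<inter> Rd (Suc i) \<subseteq> mp.span (monomials (Suc i))" using Rd_subset_span by blast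
  ultimately have "mp.dim (adjoin I l \<inter> Rd (Suc i)) + mp.dim (colon I l \<inter> Rd i)
      = mp.dim (I \<inter> Rd (Suc i)) + mp.dim (Rd i :: ('n, 'k) mpoly set)"
    using mp2.dim_add_image[OF linear_mult subspace_Rd _ finite_monomials Rd_subset_span finite_monomials,
        of "I \<inter> Rd (Suc i)" "Suc i" l i] unfolding eq1 eq2 by blast
  then show ?thesis
    using hilbert_function_add[of I "Suc i"] hilbert_function_add[of "adjoin I l" "Suc i"] by linarith
qed

lemma hilbert_function_adjoin_ge:
  assumes I: "hideal I" and l: "homogeneous 1 (l :: ('n::finite, 'k::field) mpoly)"
  shows "hilbert_function I (Suc i) \<le> hilbert_function (adjoin I l) (Suc i) + hilbert_function I i"
proof -
  have "mp.dim (I \<inter> Rd i) \<le> mp.dim (colon I l \<inter> Rd i)"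
    using colon_superset[of I l] I Rd_subset_span[of i]
    by (intro mp.dim_subspace_mono[OF _ finite_monomials[of i]]) (auto simp: hideal_def)
  then show ?thesis
    using hilbert_function_adjoin_aux[OF assms, of i] hilbert_function_add[of I i] by linarith
qed

text \<open>Equality of the counts forces \<open>colon I l\<close> and \<open>I\<close> to agree in
  every degree. This makes regularity of a linear form a purely numerical condition.\<close>

lemma hilbert_function_adjoin_regular_iff:
  assumes I: "hideal I" and l: "homogeneous 1 (l :: ('n::finite, 'k::field) mpoly)"
  shows "regular_mod I l \<longleftrightarrow>
    (\<forall>i. hilbert_function I (Suc i) = hilbert_function (adjoin I l) (Suc i) + hilbert_function I i)"
proof
  assume "regular_mod I l"
  then have "colon I l = I" using colon_superset[of I l] I by (auto simp: colon_def regular_mod_def hideal_def)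
  then have "hilbert_function I (Suc i) + mp.dim (I \<inter> Rd i)
      = hilbert_function (adjoin I l) (Suc i) + mp.dim (Rd i :: ('n, 'k) mpoly set)" for i
    using hilbert_function_adjoin_aux[OF assms, of i] by simp
  then show "\<forall>i. hilbert_function I (Suc i) = hilbert_function (adjoin I l) (Suc i) + hilbert_function I i"
    using hilbert_function_add[of I] by (smt (verit) add.assoc add.commute add_right_cancel)
next
  assume eq: "\<forall>i. hilbert_function I (Suc i) = hilbert_function (adjoin I l) (Suc i) + hilbert_function I i"
  have "I \<inter> Rd i = colon I l \<inter> Rd i" for i
  proof (rule mp.dim_subspace_eq[of _ _ "monomials i"])
    show "mp.subspace (I \<inter> Rd i)" using I by (intro mp.subspace_inter subspace_rideal subspace_Rd) (simp add: hideal_def)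
    show "I \<inter> Rd i \<subseteq> colon I l \<inter> Rd i" using colon_superset[of I l] I by (auto simp: hideal_def)
    show "finite (monomials i)" by (rule finite_monomials)
    show "colon I l \<inter> Rd i \<subseteq> mp.span (monomials i)" using Rd_subset_span by blast
    show "mp.dim (colon I l \<inter> Rd i) \<le> mp.dim (I \<inter> Rd i)"
      using spec[OF eq, of i] hilbert_function_adjoin_aux[OF assms, of i] hilbert_function_add[of I i] by linarith
  qed
  then have *: "p \<in> I" if "homogeneous i p" "l * p \<in> I" for p i using that by (auto simp: colon_def Rd_def)
  show "regular_mod I l"
    unfolding regular_mod_def
  proof (intro allI impI)
    fix c assume c: "l * c \<in> I"
    have "hcomp i c \<in> I" for i
      using *[OF homogeneous_hcomp] hideal_hcomp[OF I c, of "Suc i"] by (simp add: hcomp_mult_homogeneous[OF l])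
    then show "c \<in> I" using hideal_mem_iff[OF I] by blast
  qed
qed

lemma hilbert_function_adjoin_0:
  assumes I: "hideal I" and l: "homogeneous 1 l"
  shows "hilbert_function (adjoin I l) 0 = hilbert_function I 0"
proof -
  have "p \<in> I" if p: "p \<in> adjoin I l" "p \<in> Rd 0" for p
  proof -
    obtain r where r: "p - r * l \<in> I" using p(1) by (rule adjoinE)
    have "hcomp 0 (p - l * r) \<in> I" using hideal_hcomp[OF I r] by (simp add: mult.commute)
    then show ?thesis using p(2) by (simp add: hcomp_diff Rd_def hcomp_homogeneous[of 0] hcomp_mult_homogeneous[OF l])
  qed
  then have "adjoin I l \<inter> Rd 0 = I \<inter> Rd 0" using adjoin_superset[of I l] by blast
  then show ?thesis by (simp add: hilbert_function_alt)
qed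

section \<open>Systems of parameters consisting of linear forms\<close>

lemma rideal_const_mult_iff:
  assumes "rideal I" "c \<noteq> (0::'k::field)"
  shows "Poly_Mapping.single 0 c * p \<in> I \<longleftrightarrow> p \<in> (I :: ('n, 'k) mpoly set)"
proof
  assume "Poly_Mapping.single 0 c * p \<in> I"
  then have "Poly_Mapping.single 0 (inverse c) * (Poly_Mapping.single 0 c * p) \<in> I"
    by (rule rideal_mult_left[OF assms(1)])
  then show "p \<in> I" using assms(2) by (simp add: mult.assoc[symmetric] mult_single)
qed (rule rideal_mult_left[OF assms(1)])

text \<open>On the line \<open>l + c * x\<close> each ideal already avoided excludes at most one
  scalar \<open>c\<close>, since two would put \<open>x\<close> and then \<open>l\<close> into it;
  the new ideal, which contains \<open>l\<close> but not \<open>x\<close>, excludes only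
  \<open>c = 0\<close>. An infinite field leaves a choice.\<close>

lemma linear_form_avoiding:
  fixes \<P> :: "('n::finite, 'k::field) mpoly set set"
  assumes inf: "infinite (UNIV :: 'k set)" and fin: "finite \<P>"
    and P: "\<And>P. P \<in> \<P> \<Longrightarrow> rideal P" "\<And>P. P \<in> \<P> \<Longrightarrow> \<not> range Var \<subseteq> P"
  obtains l where "homogeneous 1 l" "\<And>P. P \<in> \<P> \<Longrightarrow> l \<notin> P"
proof -
  have "\<exists>l. homogeneous 1 l \<and> (\<forall>P\<in>\<P>. l \<notin> P)"
    using fin P
  proof (induction \<P> rule: finite_induct)
    case empty
    then show ?case by (intro exI[of _ 0]) auto
  next
    case (insert P \<P>)
    then obtain l where l: "homogeneous 1 l" "\<forall>Q\<in>\<P>. l \<notin> Q" by (metis insertCI)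
    obtain i where i: "Var i \<notin> P" using insert.prems(2)[of P] by auto
    define x where "x = (Var i :: ('n, 'k) mpoly)"
    let ?bad = "\<lambda>Q. {c :: 'k. l + Poly_Mapping.single 0 c * x \<in> Q}"
    show ?case
    proof (cases "l \<in> P")
      case False
      then show ?thesis using l by blast
    next
      case True
      have "finite (?bad Q)" if Q: "Q \<in> \<P>" for Q
      proof -
        have QI: "rideal Q" using insert.prems(1) Q by blast
        have "c = c'" if c: "c \<in> ?bad Q" "c' \<in> ?bad Q" for c c'
        proof (rule ccontr)
          assume ne: "c \<noteq> c'"
          have "(l + Poly_Mapping.single 0 c * x) - (l + Poly_Mapping.single 0 c' * x) \<in> Q"
            using c QI by (intro rideal_diff) auto
          then have "Poly_Mapping.single 0 (c - c') * x \<in> Q"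
            by (simp add: single_diff left_diff_distrib)
          then have "x \<in> Q" using rideal_const_mult_iff[OF QI, of "c - c'"] ne by simp
          then have "Poly_Mapping.single 0 c * x \<in> Q" using QI by (rule rideal_mult_left[rotated])
          then have "(l + Poly_Mapping.single 0 c * x) - Poly_Mapping.single 0 c * x \<in> Q"
            using c(1) QI by (intro rideal_diff) auto
          then show False using l(2) Q by simp
        qed
        then have "?bad Q \<subseteq> {SOME c. c \<in> ?bad Q}" by (metis (mono_tags, lifting) someI_ex singletonI subsetI)
        then show ?thesis using finite_subset by blast
      qed
      then have "finite ({0} \<union> \<Union> (?bad ` \<P>))" using insert.hyps(1) by blast
      then obtain c where c: "c \<notin> {0} \<union> \<Union> (?bad ` \<P>)" using inf ex_new_if_finite by blast
      have PI: "rideal P" using insert.prems(1) by blast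
      have "l + Poly_Mapping.single 0 c * x \<notin> P"
      proof
        assume "l + Poly_Mapping.single 0 c * x \<in> P"
        then have "(l + Poly_Mapping.single 0 c * x) - l \<in> P" using True PI rideal_diff by blast
        then show False using rideal_const_mult_iff[OF PI, of c x] c i by (simp add: x_def)
      qed
      moreover have "homogeneous 1 (l + Poly_Mapping.single 0 c * x)"
        using l(1) homogeneous_scale[OF homogeneous_Var, of c i] by (simp add: x_def homogeneous_add)
      ultimately show ?thesis using c by (intro exI[of _ "l + Poly_Mapping.single 0 c * x"]) auto
    qed
  qed
  then show thesis using that by blast
qed

section \<open>Dimension after adding a linear form, and dimension zero\<close>

lemma prime_contains_factor:
  assumes Q: "rprime Q" "I \<subseteq> Q"
    and prod: "\<And>xs. length xs = length Ps \<Longrightarrow> (\<forall>i<length Ps. xs ! i \<in> Ps ! i) \<Longrightarrow> prod_list xs \<in> I"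
  shows "\<exists>P\<in>set Ps. P \<subseteq> Q"
proof (rule ccontr)
  assume "\<not> (\<exists>P\<in>set Ps. P \<subseteq> Q)"
  then have "\<exists>x. x \<in> Ps ! i \<and> x \<notin> Q" if "i < length Ps" for i using that nth_mem by blast
  then obtain x where x: "\<And>i. i < length Ps \<Longrightarrow> x i \<in> Ps ! i \<and> x i \<notin> Q" by metis
  let ?xs = "map x [0..<length Ps]"
  have "prod_list ?xs \<in> Q" using prod[of ?xs] x Q(2) by auto
  moreover have "prod_list ys \<notin> Q" if "\<forall>y\<in>set ys. y \<notin> Q" for ys
    using that Q(1) by (induction ys) (auto simp: rprime_def)
  ultimately show False using x by fastforce
qed

lemma not_in_mmax_unit:
  assumes "rideal Q" "mmax \<subseteq> Q" "a \<in> Q" "a \<notin> (mmax :: ('n::finite, 'k::field) mpoly set)"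
  shows "Q = UNIV"
proof -
  let ?c = "Poly_Mapping.lookup a 0"
  have "a - Poly_Mapping.single 0 ?c \<in> mmax" by (simp add: mmax_def lookup_minus)
  then have "a - (a - Poly_Mapping.single 0 ?c) \<in> Q" using assms by (blast intro: rideal_diff[of Q])
  then have "Poly_Mapping.single 0 ?c * 1 \<in> Q" by simp
  moreover have "?c \<noteq> 0" using assms(4) by (simp add: mmax_def)
  ultimately have "1 \<in> Q" using rideal_const_mult_iff[OF assms(1), of ?c 1] by blast
  then show ?thesis using rideal_one_iff[OF assms(1)] by simp
qed

lemma rprime_mmax: "rprime (mmax :: ('n::finite, 'k::field) mpoly set)"
  using rideal_mmax by (auto simp: rprime_def mmax_def lookup_mult_zero)

text \<open>The lowest prime of the chain contains a prime of the list, and strictly so, because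
  \<open>l\<close> avoids the latter. Only a prime containing all variables need not be avoided; it
  cannot lie under a chain with at least one inclusion, by maximality of \<open>mmax\<close>. Hence
  the length is \<open>Suc d\<close>.\<close>

lemma prime_chain_adjoin:
  fixes I :: "('n::finite, 'k::field) mpoly set"
  assumes Ps: "\<And>P. P \<in> set Ps \<Longrightarrow> rprime P \<and> I \<subseteq> P"
    and prod: "\<And>xs. length xs = length Ps \<Longrightarrow> (\<forall>i<length Ps. xs ! i \<in> Ps ! i) \<Longrightarrow> prod_list xs \<in> I"
    and l: "\<And>P. P \<in> set Ps \<Longrightarrow> \<not> range Var \<subseteq> P \<Longrightarrow> l \<notin> P" and I: "rideal I"
    and chain: "prime_chain (adjoin I l) (Suc d)"
  shows "prime_chain I (Suc (Suc d))"
proof -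
  obtain Q where Q: "\<And>i. i \<le> Suc d \<Longrightarrow> rprime (Q i)" "\<And>i. i \<le> Suc d \<Longrightarrow> adjoin I l \<subseteq> Q i"
    "\<And>i. i < Suc d \<Longrightarrow> Q i \<subset> Q (Suc i)"
    using chain unfolding prime_chain_def by metis
  have "I \<subseteq> Q 0" using Q(2)[of 0] adjoin_superset[of I l] by simp
  then obtain P where P: "P \<in> set Ps" "P \<subseteq> Q 0"
    using prime_contains_factor[OF Q(1)[of 0] _ prod] by blast
  have PI: "rprime P" "I \<subseteq> P" using Ps P(1) by auto
  have "\<not> range Var \<subseteq> P"
  proof
    assume "range Var \<subseteq> P"
    then have "mmax \<subseteq> P" using mmax_subset_if_Vars PI(1) by (auto simp: rprime_def)
    then have m: "mmax \<subseteq> Q 0" using P(2) by simp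
    obtain a where a: "a \<in> Q 1" "a \<notin> Q 0" using Q(3)[of 0] by auto
    have "Q 1 = UNIV"
      using not_in_mmax_unit[of "Q 1" a] Q(1)[of 1] Q(3)[of 0] m a by (auto simp: rprime_def)
    then show False using Q(1)[of 1] by (simp add: rprime_def)
  qed
  then have "l \<notin> P" using l P(1) by blast
  moreover have "l \<in> Q 0" using Q(2)[of 0] adjoin_self[OF I, of l] by auto
  ultimately have ss: "P \<subset> Q 0" using P(2) by blast
  show ?thesis
    unfolding prime_chain_def
  proof (intro exI[of _ "\<lambda>i. case i of 0 \<Rightarrow> P | Suc j \<Rightarrow> Q j"] conjI allI impI)
    fix i assume i: "i \<le> Suc (Suc d)"
    show "rprime (case i of 0 \<Rightarrow> P | Suc j \<Rightarrow> Q j)" using PI Q(1) i by (cases i) auto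
    show "I \<subseteq> (case i of 0 \<Rightarrow> P | Suc j \<Rightarrow> Q j)"
    proof (cases i)
      case (Suc j)
      then show ?thesis using Q(2)[of j] i adjoin_superset[of I l] by auto
    qed (use PI in auto)
  next
    fix i assume "i < Suc (Suc d)"
    then show "(case i of 0 \<Rightarrow> P | Suc j \<Rightarrow> Q j) \<subset> (case Suc i of 0 \<Rightarrow> P | Suc j \<Rightarrow> Q j)"
      using ss Q(3) by (cases i) auto
  qed
qed

text \<open>In dimension 0 a listed prime inside \<open>mmax\<close> equals \<open>mmax\<close>. The
  listed primes are not known to be homogeneous, so others may occur; each of these contains an
  element with constant term 1, and the product of such elements is removed by
  \<open>hideal_cancel_unit\<close>.\<close>

lemma mmax_products_in_ideal:
  fixes I :: "('n::finite, 'k::field) mpoly set"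
  assumes I: "hideal I" and dim: "\<not> prime_chain I 1"
  obtains k where "\<And>xs. length xs = k \<Longrightarrow> set xs \<subseteq> mmax \<Longrightarrow> prod_list xs \<in> I"
proof -
  obtain Ps where Ps: "\<And>P. P \<in> set Ps \<Longrightarrow> rprime P \<and> I \<subseteq> P"
    and prod: "\<And>xs. length xs = length Ps \<Longrightarrow> (\<forall>i<length Ps. xs ! i \<in> Ps ! i) \<Longrightarrow> prod_list xs \<in> I"
    using primes_product_in_ideal[OF acc_mpoly hideal_rideal[OF I]] by blast
  have "\<exists>v. Poly_Mapping.lookup v 0 = 1 \<and> (\<forall>x\<in>mmax. v * x \<in> Ps ! i)" if "i < length Ps" for i
  proof (cases "Ps ! i \<subseteq> mmax")
    case True
    have P: "rprime (Ps ! i)" "I \<subseteq> Ps ! i" using Ps that by auto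
    have "Ps ! i = mmax"
    proof (rule ccontr)
      assume "Ps ! i \<noteq> mmax"
      then have "prime_chain I 1"
        unfolding prime_chain_def using P True rprime_mmax
        by (intro exI[of _ "\<lambda>j. if j = 0 then Ps ! i else mmax"]) auto
      then show False using dim by simp
    qed
    then show ?thesis by (intro exI[of _ 1]) simp
  next
    case False
    then obtain a where a: "a \<in> Ps ! i" "Poly_Mapping.lookup a 0 \<noteq> 0" by (auto simp: mmax_def)
    have R: "rideal (Ps ! i)" using Ps that by (auto simp: rprime_def)
    define v where "v = Poly_Mapping.single 0 (inverse (Poly_Mapping.lookup a 0)) * a"
    have "v \<in> Ps ! i" unfolding v_def by (rule rideal_mult_left[OF R a(1)])
    then have "\<forall>x\<in>mmax. v * x \<in> Ps ! i" using rideal_mult_right[OF R] by blast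
    moreover have "Poly_Mapping.lookup v 0 = 1" using a(2) by (simp add: v_def lookup_mult_zero)
    ultimately show ?thesis by blast
  qed
  then obtain v where v: "\<And>i. i < length Ps \<Longrightarrow> Poly_Mapping.lookup (v i) 0 = 1"
    "\<And>i x. i < length Ps \<Longrightarrow> x \<in> mmax \<Longrightarrow> v i * x \<in> Ps ! i" by metis
  define vs where "vs = map v [0..<length Ps]"
  have "Poly_Mapping.lookup (prod_list ws) 0 = 1" if "\<forall>w\<in>set ws. Poly_Mapping.lookup w 0 = (1::'k)"
    for ws :: "('n, 'k) mpoly list" using that by (induction ws) (auto simp: lookup_mult_zero)
  then have u: "1 - prod_list vs \<in> mmax" using v(1) by (auto simp: vs_def mmax_def lookup_minus)
  show thesis
  proof (rule that[of "length Ps"])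
    fix xs :: "('n, 'k) mpoly list" assume xs: "length xs = length Ps" "set xs \<subseteq> mmax"
    have "prod_list (map2 (*) vs xs) \<in> I"
    proof (rule prod)
      show "length (map2 (*) vs xs) = length Ps" by (simp add: vs_def xs)
      show "\<forall>i<length Ps. map2 (*) vs xs ! i \<in> Ps ! i"
      proof (intro allI impI)
        fix i assume i: "i < length Ps"
        then have "xs ! i \<in> mmax" using xs nth_mem[of i xs] by auto
        then show "map2 (*) vs xs ! i \<in> Ps ! i" using v(2) i xs(1) by (simp add: vs_def)
      qed
    qed
    moreover have "prod_list (map2 (*) as bs) = prod_list as * prod_list bs" if "length as = length bs"
      for as bs :: "('n, 'k) mpoly list"
      using that by (induction as bs rule: list_induct2) (auto simp: ac_simps)
    ultimately have "prod_list vs * prod_list xs \<in> I" using xs(1) by (simp add: vs_def)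
    then show "prod_list xs \<in> I" by (rule hideal_cancel_unit[OF I u])
  qed
qed

subsection \<open>Independent linear forms form regular sequences\<close>

lemma hideal_zero: "hideal {0}"
  by (simp add: hideal_def rideal_def)

lemma hilbert_function_zero:
  "hilbert_function ({0} :: ('n::finite, 'k::field) mpoly set) d = (d + CARD('n) - 1) choose d"
proof -
  have "{0} \<inter> Rd d = ({0} :: ('n, 'k) mpoly set)" by (auto simp: Rd_def)
  moreover have "mp.dim ({0} :: ('n, 'k) mpoly set) = 0"
    using mp.dim_le_card[of "{0}" "{}"] by simp
  ultimately show ?thesis
    using hilbert_function_add[of "{0} :: ('n, 'k) mpoly set" d] dim_Rd[of d, where 'n = 'n and 'k = 'k] by simp
qed

lemma hilbert_function_adjoins_1:
  fixes ls :: "('n::finite, 'k::field) mpoly list"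
  assumes "\<And>l. l \<in> set ls \<Longrightarrow> homogeneous 1 l"
  shows "hilbert_function (adjoins {0} ls) 0 = 1" "CARD('n) \<le> hilbert_function (adjoins {0} ls) 1 + length ls"
  using assms
proof (induction ls rule: rev_induct)
  case Nil
  { case 1 show ?case by (simp add: hilbert_function_zero) }
  { case 2 show ?case by (simp add: hilbert_function_zero) }
next
  case (snoc l ls)
  have h: "hideal (adjoins {0} ls)" "homogeneous 1 l" if "\<And>k. k \<in> set (ls @ [l]) \<Longrightarrow> homogeneous 1 k"
    using hideal_adjoins[OF hideal_zero] that by auto
  { case 1
    show ?case using snoc(1) hilbert_function_adjoin_0[OF h] 1 by (simp add: adjoins_snoc) }
  { case 2
    show ?case using snoc(1,2) hilbert_function_adjoin_ge[OF h, of 0] 2 by (fastforce simp: adjoins_snoc) }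
qed

text \<open>Each linear form lowers the Hilbert function in degree 1 by at most one.\<close>

lemma Var_notin_adjoins:
  fixes ls :: "('n::finite, 'k::field) mpoly list"
  assumes "\<And>l. l \<in> set ls \<Longrightarrow> homogeneous 1 l" "length ls < CARD('n)"
  shows "\<not> range Var \<subseteq> adjoins {0} ls"
proof
  assume "range Var \<subseteq> adjoins {0} ls"
  then have "mmax \<subseteq> adjoins {0} ls"
    using mmax_subset_if_Vars rideal_adjoins hideal_zero by (auto simp: hideal_def)
  then have "adjoins {0} ls \<inter> Rd 1 = Rd 1" using homogeneous_in_mmax[of 1] by (auto simp: Rd_def)
  then have "hilbert_function (adjoins {0} ls) 1 = 0" by (simp add: hilbert_function_alt)
  then show False using hilbert_function_adjoins_1(2)[of ls, OF assms(1)] assms(2) by simp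
qed

lemma hilbert_function_mmax:
  "hilbert_function (mmax :: ('n::finite, 'k::field) mpoly set) (Suc d) = 0"
proof -
  have "mmax \<inter> Rd (Suc d) = (Rd (Suc d) :: ('n, 'k) mpoly set)"
    using homogeneous_in_mmax[of "Suc d"] by (auto simp: Rd_def)
  then show ?thesis by (simp add: hilbert_function_alt)
qed

text \<open>Pascal's rule for the number of monomials of degree \<open>Suc d\<close> in
  \<open>Suc k\<close> variables. The truncated subtraction gives the right values also for zero
  variables.\<close>

lemma choose_multichoose_rec: "(Suc d + Suc k - 1) choose Suc d = ((Suc d + k - 1) choose Suc d) + ((d + Suc k - 1) choose d)"
  by (cases k) (simp_all add: add.commute)

text \<open>No change of coordinates: the Hilbert functions of the initial ideals are squeezed
  between bounds obtained from \<open>{0}\<close> upwards and from \<open>mmax\<close> downwards,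
  and the resulting equalities are regularity.\<close>

lemma independent_linear_forms_regular:
  fixes ls :: "('n::finite, 'k::field) mpoly list"
  assumes ls: "\<And>l. l \<in> set ls \<Longrightarrow> homogeneous 1 l" "length ls = CARD('n)"
    and ind: "\<And>i. i < CARD('n) \<Longrightarrow> ls ! i \<notin> adjoins {0} (take i ls)"
  shows "weakly_regular {0} ls" "adjoins {0} ls = mmax"
proof -
  define L where "L i = adjoins {0} (take i ls)" for i
  define N where "N = CARD('n)"
  have tk: "homogeneous 1 l" if "l \<in> set (take i ls)" for l i using ls(1) that by (meson in_set_takeD)
  have hL: "hideal (L i)" for i unfolding L_def using hideal_adjoins[OF hideal_zero] tk by blast
  have hl: "homogeneous 1 (ls ! i)" if "i < N" for i using ls that by (simp add: N_def)
  have LS: "L (Suc i) = adjoin (L i) (ls ! i)" if "i < N" for i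
    using that ls(2) by (simp add: L_def N_def take_Suc_conv_app_nth adjoins_snoc)
  have H0: "hilbert_function (L i) 0 = 1" for i
    unfolding L_def using hilbert_function_adjoins_1(1) tk by blast
  have dim0: "mp.dim ({0} :: ('n, 'k) mpoly set) = 0" using mp.dim_le_card[of "{0}" "{}"] by simp
  \<comment> \<open>Independence means that no nonzero constant multiplies the next form into
    \<open>L i\<close>, so the value in degree 1 drops at every step and the last ideal contains all
    variables.\<close>
  have "hilbert_function (L i) 1 \<le> N - i" if "i \<le> N" for i
    using that
  proof (induction i)
    case 0
    then show ?case by (simp add: L_def hilbert_function_zero N_def)
  next
    case (Suc i)
    have "colon (L i) (ls ! i) \<inter> Rd 0 = {0}"
    proof safe
      fix p assume p: "p \<in> colon (L i) (ls ! i)" "p \<in> Rd 0"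
      then have pc: "p = Poly_Mapping.single 0 (Poly_Mapping.lookup p 0)"
        by (intro poly_mapping_eqI) (auto simp: Rd_def homogeneous_alt mdeg_eq_0_iff lookup_single when_def)
      show "p = 0"
      proof (rule ccontr)
        assume "p \<noteq> 0"
        then have c: "Poly_Mapping.lookup p 0 \<noteq> 0" using pc by (metis single_zero)
        have "Poly_Mapping.single 0 (Poly_Mapping.lookup p 0) * ls ! i \<in> L i"
          using p(1) pc by (simp add: colon_def mult.commute)
        then have "ls ! i \<in> L i" using rideal_const_mult_iff[OF hideal_rideal[OF hL] c] by blast
        then show False using ind[of i] Suc.prems by (simp add: L_def N_def)
      qed
    next
      show "0 \<in> colon (L i) (ls ! i)" using hL[of i] by (simp add: colon_def hideal_def rideal_zero)
      show "0 \<in> Rd 0" by (simp add: Rd_def)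
    qed
    then show ?case
      using hilbert_function_adjoin_aux[OF hL hl, of i i 0] Suc dim0 dim_Rd[of 0, where 'n = 'n and 'k = 'k]
      by (simp add: LS)
  qed
  from this[of N] have "hilbert_function (L N) 1 = 0" by simp
  then have "mp.dim (L N \<inter> Rd 1) = mp.dim (Rd 1 :: ('n, 'k) mpoly set)"
    using hilbert_function_add[of "L N" 1] by simp
  then have "L N \<inter> Rd 1 = Rd 1"
    using subspace_rideal[OF hideal_rideal[OF hL]] subspace_Rd
    by (intro mp.dim_subspace_eq[OF _ _ finite_monomials Rd_subset_span] mp.subspace_inter) auto
  then have "range Var \<subseteq> L N" using homogeneous_Var by (auto simp: Rd_def)
  then have "mmax \<subseteq> L N" using mmax_subset_if_Vars hL by (auto simp: hideal_def)
  moreover have "L N \<subseteq> mmax"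
    unfolding L_def using homogeneous_in_mmax[OF tk]
    by (intro adjoins_least rideal_mmax) (auto simp: mmax_def)
  ultimately have LN: "L N = mmax" by blast
  then show "adjoins {0} ls = mmax" using ls(2) by (simp add: L_def N_def)
  \<comment> \<open>Downwards from \<open>L N = mmax\<close>, each removed form costs at most what a
    regular element would.\<close>
  have upper: "hilbert_function (L (N - k)) d \<le> (d + k - 1) choose d" if "k \<le> N" for k d
    using that
  proof (induction k arbitrary: d)
    case 0
    show ?case
    proof (cases d)
      case 0 then show ?thesis by (simp add: H0)
    next
      case (Suc e) then show ?thesis using hilbert_function_mmax[of e, where 'n = 'n and 'k = 'k] by (simp add: LN)
    qed
  next
    case (Suc k)
    note IHk = Suc.IH and k = Suc.prems
    show ?case
    proof (induction d)
      case 0 then show ?case by (simp add: H0)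
    next
      case (Suc d)
      have i: "N - Suc k < N" "Suc (N - Suc k) = N - k" using k by auto
      have "hilbert_function (L (N - Suc k)) (Suc d)
          \<le> hilbert_function (L (N - k)) (Suc d) + hilbert_function (L (N - Suc k)) d"
        using hilbert_function_adjoin_ge[OF hL hl[OF i(1)]] LS[OF i(1)] i(2) by metis
      also have "\<dots> \<le> ((Suc d + k - 1) choose Suc d) + ((d + Suc k - 1) choose d)"
        using Suc.IH IHk[of "Suc d"] k by (intro add_mono) auto
      finally show ?case by (simp add: choose_multichoose_rec)
    qed
  qed
  \<comment> \<open>Upwards from the zero ideal, whose values are known, the same inequality bounds
    the next ideal from below, and \<open>upper\<close> closes the gap.\<close>
  have exact: "hilbert_function (L i) d = (d + (N - i) - 1) choose d" if "i \<le> N" for i d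
    using that
  proof (induction i arbitrary: d)
    case 0 then show ?case by (simp add: L_def hilbert_function_zero N_def)
  next
    case (Suc i)
    show ?case
    proof (cases d)
      case 0 then show ?thesis by (simp add: H0)
    next
      case (Suc e)
      have k: "N - i = Suc (N - Suc i)" using \<open>Suc i \<le> N\<close> by simp
      have "hilbert_function (L i) (Suc e) \<le> hilbert_function (L (Suc i)) (Suc e) + hilbert_function (L i) e"
        using hilbert_function_adjoin_ge[OF hL hl] LS \<open>Suc i \<le> N\<close> by simp
      then have "(Suc e + (N - Suc i) - 1) choose Suc e \<le> hilbert_function (L (Suc i)) (Suc e)"
        using Suc.IH \<open>Suc i \<le> N\<close> choose_multichoose_rec[of e "N - Suc i"] by (simp add: k del: binomial_Suc_Suc)
      then show ?thesis
        using upper[of "N - Suc i" d] \<open>Suc i \<le> N\<close> Suc by (simp add: le_antisym)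
    qed
  qed
  show "weakly_regular {0} ls"
    unfolding weakly_regular_def
  proof (intro allI impI)
    fix i assume "i < length ls"
    then have i: "i < N" using ls(2) by (simp add: N_def)
    then have k: "N - i = Suc (N - Suc i)" by simp
    have "regular_mod (L i) (ls ! i)"
      unfolding hilbert_function_adjoin_regular_iff[OF hL hl[OF i]]
    proof
      fix d
      have "(Suc d + (N - i) - 1) choose Suc d = ((Suc d + (N - Suc i) - 1) choose Suc d) + ((d + (N - i) - 1) choose d)"
        unfolding k by (rule choose_multichoose_rec)
      then show "hilbert_function (L i) (Suc d) = hilbert_function (adjoin (L i) (ls ! i)) (Suc d) + hilbert_function (L i) d"
        using exact[OF less_imp_le[OF i], of d] exact[OF less_imp_le[OF i], of "Suc d"]
          exact[OF Suc_leI[OF i], of "Suc d"] LS[OF i] by simp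
    qed
    then show "regular_mod (adjoins {0} (take i ls)) (ls ! i)" by (simp add: L_def)
  qed
qed

text \<open>One list serves both ideals and is independent: each new form avoids finitely many
  primes for \<open>I\<close> and for \<open>J\<close> together with the span of its predecessors.
  Initial segments of different lengths cut the two quotients down to dimension 0.\<close>

lemma linear_parameters_exist:
  fixes I J :: "('n::finite, 'k::field) mpoly set"
  assumes inf: "infinite (UNIV :: 'k set)" and I: "rideal I" and J: "rideal J"
    and dim: "\<not> prime_chain I (Suc a)" "\<not> prime_chain J (Suc b)" "a \<le> CARD('n)" "b \<le> CARD('n)"
  obtains ls where "length ls = CARD('n)" "\<And>l. l \<in> set ls \<Longrightarrow> homogeneous 1 l"
    "\<And>i. i < CARD('n) \<Longrightarrow> ls ! i \<notin> adjoins {0} (take i ls)"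
    "\<not> prime_chain (adjoins I (take a ls)) 1" "\<not> prime_chain (adjoins J (take b ls)) 1"
proof -
  \<comment> \<open>The truncated difference covers both regimes: while \<open>j < c\<close> the
    dimension bound drops by one, afterwards it stays at 0.\<close>
  have ext: "\<exists>Ps :: ('n, 'k) mpoly set list. (\<forall>P\<in>set Ps. rprime P) \<and>
      (\<forall>l c. (\<forall>P\<in>set Ps. \<not> range Var \<subseteq> P \<longrightarrow> l \<notin> P) \<longrightarrow> \<not> prime_chain K (Suc (c - j)) \<longrightarrow>
        \<not> prime_chain (adjoin K l) (Suc (c - Suc j)))" if K: "rideal K" for K j
  proof -
    obtain Ps where Ps: "\<And>P. P \<in> set Ps \<Longrightarrow> rprime P \<and> K \<subseteq> P"
      "\<And>xs. length xs = length Ps \<Longrightarrow> (\<forall>i<length Ps. xs ! i \<in> Ps ! i) \<Longrightarrow> prod_list xs \<in> K"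
      using primes_product_in_ideal[OF acc_mpoly K] by blast
    have "\<not> prime_chain (adjoin K l) (Suc (c - Suc j))"
      if l: "\<forall>P\<in>set Ps. \<not> range Var \<subseteq> P \<longrightarrow> l \<notin> P" "\<not> prime_chain K (Suc (c - j))" for l c
    proof (cases "j < c")
      case True
      then have "c - j = Suc (c - Suc j)" by simp
      show ?thesis
      proof
        assume "prime_chain (adjoin K l) (Suc (c - Suc j))"
        then have "prime_chain K (Suc (Suc (c - Suc j)))"
          using l(1) by (intro prime_chain_adjoin[OF Ps _ K]) blast+
        then show False using l(2) \<open>c - j = Suc (c - Suc j)\<close> by simp
      qed
    next
      case False
      then have "c - j = c - Suc j" by simp
      then show ?thesis using prime_chain_mono[OF _ adjoin_superset[of K l]] l(2) by metis
    qed
    then show ?thesis using Ps(1) by (intro exI[of _ Ps]) blast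
  qed
  have "\<exists>ls. length ls = i \<and> (\<forall>l\<in>set ls. homogeneous 1 l) \<and>
      (\<forall>j<i. ls ! j \<notin> adjoins {0} (take j ls)) \<and>
      (\<forall>j\<le>i. \<not> prime_chain (adjoins I (take j ls)) (Suc (a - j)) \<and>
             \<not> prime_chain (adjoins J (take j ls)) (Suc (b - j)))" if "i \<le> CARD('n)" for i
    using that
  proof (induction i)
    case 0
    then show ?case using dim by simp
  next
    case (Suc i)
    then obtain ls where ls: "length ls = i" "\<And>l. l \<in> set ls \<Longrightarrow> homogeneous 1 l"
      "\<And>j. j < i \<Longrightarrow> ls ! j \<notin> adjoins {0} (take j ls)"
      "\<And>j. j \<le> i \<Longrightarrow> \<not> prime_chain (adjoins I (take j ls)) (Suc (a - j))"
      "\<And>j. j \<le> i \<Longrightarrow> \<not> prime_chain (adjoins J (take j ls)) (Suc (b - j))" by auto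
    obtain Ps where Ps: "\<And>P. P \<in> set Ps \<Longrightarrow> rprime P"
      "\<And>l c. (\<forall>P\<in>set Ps. \<not> range Var \<subseteq> P \<longrightarrow> l \<notin> P) \<Longrightarrow> \<not> prime_chain (adjoins I ls) (Suc (c - i)) \<Longrightarrow>
        \<not> prime_chain (adjoin (adjoins I ls) l) (Suc (c - Suc i))"
      using ext[OF rideal_adjoins[OF I]] by meson
    obtain Qs where Qs: "\<And>P. P \<in> set Qs \<Longrightarrow> rprime P"
      "\<And>l c. (\<forall>P\<in>set Qs. \<not> range Var \<subseteq> P \<longrightarrow> l \<notin> P) \<Longrightarrow> \<not> prime_chain (adjoins J ls) (Suc (c - i)) \<Longrightarrow>
        \<not> prime_chain (adjoin (adjoins J ls) l) (Suc (c - Suc i))"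
      using ext[OF rideal_adjoins[OF J]] by meson
    \<comment> \<open>Avoiding \<open>adjoins {0} ls\<close> yields independence; it is a proper
      target because fewer forms than variables have been chosen.\<close>
    let ?A = "insert (adjoins {0} ls) {P \<in> set Ps \<union> set Qs. \<not> range Var \<subseteq> P}"
    have ideals: "rideal P" if "P \<in> ?A" for P
      using that Ps(1) Qs(1) rideal_adjoins[OF hideal_rideal[OF hideal_zero]] by (auto simp: rprime_def)
    have proper: "\<not> range Var \<subseteq> P" if "P \<in> ?A" for P
      using that Var_notin_adjoins[of ls] ls Suc.prems by auto
    obtain l where l: "homogeneous 1 l" "\<And>P. P \<in> ?A \<Longrightarrow> l \<notin> P"
      using linear_form_avoiding[OF inf _ ideals proper] by (metis (no_types, lifting) List.finite_set finite_Un finite_insert finite_subset mem_Collect_eq subsetI)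
    have nI: "\<not> prime_chain (adjoin (adjoins I ls) l) (Suc (a - Suc i))"
      using Ps(2)[of l a] l(2) ls(4)[of i] ls(1) by simp
    have nJ: "\<not> prime_chain (adjoin (adjoins J ls) l) (Suc (b - Suc i))"
      using Qs(2)[of l b] l(2) ls(5)[of i] ls(1) by simp
    show ?case
    proof (intro exI[of _ "ls @ [l]"] conjI allI impI)
      show "length (ls @ [l]) = Suc i" by (simp add: ls)
      show "\<forall>l\<in>set (ls @ [l]). homogeneous 1 l" using ls(2) l(1) by auto
    next
      fix j assume "j < Suc i"
      then show "(ls @ [l]) ! j \<notin> adjoins {0} (take j (ls @ [l]))"
        using ls(1,3) l(2) by (cases "j = i") (auto simp: nth_append)
    next
      fix j assume j: "j \<le> Suc i"
      show "\<not> prime_chain (adjoins I (take j (ls @ [l]))) (Suc (a - j))"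
        using ls(1,4) nI j by (cases "j = Suc i") (auto simp: adjoins_snoc)
      show "\<not> prime_chain (adjoins J (take j (ls @ [l]))) (Suc (b - j))"
        using ls(1,5) nJ j by (cases "j = Suc i") (auto simp: adjoins_snoc)
    qed
  qed
  from this[of "CARD('n)"] obtain ls where ls: "length ls = CARD('n)" "\<forall>l\<in>set ls. homogeneous 1 l"
    "\<forall>j<CARD('n). ls ! j \<notin> adjoins {0} (take j ls)"
    "\<forall>j\<le>CARD('n). \<not> prime_chain (adjoins I (take j ls)) (Suc (a - j)) \<and>
      \<not> prime_chain (adjoins J (take j ls)) (Suc (b - j))" by auto
  show thesis
  proof (rule that[of ls])
    show "\<not> prime_chain (adjoins I (take a ls)) 1" using spec[OF ls(4), of a] dim(3) by simp
    show "\<not> prime_chain (adjoins J (take b ls)) 1" using spec[OF ls(4), of b] dim(4) by simp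
  qed (use ls in blast)+
qed

section \<open>The resolution modulo an ideal\<close>

text \<open>Vectors are functions on all naturals of which the first \<open>n\<close> entries count;
  equations between vectors are therefore quantified over bounded indices.\<close>

definition mv :: "(nat \<Rightarrow> nat \<Rightarrow> 'a::comm_ring_1) \<Rightarrow> nat \<Rightarrow> (nat \<Rightarrow> 'a) \<Rightarrow> nat \<Rightarrow> 'a" where
  "mv A n v i = (\<Sum>j<n. A i j * v j)"

definition dotp :: "(nat \<Rightarrow> 'a::comm_ring_1) \<Rightarrow> nat \<Rightarrow> (nat \<Rightarrow> 'a) \<Rightarrow> 'a" where
  "dotp a n v = (\<Sum>j<n. a j * v j)"

lemma mv_add: "mv A n (\<lambda>j. v j + w j) i = mv A n v i + mv A n w i"
  and mv_diff: "mv A n (\<lambda>j. v j - w j) i = mv A n v i - mv A n w i"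
  and mv_uminus: "mv A n (\<lambda>j. - v j) i = - mv A n v i"
  and mv_scale: "mv A n (\<lambda>j. c * v j) i = c * mv A n v i"
  by (simp_all add: mv_def algebra_simps sum.distrib sum_subtractf sum_negf sum_distrib_left)

lemma dotp_add: "dotp a n (\<lambda>j. v j + w j) = dotp a n v + dotp a n w"
  and dotp_diff: "dotp a n (\<lambda>j. v j - w j) = dotp a n v - dotp a n w"
  and dotp_uminus: "dotp a n (\<lambda>j. - v j) = - dotp a n v"
  and dotp_scale: "dotp a n (\<lambda>j. c * v j) = c * dotp a n v"
  by (simp_all add: dotp_def algebra_simps sum.distrib sum_subtractf sum_negf sum_distrib_left)

lemma mv_mem: "rideal L \<Longrightarrow> (\<And>j. j < n \<Longrightarrow> v j \<in> L) \<Longrightarrow> mv A n v i \<in> L"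
  unfolding mv_def by (intro rideal_sum rideal_mult_left) auto

lemma dotp_mem: "rideal L \<Longrightarrow> (\<And>j. j < n \<Longrightarrow> v j \<in> L) \<Longrightarrow> dotp a n v \<in> L"
  unfolding dotp_def by (intro rideal_sum rideal_mult_left) auto

text \<open>\<open>f\<close> is the vector of signed maximal minors of \<open>N\<close>, \<open>g\<close> consists of the signed
  maximal minors of \<open>M_t\<close> that omit a column of \<open>N\<close>, and \<open>S\<close> is the skew-symmetric matrix
  that makes \<open>(f, g)\<close> the vector of Pfaffians of the block matrix with rows \<open>(S, N)\<close> and \<open>(- N\<^sup>T, 0)\<close>.\<close>

locale pfaffian_data =
  fixes s :: nat and N S :: "nat \<Rightarrow> nat \<Rightarrow> 'a::comm_ring_1" and f g :: "nat \<Rightarrow> 'a"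
  assumes fN: "\<And>j. j < s \<Longrightarrow> (\<Sum>i<Suc s. f i * N i j) = 0"
    and adj: "\<And>c. \<exists>W.
      (\<forall>j<s. \<forall>k<s. (\<Sum>i<Suc s. W j i * N i k) = (if j = k then \<Sum>i<Suc s. f i * c i else 0)) \<and>
      (\<forall>i<Suc s. \<forall>k<Suc s. c i * f k + (\<Sum>j<s. N i j * W j k) = (if i = k then \<Sum>i<Suc s. f i * c i else 0))"
    and Sf: "\<And>i. i < Suc s \<Longrightarrow> (\<Sum>k<Suc s. S i k * f k) = - (\<Sum>j<s. N i j * g j)"
    and fS: "\<And>k. k < Suc s \<Longrightarrow> (\<Sum>i<Suc s. f i * S i k) = (\<Sum>j<s. N k j * g j)"
    and gg: "\<And>j k. j < s \<Longrightarrow> k < s \<Longrightarrow> \<exists>u. \<forall>l<s.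
      (\<Sum>i<Suc s. N i l * u i) = (if l = j then g k else 0) - (if l = k then g j else 0)"
begin

abbreviation "NV v \<equiv> mv N s v"
abbreviation "NT u \<equiv> mv (\<lambda>j i. N i j) (Suc s) u"
abbreviation "SV u \<equiv> mv S (Suc s) u"
abbreviation "fd a \<equiv> dotp f (Suc s) a"
abbreviation "gd b \<equiv> dotp g s b"

declare sum.lessThan_Suc [simp del]

definition J where "J = range fd"
definition I where "I = {fd a + gd b | a b. True}"

lemma NT_f: "j < s \<Longrightarrow> NT f j = 0"
  using fN[of j] by (simp add: mv_def mult.commute)

lemma fd_NV: "fd (NV v) = 0"
proof -
  have "fd (NV v) = (\<Sum>j<s. v j * (\<Sum>i<Suc s. f i * N i j))"
    unfolding dotp_def mv_def sum_distrib_left by (subst sum.swap) (simp add: ac_simps)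
  then show ?thesis using fN by simp
qed

text \<open>With \<open>fd_NV\<close> this says that the block matrix followed by (f, g) is zero.
  The identity holds in the ring itself and not only modulo \<open>L\<close>, which
  \<open>regular_mod_lift\<close> exploits.\<close>

lemma fd_SV: "fd (SV u) = gd (NT u)"
proof -
  have "fd (SV u) = (\<Sum>k<Suc s. u k * (\<Sum>i<Suc s. f i * S i k))"
    unfolding dotp_def mv_def sum_distrib_left by (subst sum.swap) (simp add: ac_simps del: sum.lessThan_Suc)
  also have "\<dots> = (\<Sum>k<Suc s. u k * (\<Sum>j<s. N k j * g j))" using fS by simp
  also have "\<dots> = gd (NT u)"
    unfolding dotp_def mv_def sum_distrib_left by (subst sum.swap) (simp add: ac_simps del: sum.lessThan_Suc)
  finally show ?thesis .
qed

lemma SV_f: "i < Suc s \<Longrightarrow> SV f i = - NV g i"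
  using Sf[of i] by (simp add: mv_def)

text \<open>\<open>W\<close> is later the upper part of the adjugate of the bordered matrix (N | c)
  with determinant \<open>p\<close>. The identities say that multiplication by \<open>p\<close> is
  null-homotopic on the complex formed by \<open>N\<close> and \<open>f\<close> and on the dual
  complex.\<close>

lemma J_elim:
  assumes "p \<in> J"
  obtains c W where
    "\<And>v j. j < s \<Longrightarrow> p * v j = mv W (Suc s) (NV v) j"
    "\<And>a i. i < Suc s \<Longrightarrow> p * a i = c i * fd a + NV (mv W (Suc s) a) i"
    "\<And>u i. i < Suc s \<Longrightarrow> p * u i = f i * dotp c (Suc s) u + mv (\<lambda>i j. W j i) s (NT u) i"
    "\<And>b j. j < s \<Longrightarrow> p * b j = NT (mv (\<lambda>i j. W j i) s b) j"
    "p = fd c"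
proof -
  obtain c where c: "p = fd c" using assms by (auto simp: J_def)
  obtain W where W1: "\<And>j k. j < s \<Longrightarrow> k < s \<Longrightarrow> (\<Sum>i<Suc s. W j i * N i k) = (if j = k then p else 0)"
    and W2: "\<And>i k. i < Suc s \<Longrightarrow> k < Suc s \<Longrightarrow> c i * f k + (\<Sum>j<s. N i j * W j k) = (if i = k then p else 0)"
    using adj[of c] unfolding c dotp_def by blast
  have delta: "(\<Sum>k<n. (if j = k then p else 0) * v k) = p * v j" if "j < n" for v and j n :: nat
    using that by (simp add: if_distrib[of "\<lambda>x. x * _"] cong: if_cong)
  show thesis
  proof (rule that[of W c])
    fix v j assume j: "j < s"
    have "mv W (Suc s) (NV v) j = (\<Sum>k<s. (\<Sum>i<Suc s. W j i * N i k) * v k)"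
      unfolding mv_def sum_distrib_left sum_distrib_right by (subst sum.swap) (simp add: ac_simps del: sum.lessThan_Suc)
    also have "\<dots> = (\<Sum>k<s. (if j = k then p else 0) * v k)" using W1[OF j] by simp
    finally show "p * v j = mv W (Suc s) (NV v) j" using delta[OF j] by simp
  next
    fix a i assume i: "i < Suc s"
    have "NV (mv W (Suc s) a) i = (\<Sum>k<Suc s. (\<Sum>j<s. N i j * W j k) * a k)"
      unfolding mv_def sum_distrib_left sum_distrib_right by (subst sum.swap) (simp add: ac_simps del: sum.lessThan_Suc)
    then have "c i * fd a + NV (mv W (Suc s) a) i = (\<Sum>k<Suc s. (c i * f k + (\<Sum>j<s. N i j * W j k)) * a k)"
      by (simp add: dotp_def sum_distrib_left sum.distrib algebra_simps del: sum.lessThan_Suc)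
    also have "\<dots> = (\<Sum>k<Suc s. (if i = k then p else 0) * a k)" using W2[OF i] by (intro sum.cong) auto
    finally show "p * a i = c i * fd a + NV (mv W (Suc s) a) i" using delta[OF i] by simp
  next
    fix u i assume i: "i < Suc s"
    have "mv (\<lambda>i j. W j i) s (NT u) i = (\<Sum>k<Suc s. (\<Sum>j<s. N k j * W j i) * u k)"
      unfolding mv_def sum_distrib_left sum_distrib_right by (subst sum.swap) (simp add: ac_simps del: sum.lessThan_Suc)
    then have "f i * dotp c (Suc s) u + mv (\<lambda>i j. W j i) s (NT u) i
        = (\<Sum>k<Suc s. (c k * f i + (\<Sum>j<s. N k j * W j i)) * u k)"
      by (simp add: dotp_def sum_distrib_left sum.distrib algebra_simps del: sum.lessThan_Suc)
    also have "\<dots> = (\<Sum>k<Suc s. (if i = k then p else 0) * u k)" using W2[OF _ i] by (intro sum.cong) auto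
    finally show "p * u i = f i * dotp c (Suc s) u + mv (\<lambda>i j. W j i) s (NT u) i" using delta[OF i] by simp
  next
    fix b j assume j: "j < s"
    have "NT (mv (\<lambda>i j. W j i) s b) j = (\<Sum>k<s. (\<Sum>i<Suc s. W k i * N i j) * b k)"
      unfolding mv_def sum_distrib_left sum_distrib_right by (subst sum.swap) (simp add: ac_simps del: sum.lessThan_Suc)
    also have "\<dots> = (\<Sum>k<s. (if j = k then p else 0) * b k)" using W1[OF _ j] by (intro sum.cong) auto
    finally show "p * b j = NT (mv (\<lambda>i j. W j i) s b) j" using delta[OF j] by simp
  qed (rule c)
qed

text \<open>Says that the class of \<open>b\<close> in the cokernel of the transpose of
  \<open>N\<close> vanishes modulo \<open>L\<close>.\<close>

definition imT :: "'a set \<Rightarrow> (nat \<Rightarrow> 'a) \<Rightarrow> bool" where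
  "imT L b \<longleftrightarrow> (\<exists>u. \<forall>j<s. b j - NT u j \<in> L)"

lemma imT_add: "rideal L \<Longrightarrow> imT L b \<Longrightarrow> imT L b' \<Longrightarrow> imT L (\<lambda>j. b j + b' j)"
proof -
  assume L: "rideal L" and "imT L b" "imT L b'"
  then obtain u u' where u: "\<forall>j<s. b j - NT u j \<in> L" "\<forall>j<s. b' j - NT u' j \<in> L" by (auto simp: imT_def)
  have "b j + b' j - NT (\<lambda>i. u i + u' i) j \<in> L" if "j < s" for j
    using rideal_add[OF L, of "b j - NT u j" "b' j - NT u' j"] u that by (simp add: mv_add algebra_simps)
  then show ?thesis by (auto simp: imT_def)
qed

lemma imT_scale: "rideal L \<Longrightarrow> imT L b \<Longrightarrow> imT L (\<lambda>j. c * b j)"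
proof -
  assume L: "rideal L" and "imT L b"
  then obtain u where u: "\<forall>j<s. b j - NT u j \<in> L" by (auto simp: imT_def)
  have "c * b j - NT (\<lambda>i. c * u i) j \<in> L" if "j < s" for j
    using rideal_mult_left[OF L, of "b j - NT u j" c] u that by (simp add: mv_scale algebra_simps)
  then show ?thesis by (auto simp: imT_def)
qed

lemma imT_zero: "rideal L \<Longrightarrow> (\<And>j. j < s \<Longrightarrow> b j \<in> L) \<Longrightarrow> imT L b"
  unfolding imT_def by (intro exI[of _ "\<lambda>_. 0"]) (simp add: mv_def)

lemma imT_NT: "rideal L \<Longrightarrow> imT L (NT u)"
  unfolding imT_def by (intro exI[of _ u]) (simp add: rideal_zero)

lemma imT_cong: "imT L b \<Longrightarrow> (\<And>j. j < s \<Longrightarrow> b j = b' j) \<Longrightarrow> imT L b'"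
  by (simp add: imT_def)

lemma imT_sum: "rideal L \<Longrightarrow> (\<And>k. k \<in> K \<Longrightarrow> imT L (b k)) \<Longrightarrow> imT L (\<lambda>j. \<Sum>k\<in>K. b k j)"
  by (induction K rule: infinite_finite_induct) (auto simp: imT_add intro: imT_zero rideal_zero)

lemma imT_J: "rideal L \<Longrightarrow> p \<in> J \<Longrightarrow> imT L (\<lambda>j. p * b j)"
proof -
  assume L: "rideal L" and p: "p \<in> J"
  obtain c W where "\<And>b j. j < s \<Longrightarrow> p * b j = NT (mv (\<lambda>i j. W j i) s b) j" using J_elim[OF p] by metis
  then show ?thesis using imT_cong[OF imT_NT[OF L]] by simp
qed

text \<open>The cokernel of the transpose of \<open>N\<close> is annihilated by \<open>g k\<close> on the kernel of the map to
  \<open>R/J\<close> given by \<open>g\<close>.\<close>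

lemma imT_g:
  assumes L: "rideal L" and ab: "fd a + gd b \<in> L" and k: "k < s"
  shows "imT L (\<lambda>j. g k * b j)"
proof -
  have "\<exists>u. \<forall>l<s. NT u l = (if l = m then g k else 0) - (if l = k then g m else 0)" if "m < s" for m
    using gg[OF that k] by (simp add: mv_def mult.commute)
  then obtain u where u: "\<And>m l. m < s \<Longrightarrow> l < s \<Longrightarrow> NT (u m) l = (if l = m then g k else 0) - (if l = k then g m else 0)"
    by metis
  \<comment> \<open>The relations of \<open>gg\<close>, weighted with the entries of
    \<open>b\<close>, express \<open>g k\<close> times \<open>b\<close> by an image plus
    \<open>gd b\<close> times the unit vector at \<open>k\<close>.\<close>
  have eq: "g k * b l = (\<Sum>m<s. b m * NT (u m) l) + (if l = k then gd b else 0)" if l: "l < s" for l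
  proof -
    have "(\<Sum>m<s. b m * NT (u m) l) = (\<Sum>m<s. (if m = l then b m * g k else 0) - (if l = k then g m * b m else 0))"
      using u l by (intro sum.cong) auto
    also have "\<dots> = b l * g k - (if l = k then gd b else 0)"
      using l by (simp add: sum_subtractf dotp_def)
    finally show ?thesis by (simp add: mult.commute)
  qed
  \<comment> \<open>Modulo \<open>L\<close> the factor \<open>gd b\<close> equals
    \<open>- fd a\<close>, and elements of \<open>J\<close> annihilate the cokernel.\<close>
  have "imT L (\<lambda>l. if l = k then gd b else 0)"
  proof -
    have "imT L (\<lambda>l. - fd a * (if l = k then 1 else 0))"
      using imT_J[OF L, of "fd a" "\<lambda>l. - (if l = k then 1 else 0)"] by (simp add: J_def)
    moreover have "imT L (\<lambda>l. (fd a + gd b) * (if l = k then 1 else 0))"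
      using L ab by (intro imT_zero rideal_mult_right)
    ultimately have "imT L (\<lambda>l. - fd a * (if l = k then 1 else 0) + (fd a + gd b) * (if l = k then 1 else 0))"
      by (rule imT_add[OF L])
    then show ?thesis by (rule imT_cong) auto
  qed
  moreover have "imT L (\<lambda>l. \<Sum>m<s. b m * NT (u m) l)"
    by (intro imT_sum imT_scale imT_NT L)
  ultimately have "imT L (\<lambda>l. (\<Sum>m<s. b m * NT (u m) l) + (if l = k then gd b else 0))"
    by (intro imT_add[OF L])
  then show ?thesis by (rule imT_cong) (simp add: eq)
qed

lemma imT_I:
  assumes L: "rideal L" and ab: "fd a + gd b \<in> L" and w: "w \<in> I"
  shows "imT L (\<lambda>j. w * b j)"
proof -
  obtain c d where w: "w = fd c + gd d" using w by (auto simp: I_def)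
  have "imT L (\<lambda>j. \<Sum>k<s. d k * (g k * b j))"
    by (rule imT_sum[OF L], rule imT_scale[OF L], rule imT_g[OF L ab]) simp
  moreover have "imT L (\<lambda>j. fd c * b j)" by (rule imT_J[OF L]) (simp add: J_def)
  ultimately have "imT L (\<lambda>j. fd c * b j + (\<Sum>k<s. d k * (g k * b j)))" by (intro imT_add[OF L])
  then show ?thesis
    by (rule imT_cong) (simp add: w algebra_simps dotp_def[of g] sum_distrib_left)
qed

end

text \<open>The ideal \<open>L\<close> is kept general because exactness is used both for
  \<open>{0}\<close> and modulo initial segments of a sequence of linear forms.\<close>

locale pfaffian_acyclic = pfaffian_data +
  fixes L p q w
  assumes L: "rideal L" and pJ: "p \<in> J" and qJ: "q \<in> J" and wI: "w \<in> I"
    and rp: "regular_mod L p" and rq: "regular_mod (adjoin L p) q"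
    and rw: "regular_mod (adjoin (adjoin L p) q) w"
begin

lemma cancel_qp:
  assumes "q * x - p * y \<in> L" obtains e where "x - e * p \<in> L"
proof -
  have "q * x \<in> adjoin L p" using assms by (intro adjoinI[of _ y]) (simp add: mult.commute)
  then have "x \<in> adjoin L p" using rq by (simp add: regular_mod_def)
  then show thesis using that by (rule adjoinE)
qed

lemma cancel_p: "p * x \<in> L \<Longrightarrow> x \<in> L"
  using rp by (simp add: regular_mod_def)

lemma exact3:
  assumes "\<And>i. i < Suc s \<Longrightarrow> f i * x \<in> L" shows "x \<in> L"
proof -
  obtain c where c: "p = fd c" using pJ by (auto simp: J_def)
  have "p * x = (\<Sum>i<Suc s. c i * (f i * x))"
    unfolding c dotp_def sum_distrib_right by (simp add: ac_simps del: sum.lessThan_Suc)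
  also have "\<dots> \<in> L" by (rule rideal_sum[OF L], rule rideal_mult_left[OF L], rule assms) simp
  finally show ?thesis by (rule cancel_p)
qed

lemma NV_inj:
  assumes "\<And>i. i < Suc s \<Longrightarrow> NV v i \<in> L" "j < s" shows "v j \<in> L"
proof -
  obtain W where W: "\<And>v j. j < s \<Longrightarrow> p * v j = mv W (Suc s) (NV v) j" using J_elim[OF pJ] by metis
  have "p * v j \<in> L" unfolding W[OF assms(2)] by (rule mv_mem[OF L], rule assms(1))
  then show ?thesis by (rule cancel_p)
qed

text \<open>The homotopies solve the problem for \<open>p * a\<close> and \<open>q * a\<close>. By
  injectivity of \<open>N\<close> the solutions \<open>x\<close>, \<open>y\<close> satisfy
  \<open>q * x = p * y\<close> modulo \<open>L\<close>, so \<open>x\<close> is divisible by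
  \<open>p\<close> and the quotient solves it for \<open>a\<close>.\<close>

lemma ker_f:
  assumes a: "fd a \<in> L" obtains v where "\<And>i. i < Suc s \<Longrightarrow> a i - NV v i \<in> L"
proof -
  have *: "\<exists>x. \<forall>i<Suc s. z * a i - NV x i \<in> L" if z: "z \<in> J" for z
  proof -
    obtain c W where "\<And>a i. i < Suc s \<Longrightarrow> z * a i = c i * fd a + NV (mv W (Suc s) a) i"
      using J_elim[OF z] by metis
    then show ?thesis using rideal_mult_left[OF L a] by (intro exI[of _ "mv W (Suc s) a"]) simp
  qed
  obtain x where x: "\<And>i. i < Suc s \<Longrightarrow> p * a i - NV x i \<in> L" using *[OF pJ] by blast
  obtain y where y: "\<And>i. i < Suc s \<Longrightarrow> q * a i - NV y i \<in> L" using *[OF qJ] by blast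
  have "q * x j - p * y j \<in> L" if j: "j < s" for j
  proof (rule NV_inj[of "\<lambda>j. q * x j - p * y j", OF _ j])
    fix i assume i: "i < Suc s"
    have "p * (q * a i - NV y i) - q * (p * a i - NV x i) \<in> L"
      by (intro rideal_diff[OF L] rideal_mult_left[OF L] x[OF i] y[OF i])
    then show "NV (\<lambda>j. q * x j - p * y j) i \<in> L" by (simp add: mv_diff mv_scale algebra_simps)
  qed
  then have "\<exists>e. x j - e * p \<in> L" if "j < s" for j using cancel_qp that by metis
  then obtain v where v: "\<And>j. j < s \<Longrightarrow> x j - v j * p \<in> L" by metis
  have "a i - NV v i \<in> L" if i: "i < Suc s" for i
  proof (rule cancel_p)
    have "NV (\<lambda>j. x j - v j * p) i \<in> L" using v by (intro mv_mem L)
    then have "(p * a i - NV x i) + NV (\<lambda>j. x j - v j * p) i \<in> L" by (intro rideal_add[OF L] x[OF i])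
    then show "p * (a i - NV v i) \<in> L"
      using mv_scale[of N s p v i] by (simp add: mv_diff algebra_simps)
  qed
  then show thesis using that by blast
qed

text \<open>The argument of \<open>ker_f\<close> on the dual complex, with \<open>exact3\<close> in
  the role of injectivity of \<open>N\<close>.\<close>

lemma ker_NT:
  assumes u: "\<And>j. j < s \<Longrightarrow> NT u j \<in> L" obtains e where "\<And>i. i < Suc s \<Longrightarrow> u i - e * f i \<in> L"
proof -
  have *: "\<exists>C. \<forall>i<Suc s. z * u i - f i * C \<in> L" if z: "z \<in> J" for z
  proof -
    obtain c W where "\<And>u i. i < Suc s \<Longrightarrow> z * u i = f i * dotp c (Suc s) u + mv (\<lambda>i j. W j i) s (NT u) i"
      using J_elim[OF z] by metis
    then show ?thesis using mv_mem[OF L, of s "NT u"] u by (intro exI[of _ "dotp c (Suc s) u"]) simp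
  qed
  obtain C where C: "\<And>i. i < Suc s \<Longrightarrow> p * u i - f i * C \<in> L" using *[OF pJ] by blast
  obtain D where D: "\<And>i. i < Suc s \<Longrightarrow> q * u i - f i * D \<in> L" using *[OF qJ] by blast
  have "q * C - p * D \<in> L"
  proof (rule exact3)
    fix i assume i: "i < Suc s"
    have "p * (q * u i - f i * D) - q * (p * u i - f i * C) \<in> L"
      by (intro rideal_diff[OF L] rideal_mult_left[OF L] C[OF i] D[OF i])
    then show "f i * (q * C - p * D) \<in> L" by (simp add: algebra_simps)
  qed
  then obtain e where e: "C - e * p \<in> L" by (rule cancel_qp)
  have "u i - e * f i \<in> L" if i: "i < Suc s" for i
  proof (rule cancel_p)
    have "(p * u i - f i * C) + f i * (C - e * p) \<in> L"
      by (intro rideal_add[OF L] rideal_mult_left[OF L] C[OF i] e)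
    then show "p * (u i - e * f i) \<in> L" by (simp add: algebra_simps)
  qed
  then show thesis using that by blast
qed

text \<open>A Koszul argument: the kernel of the map induced by \<open>g\<close> is annihilated by the regular
  sequence \<open>p, q, w\<close>, whereas the cokernel of the transpose of \<open>N\<close> has projective dimension 2.\<close>

lemma ker_g:
  assumes ab: "fd a + gd b \<in> L" obtains u where "\<And>j. j < s \<Longrightarrow> b j - NT u j \<in> L"
proof -
  obtain x where x: "\<And>j. j < s \<Longrightarrow> p * b j - NT x j \<in> L" using imT_J[OF L pJ] by (auto simp: imT_def)
  obtain y where y: "\<And>j. j < s \<Longrightarrow> q * b j - NT y j \<in> L" using imT_J[OF L qJ] by (auto simp: imT_def)
  obtain z where z: "\<And>j. j < s \<Longrightarrow> w * b j - NT z j \<in> L" using imT_I[OF L ab wI] by (auto simp: imT_def)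
  \<comment> \<open>Cross multiplication of two lifts of multiples of \<open>b\<close> gives an
    element of the kernel of the transpose of \<open>N\<close>, hence a multiple of
    \<open>f\<close>.\<close>
  have syz: "\<exists>e. \<forall>i<Suc s. \<beta> * x' i - \<alpha> * y' i - e * f i \<in> L"
    if xy: "\<And>j. j < s \<Longrightarrow> \<alpha> * b j - NT x' j \<in> L" "\<And>j. j < s \<Longrightarrow> \<beta> * b j - NT y' j \<in> L" for \<alpha> \<beta> x' y'
  proof -
    have "NT (\<lambda>i. \<beta> * x' i - \<alpha> * y' i) j \<in> L" if j: "j < s" for j
    proof -
      have "\<alpha> * (\<beta> * b j - NT y' j) - \<beta> * (\<alpha> * b j - NT x' j) \<in> L"
        by (rule rideal_diff[OF L rideal_mult_left[OF L xy(2)[OF j]] rideal_mult_left[OF L xy(1)[OF j]]])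
      then show ?thesis by (simp add: mv_diff mv_scale algebra_simps)
    qed
    from ker_NT[of "\<lambda>i. \<beta> * x' i - \<alpha> * y' i", OF this] show ?thesis by blast
  qed
  obtain c1 where c1: "\<And>i. i < Suc s \<Longrightarrow> q * x i - p * y i - c1 * f i \<in> L" using syz[OF x y] by blast
  obtain c2 where c2: "\<And>i. i < Suc s \<Longrightarrow> w * x i - p * z i - c2 * f i \<in> L" using syz[OF x z] by blast
  obtain c3 where c3: "\<And>i. i < Suc s \<Longrightarrow> w * y i - q * z i - c3 * f i \<in> L" using syz[OF y z] by blast
  \<comment> \<open>The three syzygies cancel as in the Koszul complex of \<open>p\<close>,
    \<open>q\<close>, \<open>w\<close>. Regularity of \<open>w\<close> then places \<open>c1\<close>
    in the ideal generated by \<open>L\<close>, \<open>p\<close> and \<open>q\<close>.\<close>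
  have "w * c1 - q * c2 + p * c3 \<in> L"
  proof (rule exact3)
    fix i assume i: "i < Suc s"
    have "q * (w * x i - p * z i - c2 * f i) - w * (q * x i - p * y i - c1 * f i) - p * (w * y i - q * z i - c3 * f i) \<in> L"
      by (intro rideal_diff[OF L] rideal_mult_left[OF L] c1[OF i] c2[OF i] c3[OF i])
    then show "f i * (w * c1 - q * c2 + p * c3) \<in> L" by (simp add: algebra_simps)
  qed
  then have "w * c1 - c2 * q \<in> adjoin L p" by (intro adjoinI[of _ "- c3"]) (simp add: algebra_simps)
  then have "w * c1 \<in> adjoin (adjoin L p) q" by (rule adjoinI)
  then have "c1 \<in> adjoin (adjoin L p) q" using rw by (simp add: regular_mod_def)
  then obtain d1 where "c1 - d1 * q \<in> adjoin L p" by (rule adjoinE)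
  then obtain d2 where d: "c1 - d1 * q - d2 * p \<in> L" by (rule adjoinE)
  \<comment> \<open>Changing \<open>x\<close> by a multiple of \<open>f\<close> does not alter its
    image, because \<open>NT f = 0\<close>, and makes \<open>x\<close> divisible by
    \<open>p\<close>.\<close>
  have "\<exists>e. x i - d1 * f i - e * p \<in> L" if i: "i < Suc s" for i
  proof -
    have "(q * x i - p * y i - c1 * f i) + f i * (c1 - d1 * q - d2 * p) \<in> L"
      by (intro rideal_add[OF L] rideal_mult_left[OF L] c1[OF i] d)
    then have "q * (x i - d1 * f i) - p * (y i + d2 * f i) \<in> L" by (simp add: algebra_simps)
    then show ?thesis by (metis cancel_qp)
  qed
  then obtain u where u: "\<And>i. i < Suc s \<Longrightarrow> x i - d1 * f i - u i * p \<in> L" by metis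
  have "b j - NT u j \<in> L" if j: "j < s" for j
  proof (rule cancel_p)
    have "NT (\<lambda>i. x i - d1 * f i - u i * p) j \<in> L" using u by (intro mv_mem L)
    moreover have "NT (\<lambda>i. x i - d1 * f i - u i * p) j = NT x j - p * NT u j"
      using NT_f[OF j] mv_scale[of "\<lambda>j i. N i j" "Suc s" p u j] by (simp add: mv_diff mv_scale mult.commute)
    ultimately have "(p * b j - NT x j) + (NT x j - p * NT u j) \<in> L"
      by (intro rideal_add[OF L] x[OF j]) simp
    then show "p * (b j - NT u j) \<in> L" by (simp add: algebra_simps)
  qed
  then show thesis using that by blast
qed

text \<open>The coordinates along \<open>g\<close> come from \<open>ker_g\<close>. Subtracting the
  combination of columns found there leaves a relation among the entries of \<open>f\<close> alone,
  which \<open>ker_f\<close> resolves.\<close>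

lemma exact1:
  assumes ab: "fd a + gd b \<in> L"
  obtains u v where "\<And>i. i < Suc s \<Longrightarrow> a i - (SV u i + NV v i) \<in> L" "\<And>j. j < s \<Longrightarrow> b j + NT u j \<in> L"
proof -
  obtain u where u: "\<And>j. j < s \<Longrightarrow> b j - NT u j \<in> L" by (rule ker_g[OF ab]) blast
  \<comment> \<open>The lower left block of the matrix is minus the transpose of \<open>N\<close>,
    hence the sign.\<close>
  define u' where "u' = (\<lambda>i. - u i)"
  have u': "b j + NT u' j \<in> L" if "j < s" for j using u[OF that] by (simp add: u'_def mv_uminus)
  have "gd (\<lambda>j. b j + NT u' j) \<in> L" using u' by (intro dotp_mem L)
  then have "(fd a + gd b) - gd (\<lambda>j. b j + NT u' j) \<in> L" by (rule rideal_diff[OF L ab])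
  then have "fd (\<lambda>i. a i - SV u' i) \<in> L" by (simp add: dotp_add dotp_diff fd_SV)
  then obtain v where "\<And>i. i < Suc s \<Longrightarrow> a i - SV u' i - NV v i \<in> L" by (rule ker_f) blast
  then show thesis using that[of u' v] u' by (simp add: algebra_simps)
qed

text \<open>With \<open>u = e * f\<close> from \<open>ker_NT\<close> and \<open>S f = - N g\<close>,
  what remains is \<open>N (v - e * g) = 0\<close> modulo \<open>L\<close>, and \<open>N\<close> is
  injective.\<close>

lemma exact2:
  assumes uv: "\<And>i. i < Suc s \<Longrightarrow> SV u i + NV v i \<in> L" "\<And>j. j < s \<Longrightarrow> NT u j \<in> L"
  obtains e where "\<And>i. i < Suc s \<Longrightarrow> u i - e * f i \<in> L" "\<And>j. j < s \<Longrightarrow> v j - e * g j \<in> L"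
proof -
  obtain e where e: "\<And>i. i < Suc s \<Longrightarrow> u i - e * f i \<in> L" by (rule ker_NT[OF uv(2)]) blast+
  have "v j - e * g j \<in> L" if j: "j < s" for j
  proof (rule NV_inj[of "\<lambda>j. v j - e * g j", OF _ j])
    fix i assume i: "i < Suc s"
    have "SV (\<lambda>i. u i - e * f i) i \<in> L" using e by (intro mv_mem L)
    then have "(SV u i + NV v i) - SV (\<lambda>i. u i - e * f i) i \<in> L" by (intro rideal_diff[OF L] uv(1)[OF i])
    then show "NV (\<lambda>j. v j - e * g j) i \<in> L" using SV_f[OF i] by (simp add: mv_diff mv_scale algebra_simps)
  qed
  then show thesis using that e by blast
qed

end

lemma (in pfaffian_data) I_mem: "fd a + gd b \<in> I"
  by (auto simp: I_def)

text \<open>A relation modulo \<open>(L, l)\<close> comes from the block matrix, whose columns are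
  relations in the ring itself. Hence its value is \<open>l\<close> times an element of
  \<open>I\<close> modulo \<open>L\<close>, and \<open>l\<close> can be cancelled.\<close>

lemma (in pfaffian_data) regular_mod_lift:
  assumes L: "rideal L" and l: "regular_mod L l" and ac: "pfaffian_acyclic s N S f g (adjoin L l) p q w"
  shows "regular_mod {x + y | x y. x \<in> L \<and> y \<in> I} l"
  unfolding regular_mod_def
proof (intro allI impI)
  interpret ac: pfaffian_acyclic s N S f g "adjoin L l" p q w by (rule ac)
  fix c assume "l * c \<in> {x + y | x y. x \<in> L \<and> y \<in> I}"
  then obtain x y where "l * c = x + y" "x \<in> L" "y \<in> I" by blast
  then obtain a b where x: "l * c = x + (fd a + gd b)" "x \<in> L" unfolding I_def by blast
  have "fd a + gd b \<in> adjoin L l"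
    using rideal_uminus[OF L x(2)] x(1) by (intro adjoinI[of _ c]) (simp add: algebra_simps)
  then obtain u v where uv: "\<And>i. i < Suc s \<Longrightarrow> a i - (SV u i + NV v i) \<in> adjoin L l"
    "\<And>j. j < s \<Longrightarrow> b j + NT u j \<in> adjoin L l" by (rule ac.exact1) blast
  have "\<exists>e. a i - (SV u i + NV v i) - e * l \<in> L" if "i < Suc s" for i using uv(1)[OF that] by (rule adjoinE) blast
  then obtain a' where a': "\<And>i. i < Suc s \<Longrightarrow> a i - (SV u i + NV v i) - a' i * l \<in> L" by metis
  have "\<exists>e. b j + NT u j - e * l \<in> L" if "j < s" for j using uv(2)[OF that] by (rule adjoinE) blast
  then obtain b' where b': "\<And>j. j < s \<Longrightarrow> b j + NT u j - b' j * l \<in> L" by metis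
  have A: "fd (\<lambda>i. a i - (SV u i + NV v i) - a' i * l) \<in> L" using a' by (intro dotp_mem L)
  have B: "gd (\<lambda>j. b j + NT u j - b' j * l) \<in> L" using b' by (intro dotp_mem L)
  have "fd (\<lambda>i. a i - (SV u i + NV v i) - a' i * l) + gd (\<lambda>j. b j + NT u j - b' j * l)
      = fd a + gd b - l * (fd a' + gd b')"
    using dotp_scale[of f "Suc s" l a'] dotp_scale[of g s l b']
    by (simp add: dotp_add dotp_diff fd_SV fd_NV algebra_simps)
  then have "fd a + gd b - l * (fd a' + gd b') \<in> L" using rideal_add[OF L A B] by simp
  then have "x + (fd a + gd b - l * (fd a' + gd b')) \<in> L" by (rule rideal_add[OF L x(2)])
  then have "l * (c - (fd a' + gd b')) \<in> L" using x(1) by (simp add: algebra_simps)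
  then have "c - (fd a' + gd b') \<in> L" using l by (simp add: regular_mod_def)
  then show "c \<in> {x + y | x y. x \<in> L \<and> y \<in> I}"
    using I_mem by (intro CollectI exI[of _ "c - (fd a' + gd b')"] exI[of _ "fd a' + gd b'"]) simp
qed

section \<open>Maximal minors\<close>

lemma cofactor_cong:
  assumes "dim_row A = dim_row B" "dim_col A = dim_col B"
    and "\<And>k l. k < dim_row A \<Longrightarrow> l < dim_col A \<Longrightarrow> k \<noteq> i \<Longrightarrow> l \<noteq> j \<Longrightarrow> A $$ (k, l) = B $$ (k, l)"
  shows "cofactor A i j = cofactor B i j"
proof -
  have "mat_delete A i j = mat_delete B i j"
    unfolding mat_delete_def using assms by (intro eq_matI) auto
  then show ?thesis by (simp add: cofactor_def)
qed

lemma det_diagonal_columns: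
  assumes "A \<in> carrier_mat (k + s) (k + s)"
    and "\<And>i j. i < k + s \<Longrightarrow> j < s \<Longrightarrow> A $$ (i, k + j) = (if i = k + j then p else 0)"
  shows "det A = p ^ s * det (mat k k (\<lambda>ij. A $$ ij))"
  using assms
proof (induction s arbitrary: A)
  case 0
  then have "mat k k (\<lambda>ij. A $$ ij) = A" by (intro eq_matI) auto
  then show ?case by simp
next
  case (Suc s)
  let ?B = "mat_delete A (k + s) (k + s)"
  have A: "A \<in> carrier_mat (Suc (k + s)) (Suc (k + s))" using Suc.prems(1) by simp
  have B: "?B \<in> carrier_mat (k + s) (k + s)" using mat_delete_carrier[OF A] by simp
  have Bij: "?B $$ (i, j) = A $$ (i, j)" if "i < k + s" "j < k + s" for i j
    using that A by (simp add: mat_delete_def)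
  have "det A = (\<Sum>i<Suc (k + s). A $$ (i, k + s) * cofactor A i (k + s))"
    using laplace_expansion_column[OF A, of "k + s"] by simp
  also have "\<dots> = (\<Sum>i<Suc (k + s). if i = k + s then p * cofactor A (k + s) (k + s) else 0)"
    using Suc.prems(2)[of _ s] by (intro sum.cong) auto
  also have "\<dots> = p * det ?B" by (simp add: cofactor_def)
  also have "det ?B = p ^ s * det (mat k k (\<lambda>ij. ?B $$ ij))"
    using Suc.prems(2) Bij by (intro Suc.IH[OF B]) auto
  also have "mat k k (\<lambda>ij. ?B $$ ij) = mat k k (\<lambda>ij. A $$ ij)" using Bij by (intro eq_matI) auto
  finally show ?case by simp
qed

lemma adj_mat_index:
  assumes A: "(A :: 'a::comm_ring_1 mat) \<in> carrier_mat n n" and i: "i < n" and k: "k < n"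
  shows "(\<Sum>j<n. A $$ (i, j) * adj_mat A $$ (j, k)) = (if i = k then det A else 0)"
    "(\<Sum>j<n. adj_mat A $$ (i, j) * A $$ (j, k)) = (if i = k then det A else 0)"
proof -
  note adj = adj_mat[OF A]
  have "(A * adj_mat A) $$ (i, k) = (\<Sum>j<n. A $$ (i, j) * adj_mat A $$ (j, k))"
    using A adj(1) i k by (simp add: scalar_prod_def atLeast0LessThan)
  from this[symmetric] show "(\<Sum>j<n. A $$ (i, j) * adj_mat A $$ (j, k)) = (if i = k then det A else 0)"
    using adj(2) i k by simp
  have "(adj_mat A * A) $$ (i, k) = (\<Sum>j<n. adj_mat A $$ (i, j) * A $$ (j, k))"
    using A adj(1) i k by (simp add: scalar_prod_def atLeast0LessThan)
  from this[symmetric] show "(\<Sum>j<n. adj_mat A $$ (i, j) * A $$ (j, k)) = (if i = k then det A else 0)"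
    using adj(3) i k by simp
qed

text \<open>Bordering a matrix with one more column makes the minors of the matrix the cofactors
  along that column.\<close>

definition border :: "nat \<Rightarrow> (nat \<Rightarrow> nat \<Rightarrow> 'a) \<Rightarrow> (nat \<Rightarrow> 'a) \<Rightarrow> 'a mat" where
  "border s N c = mat (Suc s) (Suc s) (\<lambda>(i, j). if j < s then N i j else c i)"

text \<open>The maximal minor of \<open>N\<close> without row \<open>k\<close>, with sign (-1)^(k +
  s). The cofactor deletes the bordering column, so \<open>cofactor_border\<close> can put any
  column in place of the zeros.\<close>

definition sminor :: "nat \<Rightarrow> (nat \<Rightarrow> nat \<Rightarrow> 'a::comm_ring_1) \<Rightarrow> nat \<Rightarrow> 'a" where
  "sminor s N k = cofactor (border s N (\<lambda>_. 0)) k s"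

lemma border_carrier [simp]: "border s N c \<in> carrier_mat (Suc s) (Suc s)"
  by (simp add: border_def)

lemma border_index: "i < Suc s \<Longrightarrow> j < Suc s \<Longrightarrow> border s N c $$ (i, j) = (if j < s then N i j else c i)"
  by (simp add: border_def)

lemma cofactor_border: "cofactor (border s N c) k s = sminor s N k"
  unfolding sminor_def by (rule cofactor_cong) (auto simp: border_def)

lemma det_border: "det (border s N c) = (\<Sum>i<Suc s. sminor s N i * c i)"
  using laplace_expansion_column[OF border_carrier, of s s N c]
  by (simp add: cofactor_border border_index mult.commute del: sum.lessThan_Suc)

lemma adj_border_last: "k < Suc s \<Longrightarrow> adj_mat (border s N c) $$ (s, k) = sminor s N k"
  by (simp add: adj_mat_def cofactor_border carrier_matD[OF border_carrier])

text \<open>The products of the bordered matrix with its adjugate, read blockwise; the last row of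
  the adjugate is the vector of signed minors.\<close>

lemma border_adj:
  fixes N :: "nat \<Rightarrow> nat \<Rightarrow> 'a::comm_ring_1" and c :: "nat \<Rightarrow> 'a" and s :: nat
  defines "W \<equiv> \<lambda>j k. adj_mat (border s N c) $$ (j, k)" and "p \<equiv> \<Sum>i<Suc s. sminor s N i * c i"
  shows "\<And>j k. j < s \<Longrightarrow> k < s \<Longrightarrow> (\<Sum>i<Suc s. W j i * N i k) = (if j = k then p else 0)"
    "\<And>i k. i < Suc s \<Longrightarrow> k < Suc s \<Longrightarrow> c i * sminor s N k + (\<Sum>j<s. N i j * W j k) = (if i = k then p else 0)"
    "\<And>k. k < s \<Longrightarrow> (\<Sum>i<Suc s. sminor s N i * N i k) = 0"
proof -
  let ?M = "border s N c"
  have M: "?M $$ (i, j) = (if j < s then N i j else c i)" if "i < Suc s" "j < Suc s" for i j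
    using that by (simp add: border_def)
  show "(\<Sum>i<Suc s. W j i * N i k) = (if j = k then p else 0)" if "j < s" "k < s" for j k
    using adj_mat_index(2)[OF border_carrier, of j s k N c] that M
    by (simp add: W_def p_def det_border del: sum.lessThan_Suc)
  show "c i * sminor s N k + (\<Sum>j<s. N i j * W j k) = (if i = k then p else 0)"
    if "i < Suc s" "k < Suc s" for i k
    using adj_mat_index(1)[OF border_carrier, of i s k N c] that M
    by (simp add: W_def p_def det_border adj_border_last add.commute)
  show "(\<Sum>i<Suc s. sminor s N i * N i k) = 0" if "k < s" for k
    using adj_mat_index(2)[OF border_carrier, of s s k N c] that M
    by (simp add: adj_border_last del: sum.lessThan_Suc)
qed

text \<open>\<open>N\<close> is the transpose of the smaller matrix, with s = t - r columns;
  \<open>U\<close> and \<open>B\<close> are the left blocks of the larger one, which is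
  \<open>A\<close> with t rows and t + 1 columns. The vector \<open>d\<close> below lists all signed
  maximal minors of \<open>A\<close>.\<close>

locale block_data =
  fixes s r :: nat and N U B :: "nat \<Rightarrow> nat \<Rightarrow> 'a::comm_ring_1"
  assumes r: "1 \<le> r"
begin

abbreviation "t \<equiv> s + r"

definition A :: "nat \<Rightarrow> nat \<Rightarrow> 'a" where
  "A i j = (if i \<le> s then if j \<le> r then U i j else N i (j - Suc r)
            else if j \<le> r then B (i - Suc s) j else 0)"

abbreviation f :: "nat \<Rightarrow> 'a" where "f \<equiv> sminor s N"
definition d :: "nat \<Rightarrow> 'a" where "d = sminor t (\<lambda>j i. A i j)"
definition g :: "nat \<Rightarrow> 'a" where "g j = d (Suc r + j)"

definition Q :: "(nat \<Rightarrow> 'a) \<Rightarrow> (nat \<Rightarrow> 'a) \<Rightarrow> 'a mat" where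
  "Q x y = mat (Suc r) (Suc r) (\<lambda>(i, j). if i = 0 then x j else if i < r then B (i - 1) j else y j)"

text \<open>The determinant of \<open>B\<close> bordered by two rows is alternating in these rows,
  which makes \<open>S\<close> skew. The sign is that of moving the first s rows below the other r +
  1 rows in \<open>d_expansion\<close>.\<close>

definition S :: "nat \<Rightarrow> nat \<Rightarrow> 'a" where
  "S k i = (-1) ^ (Suc r * s) * det (Q (U i) (U k))"

lemma Q_carrier: "Q x y \<in> carrier_mat (Suc r) (Suc r)"
  by (simp add: Q_def)

lemma det_Q_linear: "det (Q (\<lambda>j. \<Sum>i\<in>I. c i * x i j) y) = (\<Sum>i\<in>I. c i * det (Q (x i) y))"
proof -
  have cof: "cofactor (Q z y) 0 j = cofactor (Q (\<lambda>_. 0) y) 0 j" for z j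
    by (rule cofactor_cong) (auto simp: Q_def)
  have Qr: "Q z y $$ (0, j) = z j" if "j < Suc r" for z j using that by (simp add: Q_def)
  have exp: "det (Q z y) = (\<Sum>j<Suc r. z j * cofactor (Q (\<lambda>_. 0) y) 0 j)" for z
    unfolding laplace_expansion_row[OF Q_carrier zero_less_Suc, of z y] cof[of z]
    by (intro sum.cong) (auto simp: Qr)
  then have "det (Q (\<lambda>j. \<Sum>i\<in>I. c i * x i j) y)
      = (\<Sum>j<Suc r. \<Sum>i\<in>I. c i * (x i j * cofactor (Q (\<lambda>_. 0) y) 0 j))"
    by (simp only: sum_distrib_right mult.assoc)
  also have "\<dots> = (\<Sum>i\<in>I. c i * (\<Sum>j<Suc r. x i j * cofactor (Q (\<lambda>_. 0) y) 0 j))"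
    unfolding sum_distrib_left by (rule sum.swap)
  finally show ?thesis by (simp only: exp)
qed

lemma det_Q_skew: "det (Q x y) = - det (Q y x)"
proof -
  have "Q x y = swaprows 0 r (Q y x)"
    using r by (intro eq_matI) (auto simp: Q_def)
  then show ?thesis using det_swaprows[of 0 "Suc r" r "Q y x"] r Q_carrier by simp
qed

lemma S_skew: "S k i = - S i k"
  using det_Q_skew[of "U i" "U k"] by (simp add: S_def)

lemma d_row: "i < t \<Longrightarrow> (\<Sum>j<Suc t. A i j * d j) = 0"
  using border_adj(3)[where k = i and s = t and N = "\<lambda>j i. A i j"] by (simp add: d_def mult.commute del: sum.lessThan_Suc)

lemma sum_d_split:
  "(\<Sum>j<Suc t. z j * d j) = (\<Sum>j<Suc r. z j * d j) + (\<Sum>j<s. z (Suc r + j) * g j)"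
proof -
  have "{..<Suc t} = {..<Suc r} \<union> (+) (Suc r) ` {..<s}"
  proof (intro equalityI subsetI)
    fix x assume "x \<in> {..<Suc t}"
    then show "x \<in> {..<Suc r} \<union> (+) (Suc r) ` {..<s}"
      by (cases "x < Suc r") (auto intro!: image_eqI[of _ _ "x - Suc r"])
  qed auto
  then have "(\<Sum>j<Suc t. z j * d j) = (\<Sum>j<Suc r. z j * d j) + (\<Sum>j\<in>(+) (Suc r) ` {..<s}. z j * d j)"
    by (simp only:) (rule sum.union_disjoint, auto)
  also have "(\<Sum>j\<in>(+) (Suc r) ` {..<s}. z j * d j) = (\<Sum>j<s. z (Suc r + j) * g j)"
    by (subst sum.reindex) (auto simp: g_def)
  finally show ?thesis .
qed

text \<open>The determinant on the left is that of \<open>M_t\<close> with the row \<open>(y, 0)\<close> appended. Multiplying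
  the rows of \<open>(U | N)\<close> by the adjugate of \<open>(N | c)\<close> turns \<open>N\<close> into \<open>p\<close> times the
  identity, with a row \<open>(f U, 0)\<close> left over.\<close>

lemma d_expansion:
  assumes p: "p = (\<Sum>i<Suc s. f i * c i)" and reg: "\<And>x. p * x = 0 \<Longrightarrow> x = 0"
  shows "(\<Sum>j<Suc r. y j * d j) = (-1) ^ (Suc r * s) * (\<Sum>i<Suc s. f i * det (Q (U i) y))"
proof -
  let ?W = "adj_mat (border s N c)"
  let ?n = "Suc t"
  define E where "E = mat ?n ?n (\<lambda>(i, j). if i < t then A i j else if j \<le> r then y j else 0)"
  define P where "P = mat ?n ?n (\<lambda>(i, j). if i \<le> s \<and> j \<le> s then ?W $$ (i, j) else if i = j then 1 else 0)"
  define M where "M = mat ?n ?n (\<lambda>(i, j). if i \<le> s \<and> j \<le> s then border s N c $$ (i, j) else if i = j then 1 else 0)"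
  have car: "E \<in> carrier_mat ?n ?n" "P \<in> carrier_mat ?n ?n" "M \<in> carrier_mat ?n ?n"
    by (simp_all add: E_def P_def M_def)
  have detE: "det E = (\<Sum>j<Suc r. y j * d j)"
  proof -
    have "E = (border t (\<lambda>j i. A i j) (\<lambda>j. if j \<le> r then y j else 0))\<^sup>T"
      by (intro eq_matI) (auto simp: E_def border_def)
    then have "det E = (\<Sum>j<Suc t. (if j \<le> r then y j else 0) * d j)"
      using det_transpose[OF border_carrier] by (simp add: det_border d_def mult.commute del: sum.lessThan_Suc)
    also have "\<dots> = (\<Sum>j<Suc r. y j * d j)"
      unfolding sum_d_split by (simp del: sum.lessThan_Suc)
    finally show ?thesis .
  qed
  have blk: "(P * X) $$ (i, j) = (if i \<le> s then \<Sum>k<Suc s. ?W $$ (i, k) * X $$ (k, j) else X $$ (i, j))"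
    if X: "X \<in> carrier_mat ?n ?n" and ij: "i < ?n" "j < ?n" for X i j
  proof -
    have "(P * X) $$ (i, j) = (\<Sum>k<?n. P $$ (i, k) * X $$ (k, j))"
      using X car ij by (simp add: scalar_prod_def atLeast0LessThan del: sum.lessThan_Suc)
    also have "\<dots> = (if i \<le> s then \<Sum>k<Suc s. ?W $$ (i, k) * X $$ (k, j) else X $$ (i, j))"
    proof (cases "i \<le> s")
      case True
      have "(\<Sum>k<?n. P $$ (i, k) * X $$ (k, j)) = (\<Sum>k\<in>{..<Suc s}. P $$ (i, k) * X $$ (k, j))"
        using True ij by (intro sum.mono_neutral_right) (auto simp: P_def)
      also have "\<dots> = (\<Sum>k<Suc s. ?W $$ (i, k) * X $$ (k, j))"
        using True ij by (intro sum.cong) (auto simp: P_def)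
      finally show ?thesis using True by simp
    next
      case False
      have "(\<Sum>k<?n. P $$ (i, k) * X $$ (k, j)) = (\<Sum>k<?n. if k = i then X $$ (i, j) else 0)"
        using False ij by (intro sum.cong) (auto simp: P_def)
      then show ?thesis using False ij by (simp del: sum.lessThan_Suc)
    qed
    finally show ?thesis .
  qed
  have detM: "det M = p"
  proof -
    have "det M = 1 ^ (t - s) * det (mat (Suc s) (Suc s) (\<lambda>ij. M $$ ij))"
      by (rule det_diagonal_columns) (auto simp: M_def)
    also have "mat (Suc s) (Suc s) (\<lambda>ij. M $$ ij) = border s N c"
      by (intro eq_matI) (auto simp: M_def border_def)
    finally show ?thesis by (simp add: det_border p del: sum.lessThan_Suc)
  qed
  \<comment> \<open>\<open>det P\<close> enters only through its product with
    \<open>det M = p\<close>, so the determinant of an adjugate is never computed.\<close>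
  have detPM: "det (P * M) = p ^ Suc s"
  proof -
    have PM: "(P * M) $$ (i, j) = (if i = j then if i \<le> s then p else 1 else 0)" if ij: "i < ?n" "j < ?n" for i j
      unfolding blk[OF car(3) ij]
    proof (cases "i \<le> s \<and> j \<le> s")
      case True
      then have "(\<Sum>k<Suc s. ?W $$ (i, k) * M $$ (k, j)) = (\<Sum>k<Suc s. ?W $$ (i, k) * border s N c $$ (k, j))"
        using ij by (intro sum.cong) (auto simp: M_def)
      then show "(if i \<le> s then \<Sum>k<Suc s. ?W $$ (i, k) * M $$ (k, j) else M $$ (i, j)) = (if i = j then if i \<le> s then p else 1 else 0)"
        using True ij adj_mat_index(2)[OF border_carrier, of i s j N c]
        by (simp add: det_border p del: sum.lessThan_Suc)
    next
      case False
      then have "(\<Sum>k<Suc s. ?W $$ (i, k) * M $$ (k, j)) = 0" if "i \<le> s"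
        using ij that by (intro sum.neutral) (auto simp: M_def)
      then show "(if i \<le> s then \<Sum>k<Suc s. ?W $$ (i, k) * M $$ (k, j) else M $$ (i, j)) = (if i = j then if i \<le> s then p else 1 else 0)"
        using False ij by (auto simp: M_def simp del: sum.lessThan_Suc)
    qed
    have "P * M \<in> carrier_mat ?n ?n" using car by simp
    then have "det (P * M) = 1 ^ (t - s) * det (mat (Suc s) (Suc s) (\<lambda>ij. (P * M) $$ ij))"
      by (intro det_diagonal_columns) (auto simp: PM simp del: index_mult_mat)
    also have "mat (Suc s) (Suc s) (\<lambda>ij. (P * M) $$ ij) = p \<cdot>\<^sub>m 1\<^sub>m (Suc s)"
      by (intro eq_matI) (auto simp: PM simp del: index_mult_mat(1))
    finally show ?thesis by simp
  qed
  \<comment> \<open>The first s rows of \<open>F\<close> are (W U | p 1), row s is (f U | 0), and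
    below stand (B | 0) and (y | 0). Moving the first s rows to the bottom exposes \<open>Q\<close>
    in the upper left corner.\<close>
  define F where "F = P * E"
  have F: "F \<in> carrier_mat ?n ?n" using car by (simp add: F_def)
  have Fij: "F $$ (i, j) = (if i \<le> s then \<Sum>k<Suc s. ?W $$ (i, k) * A k j else if i < t then A i j else if j \<le> r then y j else 0)"
    if "i < ?n" "j < ?n" for i j
    unfolding F_def blk[OF car(1) that] using that r by (auto simp: E_def intro!: sum.cong)
  have "det F = (-1) ^ (Suc r * s) * (p ^ s * det (Q (\<lambda>j. \<Sum>i<Suc s. f i * U i j) y))"
  proof -
    have F': "F \<in> carrier_mat (Suc r + s) (Suc r + s)" using F by (simp add: add.commute)
    define G where "G = mat (Suc r + s) (Suc r + s) (\<lambda>(i, j). F $$ (if i < Suc r then i + s else i - Suc r, j))"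
    have "det F = (-1) ^ (Suc r * s) * det G" unfolding G_def by (rule det_swap_rows[OF F'])
    also have "det G = p ^ s * det (mat (Suc r) (Suc r) (\<lambda>ij. G $$ ij))"
    proof (rule det_diagonal_columns)
      fix i j assume ij: "i < Suc r + s" "j < s"
      have Acol: "A k (Suc (r + j)) = (if k \<le> s then N k j else 0)" for k by (simp add: A_def)
      show "G $$ (i, Suc r + j) = (if i = Suc r + j then p else 0)"
      proof (cases "i < Suc r")
        case True
        then have "G $$ (i, Suc r + j) = F $$ (i + s, Suc r + j)" using ij by (simp add: G_def)
        also have "\<dots> = 0"
        proof (cases "i = 0")
          case True
          then show ?thesis using ij border_adj(3)[where k = j and s = s and N = N]
            by (subst Fij) (auto simp: Acol adj_border_last simp del: sum.lessThan_Suc cong: sum.cong_simp)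
        next
          case False
          then show ?thesis using ij True by (subst Fij) (auto simp: Acol)
        qed
        finally show ?thesis using True by simp
      next
        case False
        then have "G $$ (i, Suc r + j) = F $$ (i - Suc r, Suc r + j)" using ij by (simp add: G_def)
        also have "\<dots> = (\<Sum>k<Suc s. ?W $$ (i - Suc r, k) * N k j)"
          using ij False by (subst Fij) (auto simp: Acol)
        also have "\<dots> = (if i - Suc r = j then p else 0)"
          using border_adj(1)[where j = "i - Suc r" and k = j and s = s and N = N and c = c] ij False by (simp add: p del: sum.lessThan_Suc)
        finally show ?thesis using False by auto
      qed
    qed (simp add: G_def)
    also have "mat (Suc r) (Suc r) (\<lambda>ij. G $$ ij) = Q (\<lambda>j. \<Sum>i<Suc s. f i * U i j) y"
    proof (rule eq_matI)
      fix i j assume "i < dim_row (Q (\<lambda>j. \<Sum>i<Suc s. f i * U i j) y)" "j < dim_col (Q (\<lambda>j. \<Sum>i<Suc s. f i * U i j) y)"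
      then have ij: "i < Suc r" "j < Suc r" by (auto simp: Q_def)
      have "F $$ (i + s, j) = (if i = 0 then \<Sum>i<Suc s. f i * U i j else if i < r then B (i - 1) j else y j)"
        using ij r by (subst Fij) (auto simp: A_def adj_border_last intro!: sum.cong)
      then show "mat (Suc r) (Suc r) (\<lambda>ij. G $$ ij) $$ (i, j) = Q (\<lambda>j. \<Sum>i<Suc s. f i * U i j) y $$ (i, j)"
        using ij by (simp add: G_def Q_def)
    qed (auto simp: Q_def)
    finally show ?thesis .
  qed
  moreover have "det F * p = p ^ Suc s * det E"
    using det_mult[OF car(2,1)] det_mult[OF car(2,3)] detPM detM by (simp add: F_def mult.commute mult.left_commute)
  ultimately have eq: "p ^ Suc s * det E = p ^ Suc s * ((-1) ^ (Suc r * s) * det (Q (\<lambda>j. \<Sum>i<Suc s. f i * U i j) y))"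
    by (simp add: ac_simps)
  \<comment> \<open>The identity is known only after multiplication by a power of \<open>p\<close>,
    which regularity of \<open>p\<close> removes.\<close>
  have cancel: "x = 0" if "p ^ k * x = 0" for k x
    using that by (induction k) (auto simp: mult.assoc dest: reg)
  have "p ^ Suc s * (det E - (-1) ^ (Suc r * s) * det (Q (\<lambda>j. \<Sum>i<Suc s. f i * U i j) y)) = 0"
    using eq by (simp add: right_diff_distrib)
  from cancel[OF this] show ?thesis using detE by (simp add: det_Q_linear del: sum.lessThan_Suc)
qed

text \<open>\<open>S f = - N g\<close> is the vanishing of the upper rows of \<open>A\<close>
  against its minors, with the part over \<open>U\<close> rewritten by \<open>d_expansion\<close>;
  skewness of \<open>S\<close> gives the transposed identity.\<close>

lemma pfaffian_data:
  assumes p: "p = (\<Sum>i<Suc s. f i * c i)" and reg: "\<And>x. p * x = 0 \<Longrightarrow> x = 0"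
  shows "pfaffian_data s N S f g"
proof
  fix j assume "j < s"
  then show "(\<Sum>i<Suc s. f i * N i j) = 0" by (rule border_adj(3))
next
  fix c
  show "\<exists>W. (\<forall>j<s. \<forall>k<s. (\<Sum>i<Suc s. W j i * N i k) = (if j = k then \<Sum>i<Suc s. f i * c i else 0)) \<and>
      (\<forall>i<Suc s. \<forall>k<Suc s. c i * f k + (\<Sum>j<s. N i j * W j k) = (if i = k then \<Sum>i<Suc s. f i * c i else 0))"
    using border_adj(1,2)[where s = s and N = N and c = c]
    by (intro exI[of _ "\<lambda>j k. adj_mat (border s N c) $$ (j, k)"]) blast
next
  have Sf: "(\<Sum>k<Suc s. S i k * f k) = - (\<Sum>j<s. N i j * g j)" if i: "i < Suc s" for i
  proof -
    have "(\<Sum>j<Suc t. A i j * d j) = 0" using d_row[of i] i r by simp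
    then have "(\<Sum>j<Suc r. A i j * d j) + (\<Sum>j<s. A i (Suc r + j) * g j) = 0" unfolding sum_d_split .
    moreover have "(\<Sum>j<Suc r. A i j * d j) = (\<Sum>j<Suc r. U i j * d j)"
      using i by (intro sum.cong) (auto simp: A_def)
    moreover have "(\<Sum>j<s. A i (Suc r + j) * g j) = (\<Sum>j<s. N i j * g j)" using i by (simp add: A_def)
    moreover have "(\<Sum>j<Suc r. U i j * d j) = (\<Sum>k<Suc s. S i k * f k)"
      using d_expansion[OF p reg, of "U i"] unfolding S_def
      by (simp add: sum_distrib_left ac_simps del: sum.lessThan_Suc)
    ultimately show ?thesis by (simp add: eq_neg_iff_add_eq_0)
  qed
  show "(\<Sum>k<Suc s. S i k * f k) = - (\<Sum>j<s. N i j * g j)" if "i < Suc s" for i by (rule Sf[OF that])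
  show "(\<Sum>i<Suc s. f i * S i k) = (\<Sum>j<s. N k j * g j)" if k: "k < Suc s" for k
  proof -
    have "(\<Sum>i<Suc s. f i * S i k) = - (\<Sum>i<Suc s. S k i * f i)"
      unfolding sum_negf[symmetric] by (intro sum.cong) (auto simp: S_skew[of _ k])
    then show ?thesis using Sf[OF k] by (simp del: sum.lessThan_Suc)
  qed
next
  fix j k assume jk: "j < s" "k < s"
  \<comment> \<open>Bordering the transpose of \<open>A\<close> by this unit vector gives
    determinant \<open>g k\<close>. The required \<open>u\<close> is column \<open>Suc r + j\<close>
    of the adjugate, of which the zero block of \<open>A\<close> leaves only the first s + 1 entries
    in the sum.\<close>
  let ?E = "\<lambda>i. if i = Suc r + k then (1::'a) else 0"
  let ?b = "border t (\<lambda>j i. A i j) ?E"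
  have "(\<Sum>i<Suc s. N i l * adj_mat ?b $$ (i, Suc r + j)) = (if l = j then g k else 0) - (if l = k then g j else 0)"
    if l: "l < s" for l
  proof -
    have "?E (Suc r + l) * d (Suc r + j) + (\<Sum>i<t. A i (Suc r + l) * adj_mat ?b $$ (i, Suc r + j))
        = (if Suc r + l = Suc r + j then \<Sum>i<Suc t. d i * ?E i else 0)"
      unfolding d_def using border_adj(2)[where i = "Suc r + l" and k = "Suc r + j" and s = t and N = "\<lambda>j i. A i j" and c = ?E] l jk by simp
    moreover have "(\<Sum>i<Suc t. d i * ?E i) = g k"
      using jk by (simp add: g_def if_distrib[of "\<lambda>x. _ * x"] cong: if_cong del: sum.lessThan_Suc)
    moreover have "(\<Sum>i<t. A i (Suc r + l) * adj_mat ?b $$ (i, Suc r + j)) = (\<Sum>i<Suc s. N i l * adj_mat ?b $$ (i, Suc r + j))"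
      using r by (intro sum.mono_neutral_cong_right) (auto simp: A_def)
    ultimately show ?thesis by (auto simp: g_def algebra_simps)
  qed
  then show "\<exists>u. \<forall>l<s. (\<Sum>i<Suc s. N i l * u i) = (if l = j then g k else 0) - (if l = k then g j else 0)"
    by (intro exI[of _ "\<lambda>i. adj_mat ?b $$ (i, Suc r + j)"]) blast
qed

end

section \<open>Ideals of maximal minors\<close>

lemma sminor_cong:
  "(\<And>i j. i < Suc m \<Longrightarrow> j < m \<Longrightarrow> N i j = N' i j) \<Longrightarrow> sminor m N k = sminor m N' k"
  unfolding sminor_def by (rule cofactor_cong) (auto simp: border_def)

text \<open>\<open>submatrix\<close> enumerates the remaining columns increasingly and
  \<open>mat_delete\<close> shifts indices past \<open>k\<close>; these are the same bijection. The
  transpose appears because \<open>sminor\<close> deletes rows.\<close>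

lemma maximal_minor_sminor:
  assumes A: "(A :: 'a::comm_ring_1 mat) \<in> carrier_mat m (Suc m)" and k: "k < Suc m"
  shows "det (submatrix A {..<m} ({..<Suc m} - {k})) = (-1) ^ (k + m) * sminor m (\<lambda>j i. A $$ (i, j)) k"
proof -
  let ?J = "{..<Suc m} - {k}"
  let ?D = "mat_delete (border m (\<lambda>j i. A $$ (i, j)) (\<lambda>_. 0)) k m"
  have pI: "pick {..<m} i = i" if "i < m" for i
  proof -
    have "{a \<in> {..<m}. a < i} = {..<i}" using that by auto
    then show ?thesis using pick_card_in_set[of i "{..<m}"] that by simp
  qed
  have pJ: "pick ?J j = insert_index k j" if "j < m" for j
  proof -
    have "{a \<in> ?J. a < insert_index k j} = insert_index k ` {..<j}"
    proof (intro equalityI subsetI)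
      fix a assume a: "a \<in> {a \<in> ?J. a < insert_index k j}"
      then show "a \<in> insert_index k ` {..<j}"
        by (intro image_eqI[of _ _ "delete_index k a"])
          (auto simp: insert_index_def delete_index_def split: if_splits)
    qed (use that k in \<open>auto simp: insert_index_def split: if_splits\<close>)
    moreover have "card (insert_index k ` {..<j}) = j"
      by (subst card_image) (auto simp: inj_on_def insert_index_def split: if_splits)
    moreover have "insert_index k j \<in> ?J" using that k by (auto simp: insert_index_def)
    ultimately show ?thesis using pick_card_in_set[of "insert_index k j" ?J] by simp
  qed
  have cI: "card {i. i < dim_row A \<and> i \<in> {..<m}} = m"
  proof -
    have "{i. i < dim_row A \<and> i \<in> {..<m}} = {..<m}" using A by auto
    then show ?thesis by simp
  qed
  have cJ: "card {j. j < dim_col A \<and> j \<in> ?J} = m"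
  proof -
    have "{j. j < dim_col A \<and> j \<in> ?J} = ?J" using A by auto
    then show ?thesis using k by simp
  qed
  have "submatrix A {..<m} ?J = ?D\<^sup>T"
  proof (rule eq_matI)
    fix i j assume "i < dim_row (?D\<^sup>T)" "j < dim_col (?D\<^sup>T)"
    then have ij: "i < m" "j < m" by (auto simp: border_def)
    have "submatrix A {..<m} ?J $$ (i, j) = A $$ (pick {..<m} i, pick ?J j)"
      by (rule submatrix_index; simp only: cI cJ ij)
    then show "submatrix A {..<m} ?J $$ (i, j) = ?D\<^sup>T $$ (i, j)"
      using ij k by (auto simp: pI pJ mat_delete_def border_def insert_index_def)
  qed (simp_all only: dim_submatrix cI cJ, simp_all add: border_def)
  moreover have "?D \<in> carrier_mat m m"
    using mat_delete_carrier[OF border_carrier[of m "\<lambda>j i. A $$ (i, j)" "\<lambda>_. 0"]] by simp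
  ultimately have "det (submatrix A {..<m} ?J) = det ?D" by (simp add: det_transpose)
  then show ?thesis
    by (simp add: sminor_def cofactor_def mult.assoc[symmetric] power_add[symmetric] mult_2[symmetric])
qed

lemma maximal_minors_eq:
  assumes A: "(A :: 'a::comm_ring_1 mat) \<in> carrier_mat m (Suc m)"
  shows "maximal_minors A = (\<lambda>k. (-1) ^ (k + m) * sminor m (\<lambda>j i. A $$ (i, j)) k) ` {..<Suc m}"
proof (intro equalityI subsetI)
  fix x assume "x \<in> maximal_minors A"
  then obtain I J where IJ: "x = det (submatrix A I J)" "I \<subseteq> {..<m}" "J \<subseteq> {..<Suc m}" "card I = m" "card J = m"
    using A by (auto simp: maximal_minors_def)
  have I: "I = {..<m}" using IJ card_subset_eq[of "{..<m}" I] by simp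
  have "card ({..<Suc m} - J) = 1" using IJ card_Diff_subset[of J "{..<Suc m}"] finite_subset[OF IJ(3)] by simp
  then obtain k where k: "{..<Suc m} - J = {k}" by (auto simp: card_1_singleton_iff)
  then have "J = {..<Suc m} - {k}" "k < Suc m" using IJ(3) by auto
  then show "x \<in> (\<lambda>k. (-1) ^ (k + m) * sminor m (\<lambda>j i. A $$ (i, j)) k) ` {..<Suc m}"
    using maximal_minor_sminor[OF A] IJ(1) I by auto
next
  fix x assume "x \<in> (\<lambda>k. (-1) ^ (k + m) * sminor m (\<lambda>j i. A $$ (i, j)) k) ` {..<Suc m}"
  then obtain k where k: "k < Suc m" "x = det (submatrix A {..<m} ({..<Suc m} - {k}))"
    using maximal_minor_sminor[OF A] by auto
  have "card ({..<Suc m} - {k}) = m" using k(1) by simp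
  then show "x \<in> maximal_minors A"
    unfolding maximal_minors_def using k A
    by (intro CollectI exI[of _ "{..<m}"] exI[of _ "{..<Suc m} - {k}"]) auto
qed

lemma Idl_maximal_minors:
  assumes A: "(A :: 'a::comm_ring_1 mat) \<in> carrier_mat m (Suc m)"
  shows "Idl\<^bsub>class_ring\<^esub> (maximal_minors A) = range (dotp (sminor m (\<lambda>j i. A $$ (i, j))) (Suc m))"
proof
  let ?f = "sminor m (\<lambda>j i. A $$ (i, j))"
  have R: "rideal (range (dotp ?f (Suc m)))"
    unfolding rideal_def
  proof (intro conjI ballI allI)
    show "0 \<in> range (dotp ?f (Suc m))" by (rule range_eqI[of _ _ "\<lambda>_. 0"]) (simp add: dotp_def)
  next
    fix a b assume "a \<in> range (dotp ?f (Suc m))" "b \<in> range (dotp ?f (Suc m))"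
    then obtain u v where "a = dotp ?f (Suc m) u" "b = dotp ?f (Suc m) v" by blast
    then have "a + b = dotp ?f (Suc m) (\<lambda>j. u j + v j)" by (simp add: dotp_add)
    then show "a + b \<in> range (dotp ?f (Suc m))" by simp
  next
    fix r a assume "a \<in> range (dotp ?f (Suc m))"
    then obtain u where "a = dotp ?f (Suc m) u" by blast
    then have "r * a = dotp ?f (Suc m) (\<lambda>j. r * u j)" by (simp add: dotp_scale)
    then show "r * a \<in> range (dotp ?f (Suc m))" by simp
  qed
  have "(-1) ^ (k + m) * ?f k = dotp ?f (Suc m) (\<lambda>j. if j = k then (-1) ^ (k + m) else 0)" if "k < Suc m" for k
    using that by (simp add: dotp_def if_distrib[of "\<lambda>x. _ * x"] mult.commute cong: if_cong)
  then have "maximal_minors A \<subseteq> range (dotp ?f (Suc m))"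
    unfolding maximal_minors_eq[OF A] by auto
  then show "Idl\<^bsub>class_ring\<^esub> (maximal_minors A) \<subseteq> range (dotp ?f (Suc m))" by (rule Idl_least[OF R])
  show "range (dotp ?f (Suc m)) \<subseteq> Idl\<^bsub>class_ring\<^esub> (maximal_minors A)"
  proof safe
    fix u
    have f: "?f k \<in> Idl\<^bsub>class_ring\<^esub> (maximal_minors A)" if "k < Suc m" for k
    proof -
      have "(-1) ^ (k + m) * ?f k \<in> Idl\<^bsub>class_ring\<^esub> (maximal_minors A)"
        using subset_Idl[of "maximal_minors A"] that unfolding maximal_minors_eq[OF A] by blast
      then have "(-1) ^ (k + m) * ((-1) ^ (k + m) * ?f k) \<in> Idl\<^bsub>class_ring\<^esub> (maximal_minors A)"
        by (rule rideal_mult_left[OF rideal_Idl])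
      then show ?thesis by (simp add: mult.assoc[symmetric] power_add[symmetric] mult_2[symmetric])
    qed
    show "dotp ?f (Suc m) u \<in> Idl\<^bsub>class_ring\<^esub> (maximal_minors A)"
      unfolding dotp_def by (rule rideal_sum[OF rideal_Idl], rule rideal_mult_right[OF rideal_Idl], rule f) simp
  qed
qed

lemma homogeneous_det:
  assumes "A \<in> carrier_mat m m" "\<And>i j. i < m \<Longrightarrow> j < m \<Longrightarrow> homogeneous 1 (A $$ (i, j))"
  shows "homogeneous m (det (A :: ('n::finite, 'k::field) mpoly mat))"
proof -
  have sg: "homogeneous 0 (signof p :: ('n, 'k) mpoly)" for p
    by (cases "evenperm p") (auto simp: sign_def homogeneous_uminus)
  have "homogeneous m (signof p * (\<Prod>i = 0..<m. A $$ (i, p i)))" if "p permutes {0..<m}" for p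
  proof -
    have "homogeneous (\<Sum>i = 0..<m. 1) (\<Prod>i = 0..<m. A $$ (i, p i))"
      using assms(2) permutes_in_image[OF that] by (intro homogeneous_prod) auto
    then show ?thesis using homogeneous_mult[OF sg, of m _ p] by simp
  qed
  then show ?thesis unfolding det_def'[OF assms(1)] by (intro homogeneous_sum) auto
qed

lemma homogeneous_sminor:
  assumes "\<And>i j. i < Suc m \<Longrightarrow> j < m \<Longrightarrow> homogeneous 1 (N i j :: ('n::finite, 'k::field) mpoly)" "k < Suc m"
  shows "homogeneous m (sminor m N k)"
proof -
  have "homogeneous m (det (mat_delete (border m N (\<lambda>_. 0)) k m))"
  proof (rule homogeneous_det)
    show "mat_delete (border m N (\<lambda>_. 0)) k m \<in> carrier_mat m m"
      using mat_delete_carrier[OF border_carrier[of m N "\<lambda>_. 0"]] by simp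
    show "homogeneous 1 (mat_delete (border m N (\<lambda>_. 0)) k m $$ (i, j))" if "i < m" "j < m" for i j
      using assms that by (auto simp: mat_delete_def border_def)
  qed
  moreover have "(-1) ^ (k + m) * x = x \<or> (-1) ^ (k + m) * x = - x" for x :: "('n, 'k) mpoly"
    by (cases "even (k + m)") auto
  ultimately show ?thesis unfolding sminor_def cofactor_def using homogeneous_uminus by metis
qed

section \<open>Prime chains over the sum of two ideals\<close>

lemma minimal_primes_alt: "P \<in> minimal_primes I \<longleftrightarrow>
    rprime P \<and> I \<subseteq> P \<and> (\<forall>Q. rprime Q \<and> I \<subseteq> Q \<and> Q \<subseteq> P \<longrightarrow> Q = P)"
  by (simp add: minimal_primes_def primeideal_class_ring_iff)

text \<open>Every prime above \<open>I\<close> contains a member of the finite list of primes, so a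
  smallest listed prime inside \<open>Q\<close> is minimal over \<open>I\<close>.\<close>

lemma minimal_prime_below:
  fixes I :: "('n::finite, 'k::field) mpoly set"
  assumes I: "rideal I" and Q: "rprime Q" "I \<subseteq> Q"
  obtains P where "P \<in> minimal_primes I" "P \<subseteq> Q"
proof -
  obtain Ps where Ps: "\<And>P. P \<in> set Ps \<Longrightarrow> rprime P \<and> I \<subseteq> P"
    and prod: "\<And>xs. length xs = length Ps \<Longrightarrow> (\<forall>i<length Ps. xs ! i \<in> Ps ! i) \<Longrightarrow> prod_list xs \<in> I"
    using primes_product_in_ideal[OF acc_mpoly I] by blast
  let ?F = "{P \<in> set Ps. P \<subseteq> Q}"
  have below: "\<exists>P\<in>set Ps. P \<subseteq> Q'" if "rprime Q'" "I \<subseteq> Q'" for Q'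
    using prime_contains_factor[OF that prod] by blast
  have "finite ?F" "?F \<noteq> {}" using below[OF Q] by auto
  then obtain P where P: "P \<in> ?F" "\<forall>P'\<in>?F. P' \<subseteq> P \<longrightarrow> P = P'" using finite_has_minimal by meson
  have "P \<in> minimal_primes I"
    unfolding minimal_primes_alt
  proof (intro conjI allI impI)
    show "rprime P" "I \<subseteq> P" using P(1) Ps by auto
    fix Q' assume Q': "rprime Q' \<and> I \<subseteq> Q' \<and> Q' \<subseteq> P"
    then obtain P' where "P' \<in> set Ps" "P' \<subseteq> Q'" using below by blast
    then show "Q' = P" using P Q' by blast
  qed
  then show thesis using that P(1) by blast
qed

lemma prime_chain_extend:
  assumes P: "rprime P" "I \<subseteq> P" "P \<subset> Q 0"
    and Q: "\<And>i. i \<le> k \<Longrightarrow> rprime (Q i)" "\<And>i. i < k \<Longrightarrow> Q i \<subset> Q (Suc i)"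
    and sub: "\<And>i. i \<le> k \<Longrightarrow> I \<subseteq> Q i"
  shows "prime_chain I (Suc k)"
  unfolding prime_chain_def
proof (intro exI[of _ "\<lambda>i. case i of 0 \<Rightarrow> P | Suc j \<Rightarrow> Q j"] conjI allI impI)
  fix i assume i: "i \<le> Suc k"
  show "rprime (case i of 0 \<Rightarrow> P | Suc j \<Rightarrow> Q j)"
    using P(1) Q(1)[of "i - 1"] i by (cases i) simp_all
  show "I \<subseteq> (case i of 0 \<Rightarrow> P | Suc j \<Rightarrow> Q j)"
    using P(2) sub[of "i - 1"] i by (cases i) simp_all
next
  fix i assume i: "i < Suc k"
  show "(case i of 0 \<Rightarrow> P | Suc j \<Rightarrow> Q j) \<subset> (case Suc i of 0 \<Rightarrow> P | Suc j \<Rightarrow> Q j)"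
  proof (cases i)
    case 0
    then show ?thesis using P(3) by (simp only: nat.case)
  next
    case (Suc j)
    have "j < k" using i Suc by (simp only: Suc_less_eq)
    from Q(2)[OF this] show ?thesis using Suc by (simp only: nat.case)
  qed
qed

text \<open>If the bottom of a chain of length \<open>m\<close> above the sum were not minimal over
  \<open>X\<close>, or over \<open>Z\<close>, a smaller prime would lengthen the chain beyond the
  bound. So the bottom would be a common component.\<close>

lemma prime_chain_set_add:
  fixes X Z :: "('n::finite, 'k::field) mpoly set"
  assumes XZ: "rideal X" "rideal Z" and nc: "no_common_component X Z"
    and dim: "\<not> prime_chain X (Suc m)" "\<not> prime_chain Z (Suc m)"
  shows "\<not> prime_chain {a + b | a b. a \<in> X \<and> b \<in> Z} m"
proof
  define T where "T = {a + b | a b. a \<in> X \<and> b \<in> Z}"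
  have XT: "X \<subseteq> T"
  proof
    fix x assume "x \<in> X"
    then show "x \<in> T" unfolding T_def using rideal_zero[OF XZ(2)] by (intro CollectI exI[of _ x] exI[of _ 0]) simp
  qed
  have ZT: "Z \<subseteq> T"
  proof
    fix x assume "x \<in> Z"
    then show "x \<in> T" unfolding T_def using rideal_zero[OF XZ(1)] by (intro CollectI exI[of _ 0] exI[of _ x]) simp
  qed
  assume "prime_chain {a + b | a b. a \<in> X \<and> b \<in> Z} m"
  then have "prime_chain T m" by (simp only: T_def)
  then obtain Q where Q: "\<And>i. i \<le> m \<Longrightarrow> rprime (Q i)" "\<And>i. i < m \<Longrightarrow> Q i \<subset> Q (Suc i)"
    and sub: "\<And>i. i \<le> m \<Longrightarrow> T \<subseteq> Q i"
    unfolding prime_chain_def by metis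
  have sub': "X \<subseteq> Q i" "Z \<subseteq> Q i" if "i \<le> m" for i using sub[OF that] XT ZT by auto
  have min: "Q 0 \<in> minimal_primes W" if W: "rideal W" "\<not> prime_chain W (Suc m)" "\<And>i. i \<le> m \<Longrightarrow> W \<subseteq> Q i" for W
  proof -
    obtain P where P: "P \<in> minimal_primes W" "P \<subseteq> Q 0"
      using minimal_prime_below[OF W(1) Q(1)[of 0] W(3)[of 0]] by auto
    have "P = Q 0"
    proof (rule ccontr)
      assume "P \<noteq> Q 0"
      then have "P \<subset> Q 0" using P(2) by blast
      then have "prime_chain W (Suc m)"
        using P(1) by (intro prime_chain_extend[where Q = Q, OF _ _ _ Q W(3)]) (auto simp: minimal_primes_alt)
      then show False using W(2) by simp
    qed
    then show ?thesis using P(1) by simp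
  qed
  have "Q 0 \<in> minimal_primes X \<inter> minimal_primes Z" using min XZ dim sub' by blast
  then show False using nc unfolding no_common_component_def by blast
qed

section \<open>A regular sequence in the two ideals\<close>

definition regular3 :: "'a::comm_ring_1 set \<Rightarrow> 'a \<Rightarrow> 'a \<Rightarrow> 'a \<Rightarrow> bool" where
  "regular3 L p q w \<longleftrightarrow> regular_mod L p \<and> regular_mod (adjoin L p) q \<and> regular_mod (adjoin (adjoin L p) q) w"

text \<open>\<open>regular_mod_swap\<close> moves \<open>l\<close> past \<open>p\<close>,
  \<open>q\<close> and \<open>w\<close> in turn. Homogeneity of \<open>p\<close> and
  \<open>q\<close> keeps the intermediate ideals homogeneous.\<close>

lemma regular3_descend:
  assumes L: "hideal L" and l: "l \<in> mmax" "regular_mod L l"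
    and pq: "homogeneous a p" "homogeneous b q" and r: "regular3 (adjoin L l) p q w"
  shows "regular3 L p q w"
proof -
  note R = hideal_rideal[OF L]
  have hp: "hideal (adjoin L p)" by (rule hideal_adjoin[OF L pq(1)])
  have hq: "hideal (adjoin (adjoin L p) q)" by (rule hideal_adjoin[OF hp pq(2)])
  have 1: "regular_mod L p" "regular_mod (adjoin L p) l"
    using regular_mod_swap[OF L l] r by (auto simp: regular3_def)
  have "adjoin (adjoin L l) p = adjoin (adjoin L p) l" by (rule adjoin_commute[OF R])
  then have 2: "regular_mod (adjoin L p) q" "regular_mod (adjoin (adjoin L p) q) l"
    using regular_mod_swap[OF hp l(1) 1(2)] r by (auto simp: regular3_def)
  have "adjoin (adjoin (adjoin L l) p) q = adjoin (adjoin (adjoin L p) q) l"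
    using adjoin_commute[OF R, of l p] adjoin_commute[OF hideal_rideal[OF hp], of l q] by simp
  then have 3: "regular_mod (adjoin (adjoin L p) q) w"
    using regular_mod_swap[OF hq l(1) 2(2)] r by (auto simp: regular3_def)
  show ?thesis using 1 2 3 by (simp add: regular3_def)
qed

lemma adjoins_decompose:
  assumes "rideal J" shows "adjoins J ls = {a + b | a b. a \<in> J \<and> b \<in> adjoins {0} ls}"
proof
  have Z: "rideal {0}" by (simp add: rideal_def)
  note LZ = rideal_adjoins[OF Z, of ls]
  have "J \<subseteq> {a + b | a b. a \<in> J \<and> b \<in> adjoins {0} ls}"
  proof
    fix x assume "x \<in> J"
    then show "x \<in> {a + b | a b. a \<in> J \<and> b \<in> adjoins {0} ls}"
      using rideal_zero[OF LZ] by (intro CollectI exI[of _ x] exI[of _ 0]) auto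
  qed
  moreover have "set ls \<subseteq> {a + b | a b. a \<in> J \<and> b \<in> adjoins {0} ls}"
  proof
    fix x assume "x \<in> set ls"
    then show "x \<in> {a + b | a b. a \<in> J \<and> b \<in> adjoins {0} ls}"
      using rideal_zero[OF assms] adjoins_mem[OF Z] by (intro CollectI exI[of _ 0] exI[of _ x]) auto
  qed
  ultimately show "adjoins J ls \<subseteq> {a + b | a b. a \<in> J \<and> b \<in> adjoins {0} ls}"
    by (rule adjoins_least[OF rideal_set_add[OF assms LZ]])
  have "adjoins {0} ls \<subseteq> adjoins J ls" by (rule adjoins_mono) (simp add: rideal_zero[OF assms])
  then show "{a + b | a b. a \<in> J \<and> b \<in> adjoins {0} ls} \<subseteq> adjoins J ls"
    using adjoins_superset[OF assms, of ls] by (auto intro!: rideal_add[OF rideal_adjoins[OF assms]])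
qed

text \<open>In dimension 0 all products of \<open>k\<close> elements of \<open>mmax\<close> lie in
  \<open>adjoins J ls\<close>, with \<open>k\<close> independent of \<open>x\<close>. The degree-k
  component of such a decomposition of \<open>x ^ k\<close> supplies a homogeneous
  \<open>p\<close>.\<close>

lemma power_mod_linear_forms:
  fixes J :: "('n::finite, 'k::field) mpoly set"
  assumes J: "hideal J" and ls: "\<And>l. l \<in> set ls \<Longrightarrow> homogeneous 1 l" and dim: "\<not> prime_chain (adjoins J ls) 1"
  shows "\<exists>k. \<forall>x. homogeneous 1 x \<longrightarrow> (\<exists>p\<in>J. homogeneous k p \<and> x ^ k - p \<in> adjoins {0} ls)"
proof -
  have hJ: "hideal (adjoins J ls)" by (rule hideal_adjoins[OF J ls])
  have hL: "hideal (adjoins {0} ls)" by (rule hideal_adjoins[OF hideal_zero ls])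
  obtain k where k: "\<And>xs. length xs = k \<Longrightarrow> set xs \<subseteq> mmax \<Longrightarrow> prod_list xs \<in> adjoins J ls"
    using mmax_products_in_ideal[OF hJ dim] by metis
  have "\<exists>p\<in>J. homogeneous k p \<and> x ^ k - p \<in> adjoins {0} ls" if x: "homogeneous 1 x" for x
  proof -
    have "prod_list (replicate k x) \<in> adjoins J ls"
      using homogeneous_in_mmax[OF x] by (intro k) auto
    then have "x ^ k \<in> adjoins J ls" by simp
    then obtain a b where ab: "x ^ k = a + b" "a \<in> J" "b \<in> adjoins {0} ls"
      unfolding adjoins_decompose[OF hideal_rideal[OF J]] by blast
    have "hcomp k (x ^ k) = x ^ k" using homogeneous_power[OF x, of k] by (simp add: hcomp_homogeneous)
    then have "x ^ k = hcomp k a + hcomp k b" using ab(1) hcomp_add by metis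
    then have "x ^ k - hcomp k a = hcomp k b" by simp
    then have "x ^ k - hcomp k a \<in> adjoins {0} ls" using hideal_hcomp[OF hL ab(3), of k] by simp
    then show ?thesis using hideal_hcomp[OF J ab(2)] homogeneous_hcomp by blast
  qed
  then show ?thesis by blast
qed

text \<open>The forms \<open>x\<close>, \<open>y\<close> after the first d + 1 have powers congruent
  to \<open>p\<close>, \<open>q\<close> in \<open>J\<close>, and a power of \<open>z\<close>, the
  form just before them, is congruent to \<open>w\<close> in \<open>I\<close>. Replacing regular
  elements by powers and congruent elements keeps regularity, first modulo \<open>L d\<close> and
  then, by descent, modulo all smaller \<open>L i\<close>.\<close>

lemma regular_triple_exists:
  fixes I J :: "('n::finite, 'k::field) mpoly set"
  assumes I: "hideal I" and J: "hideal J" and N: "CARD('n) = d + 3"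
    and ls: "length ls = d + 3" "\<And>l. l \<in> set ls \<Longrightarrow> homogeneous 1 l" "weakly_regular {0} ls"
    and dim: "\<not> prime_chain (adjoins I (take d ls)) 1" "\<not> prime_chain (adjoins J (take (Suc d) ls)) 1"
  obtains p q w where "p \<in> J" "q \<in> J" "w \<in> I"
    "\<And>i. i \<le> d \<Longrightarrow> regular3 (adjoins {0} (take i ls)) p q w"
proof -
  define L where "L i = adjoins {0} (take i ls)" for i
  have tk: "homogeneous 1 l" if "l \<in> set (take i ls)" for l i using ls(2) that by (meson in_set_takeD)
  have hL: "hideal (L i)" for i unfolding L_def by (rule hideal_adjoins[OF hideal_zero tk])
  have LS: "L (Suc i) = adjoin (L i) (ls ! i)" if "i < d + 3" for i
    using that ls(1) by (simp add: L_def take_Suc_conv_app_nth adjoins_snoc)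
  have hl: "homogeneous 1 (ls ! i)" if "i < d + 3" for i using that ls by simp
  have rl: "regular_mod (L i) (ls ! i)" if "i < d + 3" for i
    using that ls(1,3) by (simp add: weakly_regular_def L_def)
  define z x y where "z = ls ! d" and "x = ls ! Suc d" and "y = ls ! Suc (Suc d)"
  have hom: "homogeneous 1 z" "homogeneous 1 x" "homogeneous 1 y" using hl by (auto simp: z_def x_def y_def)
  obtain k where k: "\<And>x. homogeneous 1 x \<Longrightarrow> \<exists>p\<in>J. homogeneous k p \<and> x ^ k - p \<in> L (Suc d)"
    using power_mod_linear_forms[OF J tk[of _ "Suc d"] dim(2)] unfolding L_def by blast
  obtain m where m: "\<And>x. homogeneous 1 x \<Longrightarrow> \<exists>p\<in>I. homogeneous m p \<and> x ^ m - p \<in> L d"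
    using power_mod_linear_forms[OF I tk[of _ d] dim(1)] unfolding L_def by blast
  obtain p where p: "p \<in> J" "homogeneous k p" "x ^ k - p \<in> L (Suc d)" using k[OF hom(2)] by blast
  obtain q where q: "q \<in> J" "homogeneous k q" "y ^ k - q \<in> L (Suc d)" using k[OF hom(3)] by blast
  obtain w where w: "w \<in> I" "z ^ m - w \<in> L d" using m[OF hom(1)] by blast
  note R = hideal_rideal[OF hL]
  have LSd: "L (Suc d) = adjoin (L d) z" "L (Suc (Suc d)) = adjoin (L (Suc d)) x"
    using LS by (simp_all add: z_def x_def)
  have rz: "regular_mod (L d) z" and rx: "regular_mod (L (Suc d)) x" and ry: "regular_mod (adjoin (L (Suc d)) x) y"
    using rl[of d] rl[of "Suc d"] rl[of "Suc (Suc d)"] LSd by (simp_all add: z_def x_def y_def)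
  have rp: "regular_mod (adjoin (L d) z) p"
    using regular_mod_cong[OF R p(3) regular_mod_power[OF rx]] LSd by simp
  have "regular_mod (adjoin (L (Suc d)) (x ^ k)) (y ^ k)"
    by (rule regular_mod_power[OF regular_mod_adjoin_power[OF R rx ry]])
  then have "regular_mod (adjoin (L (Suc d)) p) (y ^ k)" using adjoin_cong[OF R p(3)] by simp
  then have rq: "regular_mod (adjoin (adjoin (L d) z) p) q"
    using regular_mod_cong[OF rideal_adjoin[OF R] subsetD[OF adjoin_superset q(3)]] LSd by simp
  have zm: "z \<in> mmax" using homogeneous_in_mmax[OF hom(1)] by simp
  \<comment> \<open>So far \<open>z\<close>, \<open>p\<close>, \<open>q\<close> is regular modulo
    \<open>L d\<close>. Once \<open>z\<close> has been moved to the end, \<open>w\<close> can take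
    its place.\<close>
  note 1 = regular_mod_swap[OF hL zm rz rp]
  have hp: "hideal (adjoin (L d) p)" by (rule hideal_adjoin[OF hL p(2)])
  have "adjoin (adjoin (L d) z) p = adjoin (adjoin (L d) p) z" by (rule adjoin_commute[OF R])
  then have rq': "regular_mod (adjoin (adjoin (L d) p) z) q" using rq by simp
  note 2 = regular_mod_swap[OF hp zm 1(2) rq']
  have "z ^ m - w \<in> adjoin (adjoin (L d) p) q" using w(2) adjoin_superset by blast
  then have 3: "regular_mod (adjoin (adjoin (L d) p) q) w"
    by (rule regular_mod_cong[OF rideal_adjoin[OF rideal_adjoin[OF R]] _ regular_mod_power[OF 2(2)]])
  have top: "regular3 (L d) p q w" using 1(1) 2(1) 3 by (simp add: regular3_def)
  have "regular3 (L (d - j)) p q w" if "j \<le> d" for j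
    using that
  proof (induction j)
    case 0 then show ?case using top by simp
  next
    case (Suc j)
    have e: "Suc (d - Suc j) = d - j" "d - Suc j < d + 3" using Suc.prems by auto
    then have "regular3 (adjoin (L (d - Suc j)) (ls ! (d - Suc j))) p q w"
      using Suc LS[of "d - Suc j"] by simp
    then show ?case
      using regular3_descend[OF hL _ rl[OF e(2)] p(2) q(2)] homogeneous_in_mmax[OF hl[OF e(2)]] by simp
  qed
  then have "regular3 (adjoins {0} (take i ls)) p q w" if "i \<le> d" for i
    using that unfolding L_def by (metis diff_diff_cancel diff_le_self)
  then show thesis using that p(1) q(1) w(1) by blast
qed

section \<open>Consequences of a regular sequence of linear forms\<close>

lemma adjoins_in_mmax:
  assumes "Y \<subseteq> mmax" "\<And>l. l \<in> set ls \<Longrightarrow> homogeneous 1 l"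
  shows "adjoins Y ls \<subseteq> (mmax :: ('n::finite, 'k::field) mpoly set)"
  using homogeneous_in_mmax[OF assms(2)] by (intro adjoins_least rideal_mmax assms(1)) auto

lemma mmax_ne_UNIV: "(mmax :: ('n::finite, 'k::field) mpoly set) \<noteq> UNIV"
  using rprime_mmax by (auto simp: rprime_def)

text \<open>A monomial of degree above the sum of the \<open>k i\<close> has some exponent at least
  \<open>k i\<close>. Hence all monomials of degree \<open>Suc K\<close> multiply \<open>p\<close>
  into \<open>Y\<close>, and so does a power of any linear form.\<close>

lemma mmax_products_of_Vars:
  fixes Y :: "('n::finite, 'k::field) mpoly set"
  assumes Y: "rideal Y" and p: "\<And>i. Var i ^ k i * p \<in> Y" and l: "homogeneous 1 l"
  shows "\<exists>m. l ^ m * p \<in> Y"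
proof -
  have R: "rideal (colon Y p)" by (rule rideal_colon[OF Y])
  have V: "Var i ^ k i \<in> colon Y p" for i using p by (simp add: colon_def mult.commute)
  define K where "K = (\<Sum>i\<in>UNIV. k i)"

  have mono: "Poly_Mapping.single m c \<in> colon Y p" if "mdeg m = Suc K" for m :: "'n \<Rightarrow>\<^sub>0 nat" and c :: 'k
  proof -
    have "\<exists>i. k i \<le> Poly_Mapping.lookup m i"
    proof (rule ccontr)
      assume "\<not> ?thesis"
      then have "Poly_Mapping.lookup m i \<le> k i" for i by (meson linear)
      then have "mdeg m \<le> K" unfolding mdeg_def K_def by (intro sum_mono)
      then show False using that by simp
    qed
    then obtain i where i: "k i \<le> Poly_Mapping.lookup m i" by blast
    have pw: "Var i ^ j = (Poly_Mapping.single (Poly_Mapping.single i j) 1 :: ('n, 'k) mpoly)" for j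
      by (induction j) (auto simp: Var_def mult_single single_add[symmetric])
    have "m = Poly_Mapping.single i (k i) + (m - Poly_Mapping.single i (k i))"
      using i by (intro poly_mapping_eqI) (auto simp: lookup_add lookup_minus lookup_single when_def)
    then have "Poly_Mapping.single m c = Var i ^ k i * Poly_Mapping.single (m - Poly_Mapping.single i (k i)) c"
      unfolding pw mult_single by simp
    then show ?thesis using rideal_mult_right[OF R V] by simp
  qed
  have "homogeneous (Suc K) (l ^ Suc K)" using homogeneous_power[OF l, of "Suc K"] by (simp only: mult_1_right)
  then have "Poly_Mapping.single m (Poly_Mapping.lookup (l ^ Suc K) m) \<in> colon Y p"
    if "m \<in> Poly_Mapping.keys (l ^ Suc K)" for m using that by (intro mono) (simp add: homogeneous_iff)
  then have "(\<Sum>m\<in>Poly_Mapping.keys (l ^ Suc K). Poly_Mapping.single m (Poly_Mapping.lookup (l ^ Suc K) m)) \<in> colon Y p"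
    by (rule rideal_sum[OF R])
  then have "l ^ Suc K \<in> colon Y p" using poly_mapping_sum_singles[of "l ^ Suc K"] by argo
  then have "l ^ Suc K * p \<in> Y" unfolding colon_def mem_Collect_eq by (simp only: mult.commute)
  then show ?thesis by blast
qed

lemma saturation_eq_if_regular:
  fixes Y :: "('n::finite, 'k::field) mpoly set"
  assumes Y: "rideal Y" and l: "homogeneous 1 l" "regular_mod Y l"
  shows "saturation Y = Y"
proof
  show "saturation Y \<subseteq> Y"
  proof
    fix p assume "p \<in> saturation Y"
    then have "\<exists>k. \<forall>i. Var i ^ k i * p \<in> Y" unfolding saturation_def by (simp add: choice_iff)
    then obtain m where "l ^ m * p \<in> Y" using mmax_products_of_Vars[OF Y _ l(1)] by blast
    then show "p \<in> Y" by (rule regular_modD[OF regular_mod_power[OF l(2)]])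
  qed
  show "Y \<subseteq> saturation Y"
    unfolding saturation_def using rideal_mult_left[OF Y] by blast
qed

text \<open>The prime ideals are produced as annihilators of elements modulo the members of the regular
  sequence, so each linear form of the sequence raises the dimension by one.\<close>

lemma prime_chain_above:
  fixes Y :: "('n::finite, 'k::field) mpoly set"
  assumes "hideal Y" "rprime P" "a \<notin> Y" "\<And>x. x \<in> P \<Longrightarrow> x * a \<in> Y" "weakly_regular Y ls"
    and "\<And>l. l \<in> set ls \<Longrightarrow> homogeneous 1 l"
  shows "\<exists>Q. Q 0 = P \<and> (\<forall>i\<le>length ls. rprime (Q i)) \<and> (\<forall>i<length ls. Q i \<subset> Q (Suc i))"
  using assms
proof (induction ls arbitrary: Y P a)
  case Nil
  then show ?case by (intro exI[of _ "\<lambda>_. P"]) simp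
next
  case (Cons l ls)
  note Y = Cons.prems(1) and P = Cons.prems(2) and a = Cons.prems(3,4)
  have R: "rideal Y" by (rule hideal_rideal[OF Y])
  have l: "homogeneous 1 l" "regular_mod Y l" "weakly_regular (adjoin Y l) ls"
    using Cons.prems(5,6) by (auto simp: weakly_regular_Cons)
  have lm: "l \<in> mmax" using homogeneous_in_mmax[OF l(1)] by simp
  have lP: "l \<notin> P" using a l(2) by (auto simp: regular_mod_def)
  \<comment> \<open>If everything that \<open>P\<close> annihilates modulo \<open>Y\<close> lay in
    \<open>adjoin Y l\<close>, then \<open>a\<close> could be divided by \<open>l\<close>
    indefinitely, against the graded intersection theorem.\<close>
  have "\<exists>x. (\<forall>y\<in>P. y * x \<in> Y) \<and> x \<notin> adjoin Y l"
  proof (rule ccontr)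
    assume "\<not> ?thesis"
    then have N: "x \<in> adjoin Y l" if "\<And>y. y \<in> P \<Longrightarrow> y * x \<in> Y" for x using that by blast
    have "\<exists>b. a - l ^ k * b \<in> Y \<and> (\<forall>y\<in>P. y * b \<in> Y)" for k
    proof (induction k)
      case 0
      then show ?case using a(2) R by (intro exI[of _ a]) (simp add: rideal_zero)
    next
      case (Suc k)
      then obtain b where b: "a - l ^ k * b \<in> Y" "\<And>y. y \<in> P \<Longrightarrow> y * b \<in> Y" by blast
      obtain c where c: "b - c * l \<in> Y" using N[OF b(2)] by (rule adjoinE)
      have "(a - l ^ k * b) + l ^ k * (b - c * l) \<in> Y" by (rule rideal_add[OF R b(1) rideal_mult_left[OF R c]])
      then have "a - l ^ Suc k * c \<in> Y" by (simp add: algebra_simps)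
      moreover have "y * c \<in> Y" if y: "y \<in> P" for y
      proof -
        have "y * b - y * (b - c * l) \<in> Y" by (rule rideal_diff[OF R b(2)[OF y] rideal_mult_left[OF R c]])
        then have "l * (y * c) \<in> Y" by (simp add: algebra_simps)
        then show ?thesis using l(2) by (simp add: regular_mod_def)
      qed
      ultimately show ?case by blast
    qed
    then have "\<exists>b. a - l ^ k * b \<in> Y" for k by blast
    then show False using hideal_mem_if_powers[OF Y lm] a(1) by blast
  qed
  then obtain x where x: "\<And>y. y \<in> P \<Longrightarrow> y * x \<in> Y" "x \<notin> adjoin Y l" by blast
  have Rl: "rideal (adjoin Y l)" by (rule rideal_adjoin[OF R])
  obtain y where y: "x * y \<notin> adjoin Y l" "rprime (colon (adjoin Y l) (x * y))"
    using prime_colon_exists[OF acc_mpoly Rl x(2)] by metis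
  let ?P = "colon (adjoin Y l) (x * y)"
  have "P \<subseteq> ?P"
  proof
    fix z assume "z \<in> P"
    then have "y * (z * x) \<in> Y" using x(1) R by (simp add: rideal_mult_left)
    then have "x * y * z \<in> Y" by (simp add: ac_simps)
    then show "z \<in> ?P" unfolding colon_def using adjoin_superset[of Y l] by blast
  qed
  moreover have "l \<in> ?P" unfolding colon_def using rideal_mult_left[OF Rl adjoin_self[OF R]] by simp
  ultimately have PP: "P \<subset> ?P" using lP by blast
  have "\<exists>Q. Q 0 = ?P \<and> (\<forall>i\<le>length ls. rprime (Q i)) \<and> (\<forall>i<length ls. Q i \<subset> Q (Suc i))"
  proof (rule Cons.IH[OF hideal_adjoin[OF Y l(1)] y(2) y(1) _ l(3)])
    show "z * (x * y) \<in> adjoin Y l" if "z \<in> ?P" for z using that by (simp add: colon_def mult.commute)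
    show "homogeneous 1 l'" if "l' \<in> set ls" for l' using Cons.prems(6) that by simp
  qed
  then obtain Q where Q: "Q 0 = ?P" "\<And>i. i \<le> length ls \<Longrightarrow> rprime (Q i)"
    "\<And>i. i < length ls \<Longrightarrow> Q i \<subset> Q (Suc i)" by blast
  show ?case
  proof (intro exI[of _ "\<lambda>i. case i of 0 \<Rightarrow> P | Suc j \<Rightarrow> Q j"] conjI allI impI)
    fix i assume i: "i \<le> length (l # ls)"
    show "rprime (case i of 0 \<Rightarrow> P | Suc j \<Rightarrow> Q j)"
      using P Q(2)[of "i - 1"] i by (cases i) simp_all
  next
    fix i assume i: "i < length (l # ls)"
    show "(case i of 0 \<Rightarrow> P | Suc j \<Rightarrow> Q j) \<subset> (case Suc i of 0 \<Rightarrow> P | Suc j \<Rightarrow> Q j)"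
    proof (cases i)
      case 0
      then show ?thesis using PP Q(1) by (simp only: nat.case)
    next
      case (Suc j)
      have "j < length ls" using i Suc by simp
      from Q(3)[OF this] show ?thesis using Suc by (simp only: nat.case)
    qed
  qed simp
qed

lemma prime_chain_if_above:
  assumes "Q 0 = P" "\<forall>i\<le>k. rprime (Q i)" "\<forall>i<k. Q i \<subset> Q (Suc i)"
  shows "prime_chain P k"
proof -
  have "P \<subseteq> Q i" if "i \<le> k" for i
    using that
  proof (induction i)
    case (Suc i)
    have "i < k" "i \<le> k" using Suc.prems by simp_all
    then show ?case using Suc.IH assms(3) by (meson psubset_imp_subset subset_trans)
  qed (simp add: assms(1))
  then show ?thesis unfolding prime_chain_def using assms(2,3) by blast
qed

text \<open>Unmixedness: a minimal prime annihilates some element modulo \<open>Y\<close>, so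
  \<open>prime_chain_above\<close> starts a chain of full length at each of them, and
  \<open>dim\<close> bounds all chains from above.\<close>

lemma krull_dim_if_regular:
  fixes Y :: "('n::finite, 'k::field) mpoly set"
  assumes Y: "hideal Y" "Y \<noteq> UNIV" and ls: "weakly_regular Y ls" "\<And>l. l \<in> set ls \<Longrightarrow> homogeneous 1 l"
    and len: "0 < length ls" and dim: "\<not> prime_chain Y (Suc (length ls))"
  shows "krull_dim (class_ring Quot Y) = enat (length ls)"
    "\<And>P. P \<in> minimal_primes Y \<Longrightarrow> krull_dim (class_ring Quot P) = enat (length ls)"
proof -
  note R = hideal_rideal[OF Y(1)]
  have chain: "prime_chain P (length ls)" if "rprime P" "a \<notin> Y" "\<And>x. x \<in> P \<Longrightarrow> x * a \<in> Y" for P a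
    using prime_chain_above[OF Y(1) that ls] prime_chain_if_above by metis
  have "1 \<notin> Y" using rideal_one_iff[OF R] Y(2) by simp
  then obtain y where y: "1 * y \<notin> Y" "rprime (colon Y (1 * y))" using prime_colon_exists[OF acc_mpoly R] by metis
  have "prime_chain (colon Y (1 * y)) (length ls)"
    by (rule chain[OF y(2,1)]) (simp add: colon_def mult.commute)
  then have "prime_chain Y (length ls)" by (rule prime_chain_mono[OF _ colon_superset[OF R]])
  then show "krull_dim (class_ring Quot Y) = enat (length ls)"
    using krull_dim_Quot_eq_iff[OF R len] dim by simp
  fix P assume P: "P \<in> minimal_primes Y"
  then have Pp: "rprime P" "Y \<subseteq> P" by (simp_all add: minimal_primes_alt)
  obtain a where a: "a \<notin> Y" "P = colon Y a"
    using minimal_prime_is_colon[OF acc_mpoly R Pp] P by (metis minimal_primes_alt)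
  have "prime_chain P (length ls)"
    by (rule chain[OF Pp(1) a(1)]) (simp add: a(2) colon_def mult.commute)
  moreover have "\<not> prime_chain P (Suc (length ls))" using dim prime_chain_mono[OF _ Pp(2)] by blast
  ultimately show "krull_dim (class_ring Quot P) = enat (length ls)"
    using krull_dim_Quot_eq_iff[OF rprime_rideal[OF Pp(1)] len] by simp
qed

section \<open>Hilbert functions from graded resolutions\<close>

abbreviation fscale :: "'k::field \<Rightarrow> (nat \<Rightarrow> ('n, 'k) mpoly) \<Rightarrow> nat \<Rightarrow> ('n, 'k) mpoly" where
  "fscale \<equiv> \<lambda>c v j. Poly_Mapping.single 0 c * v j"

interpretation mf: vector_space "fscale :: 'k::field \<Rightarrow> (nat \<Rightarrow> ('n, 'k) mpoly) \<Rightarrow> nat \<Rightarrow> ('n, 'k) mpoly"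
  by unfold_locales (simp_all add: fun_eq_iff algebra_simps mult_single single_add)

interpretation mpf: vector_space_pair
  "pscale :: 'k::field \<Rightarrow> ('n, 'k) mpoly \<Rightarrow> ('n, 'k) mpoly"
  "fscale :: 'k::field \<Rightarrow> (nat \<Rightarrow> ('n, 'k) mpoly) \<Rightarrow> nat \<Rightarrow> ('n, 'k) mpoly" ..

interpretation mfp: vector_space_pair
  "fscale :: 'k::field \<Rightarrow> (nat \<Rightarrow> ('n, 'k) mpoly) \<Rightarrow> nat \<Rightarrow> ('n, 'k) mpoly"
  "pscale :: 'k::field \<Rightarrow> ('n, 'k) mpoly \<Rightarrow> ('n, 'k) mpoly" ..

interpretation mff: vector_space_pair
  "fscale :: 'k::field \<Rightarrow> (nat \<Rightarrow> ('n, 'k) mpoly) \<Rightarrow> nat \<Rightarrow> ('n, 'k) mpoly" fscale ..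

text \<open>\<open>shifted i a\<close> is the component of degree \<open>i\<close> of \<open>R(-a)\<close>.\<close>

definition shifted :: "nat \<Rightarrow> nat \<Rightarrow> ('n::finite, 'k::field) mpoly set" where
  "shifted i a = (if a \<le> i then Rd (i - a) else {0})"

definition hshift :: "nat \<Rightarrow> nat \<Rightarrow> ('n::finite, 'k::field) mpoly \<Rightarrow> ('n, 'k) mpoly" where
  "hshift i a p = (if a \<le> i then hcomp (i - a) p else 0)"

definition dimR :: "'n::finite itself \<Rightarrow> nat \<Rightarrow> nat \<Rightarrow> nat" where
  "dimR _ i a = (if a \<le> i then (i - a + CARD('n) - 1) choose (i - a) else 0)"

lemma hshift_mem [simp]: "hshift i a p \<in> shifted i a"
  by (simp add: hshift_def shifted_def Rd_def)

lemma hshift_shifted: "p \<in> shifted i a \<Longrightarrow> hshift i a p = p"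
  by (auto simp: hshift_def shifted_def Rd_def hcomp_homogeneous split: if_splits)

lemma hshift_mult: "homogeneous k q \<Longrightarrow> hshift i a (q * p) = q * hshift i (a + k) p"
  by (auto simp: hshift_def hcomp_mult_homogeneous)

lemma hshift_sum: "hshift i a (sum f A) = (\<Sum>x\<in>A. hshift i a (f x))"
  by (simp add: hshift_def hcomp_sum)

lemma zero_shifted [simp]: "0 \<in> shifted i a"
  by (simp add: shifted_def Rd_def)

lemma subspace_shifted: "mp.subspace (shifted i a)"
  by (simp add: shifted_def subspace_Rd)

lemma finite_span_shifted: "\<exists>W. finite W \<and> (shifted i a :: ('n::finite, 'k::field) mpoly set) \<subseteq> mp.span W"
proof (cases "a \<le> i")
  case True
  then show ?thesis unfolding shifted_def using finite_monomials Rd_subset_span by auto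
next
  case False
  then show ?thesis unfolding shifted_def by (intro exI[of _ "{}"]) auto
qed

lemma dim_zero_subspace: "mp.dim ({0} :: ('n::finite, 'k::field) mpoly set) = 0"
  using mp.dim_le_card[of "{0}" "{}"] by simp

lemma dim_shifted: "mp.dim (shifted i a :: ('n::finite, 'k::field) mpoly set) = dimR TYPE('n) i a"
  by (simp add: shifted_def dimR_def dim_Rd dim_zero_subspace)

text \<open>Entries from \<open>m\<close> on are set to 0, so that tuples form a finite-dimensional
  space of functions.\<close>

definition tuples :: "nat \<Rightarrow> nat \<Rightarrow> (nat \<Rightarrow> nat) \<Rightarrow> (nat \<Rightarrow> ('n::finite, 'k::field) mpoly) set" where
  "tuples m i a = {v. (\<forall>j<m. v j \<in> shifted i (a j)) \<and> (\<forall>j\<ge>m. v j = 0)}"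

lemma subspace_tuples: "mf.subspace (tuples m i a)"
proof (rule mf.subspaceI)
  show "0 \<in> tuples m i a" by (simp add: tuples_def)
  show "x + y \<in> tuples m i a" if x: "x \<in> tuples m i a" and y: "y \<in> tuples m i a" for x y
    using x y by (simp add: tuples_def mp.subspace_add[OF subspace_shifted])
  show "fscale c x \<in> tuples m i a" if x: "x \<in> tuples m i a" for c x
  proof -
    have "Poly_Mapping.single 0 c * x j \<in> shifted i (a j)" if j: "j < m" for j
      using mp.subspace_scale[OF subspace_shifted, of "x j" i "a j" c] x j by (simp add: tuples_def)
    then show ?thesis using x by (simp add: tuples_def)
  qed
qed

definition unit_tuple :: "nat \<Rightarrow> ('n, 'k::field) mpoly \<Rightarrow> nat \<Rightarrow> ('n, 'k) mpoly" where
  "unit_tuple m p = (\<lambda>j. if j = m then p else 0)"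

lemma linear_unit_tuple: "Vector_Spaces.linear pscale fscale (unit_tuple m)"
  by unfold_locales (auto simp: unit_tuple_def fun_eq_iff)

lemma tuples_Suc:
  "tuples (Suc m) i a = {u + unit_tuple m p | u p. u \<in> tuples m i a \<and> p \<in> shifted i (a m)}"
proof (intro equalityI subsetI)
  fix v assume v: "v \<in> tuples (Suc m) i a"
  have "v = v(m := 0) + unit_tuple m (v m)" by (auto simp: unit_tuple_def fun_eq_iff)
  moreover have "v(m := 0) \<in> tuples m i a" "v m \<in> shifted i (a m)"
    using v by (auto simp: tuples_def)
  ultimately show "v \<in> {u + unit_tuple m p | u p. u \<in> tuples m i a \<and> p \<in> shifted i (a m)}" by blast
next
  fix v assume "v \<in> {u + unit_tuple m p | u p. u \<in> tuples m i a \<and> p \<in> shifted i (a m)}"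
  then obtain u p where "v = u + unit_tuple m p" "u \<in> tuples m i a" "p \<in> shifted i (a m)" by blast
  then show "v \<in> tuples (Suc m) i a" by (auto simp: tuples_def unit_tuple_def)
qed

lemma tuples_dim:
  "(\<exists>W. finite W \<and> (tuples m i a :: (nat \<Rightarrow> ('n::finite, 'k::field) mpoly) set) \<subseteq> mf.span W) \<and>
   mf.dim (tuples m i a :: (nat \<Rightarrow> ('n, 'k) mpoly) set) = (\<Sum>j<m. dimR TYPE('n) i (a j))"
proof (induction m)
  case 0
  have "tuples 0 i a = {0 :: nat \<Rightarrow> ('n, 'k) mpoly}" by (auto simp: tuples_def fun_eq_iff)
  moreover have "mf.dim {0 :: nat \<Rightarrow> ('n, 'k) mpoly} = 0" using mf.dim_le_card[of "{0}" "{}"] by simp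
  ultimately show ?case by (auto intro!: exI[of _ "{}"])
next
  case (Suc m)
  let ?U = "tuples m i a :: (nat \<Rightarrow> ('n, 'k) mpoly) set" and ?V = "shifted i (a m) :: ('n, 'k) mpoly set"
  obtain W where W: "finite W" "?U \<subseteq> mf.span W" using Suc by blast
  obtain W' where W': "finite W'" "?V \<subseteq> mp.span W'" using finite_span_shifted by blast
  have "{p \<in> ?V. unit_tuple m p \<in> ?U} = {0}" by (auto simp: tuples_def unit_tuple_def)
  then have "mf.dim (tuples (Suc m) i a :: (nat \<Rightarrow> ('n, 'k) mpoly) set) + 0 = mf.dim ?U + mp.dim ?V"
    using mpf.dim_add_image[OF linear_unit_tuple subspace_shifted subspace_tuples W' W, of m]
    unfolding tuples_Suc by (simp only: dim_zero_subspace)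
  moreover have "tuples (Suc m) i a \<subseteq> mf.span (W \<union> unit_tuple m ` W')"
  proof
    fix v :: "nat \<Rightarrow> ('n, 'k) mpoly" assume "v \<in> tuples (Suc m) i a"
    then obtain u p where v: "v = u + unit_tuple m p" "u \<in> ?U" "p \<in> ?V" unfolding tuples_Suc by blast
    have "unit_tuple m p \<in> mf.span (unit_tuple m ` W')"
      unfolding mpf.linear_span_image[OF linear_unit_tuple] using v(3) W'(2) by blast
    then show "v \<in> mf.span (W \<union> unit_tuple m ` W')"
      unfolding mf.span_Un v(1) using v(2) W(2) by blast
  qed
  ultimately show ?case
    using Suc W(1) W'(1) by (intro conjI exI[of _ "W \<union> unit_tuple m ` W'"]) (simp_all add: dim_shifted)
qed

text \<open>A self-dual resolution of length 3: the same vector \<open>F\<close> gives the first and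
  the last map, and the middle modules have twists \<open>a j\<close> and \<open>M - a j\<close>.
  The bound \<open>a i + a j <= M\<close> protects the subtraction of naturals.\<close>

locale graded_resolution =
  fixes m M :: nat and a :: "nat \<Rightarrow> nat" and F :: "nat \<Rightarrow> ('n::finite, 'k::field) mpoly"
    and \<Phi> :: "nat \<Rightarrow> nat \<Rightarrow> ('n, 'k) mpoly" and I :: "('n, 'k) mpoly set"
  assumes I: "I = range (dotp F m)"
    and F: "\<And>j. j < m \<Longrightarrow> homogeneous (a j) (F j)"
    and aM: "\<And>j. j < m \<Longrightarrow> a j \<le> M"
    and \<Phi>: "\<And>i j. i < m \<Longrightarrow> j < m \<Longrightarrow> \<Phi> i j = 0 \<or> (a i + a j \<le> M \<and> homogeneous (M - a j - a i) (\<Phi> i j))"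
    and c1: "\<And>w. dotp F m (mv \<Phi> m w) = 0"
    and c2: "\<And>i. i < m \<Longrightarrow> mv \<Phi> m F i = 0"
    and e1: "\<And>v. dotp F m v = 0 \<Longrightarrow> \<exists>w. \<forall>i<m. v i = mv \<Phi> m w i"
    and e2: "\<And>w. (\<And>i. i < m \<Longrightarrow> mv \<Phi> m w i = 0) \<Longrightarrow> \<exists>c. \<forall>i<m. w i = c * F i"
    and e3: "\<And>c. (\<And>i. i < m \<Longrightarrow> c * F i = 0) \<Longrightarrow> c = 0"
begin

lemma hshift_dotp: "hshift i 0 (dotp F m v) = dotp F m (\<lambda>j. hshift i (a j) (v j))"
  unfolding dotp_def hshift_sum by (intro sum.cong) (auto simp: hshift_mult[OF F])

lemma hshift_mv:
  assumes "k < m"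
  shows "hshift i (a k) (mv \<Phi> m w k) = mv \<Phi> m (\<lambda>j. hshift i (M - a j) (w j)) k"
  unfolding mv_def hshift_sum
proof (intro sum.cong refl)
  fix j assume "j \<in> {..<m}"
  then have j: "j < m" by simp
  show "hshift i (a k) (\<Phi> k j * w j) = \<Phi> k j * hshift i (M - a j) (w j)"
  proof (cases "\<Phi> k j = 0")
    case True
    then show ?thesis by (simp add: hshift_def)
  next
    case False
    then have h: "a k + a j \<le> M" "homogeneous (M - a j - a k) (\<Phi> k j)" using \<Phi>[OF assms j] by auto
    then have "a k + (M - a j - a k) = M - a j" by simp
    then show ?thesis using hshift_mult[OF h(2), of i "a k" "w j"] by simp
  qed
qed

lemma linear_dotp: "Vector_Spaces.linear fscale pscale (dotp F m)"
  by unfold_locales (simp_all add: dotp_def algebra_simps sum.distrib sum_distrib_left)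

definition trunc :: "(nat \<Rightarrow> ('n, 'k) mpoly) \<Rightarrow> nat \<Rightarrow> ('n, 'k) mpoly" where
  "trunc v = (\<lambda>j. if j < m then v j else 0)"

lemma linear_mv: "Vector_Spaces.linear fscale fscale (\<lambda>w. trunc (mv \<Phi> m w))"
  by unfold_locales (auto simp: trunc_def mv_def fun_eq_iff algebra_simps sum.distrib sum_distrib_left)

lemma linear_F: "Vector_Spaces.linear pscale fscale (\<lambda>c. trunc (\<lambda>j. c * F j))"
  by unfold_locales (auto simp: trunc_def fun_eq_iff algebra_simps)

lemma rank_nullity:
  "mp.dim (dotp F m ` tuples m i a) + mf.dim {v \<in> tuples m i a. dotp F m v = 0} = (\<Sum>j<m. dimR TYPE('n) i (a j))"
  "mf.dim ((\<lambda>w. trunc (mv \<Phi> m w)) ` tuples m i b) + mf.dim {w \<in> tuples m i b. trunc (mv \<Phi> m w) = 0}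
    = (\<Sum>j<m. dimR TYPE('n) i (b j))"
  "mf.dim ((\<lambda>c. trunc (\<lambda>j. c * F j)) ` shifted i e) + mp.dim {c \<in> shifted i e. trunc (\<lambda>j. c * F j) = 0}
    = dimR TYPE('n) i e"
proof -
  obtain W where W: "finite W" "(tuples m i a :: (nat \<Rightarrow> ('n, 'k) mpoly) set) \<subseteq> mf.span W" using tuples_dim by blast
  obtain W2 where W2: "finite W2" "(tuples m i b :: (nat \<Rightarrow> ('n, 'k) mpoly) set) \<subseteq> mf.span W2" using tuples_dim by blast
  obtain W3 where W3: "finite W3" "(shifted i e :: ('n, 'k) mpoly set) \<subseteq> mp.span W3" using finite_span_shifted by blast
  have f0: "mf.dim {0 :: nat \<Rightarrow> ('n, 'k) mpoly} = 0" using mf.dim_le_card[of "{0}" "{}"] by simp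

  have im: "{u + f v | u v. u \<in> {0} \<and> v \<in> V} = f ` V" for f :: "'x \<Rightarrow> ('n, 'k) mpoly" and V by auto
  have im_f: "{u + f v | u v. u \<in> {0} \<and> v \<in> V} = f ` V" for f :: "'x \<Rightarrow> nat \<Rightarrow> ('n, 'k) mpoly" and V by auto
  have sp: "{0 :: ('n, 'k) mpoly} \<subseteq> mp.span {}" "{0 :: nat \<Rightarrow> ('n, 'k) mpoly} \<subseteq> mf.span {}" by simp_all
  show "mp.dim (dotp F m ` tuples m i a) + mf.dim {v \<in> tuples m i a. dotp F m v = 0} = (\<Sum>j<m. dimR TYPE('n) i (a j))"
    using mfp.dim_add_image[OF linear_dotp subspace_tuples mp.subspace_single_0 W finite.emptyI sp(1)]
    unfolding im by (simp only: dim_zero_subspace tuples_dim singleton_iff add_0)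
  show "mf.dim ((\<lambda>w. trunc (mv \<Phi> m w)) ` tuples m i b) + mf.dim {w \<in> tuples m i b. trunc (mv \<Phi> m w) = 0}
    = (\<Sum>j<m. dimR TYPE('n) i (b j))"
    using mff.dim_add_image[OF linear_mv subspace_tuples mf.subspace_single_0 W2 finite.emptyI sp(2)]
    unfolding im_f by (simp only: f0 tuples_dim singleton_iff add_0)
  show "mf.dim ((\<lambda>c. trunc (\<lambda>j. c * F j)) ` shifted i e) + mp.dim {c \<in> shifted i e. trunc (\<lambda>j. c * F j) = 0}
    = dimR TYPE('n) i e"
    using mpf.dim_add_image[OF linear_F subspace_shifted mf.subspace_single_0 W3 finite.emptyI sp(2)]
    unfolding im_f by (simp only: f0 dim_shifted singleton_iff add_0)
qed

lemma image_dotp: "dotp F m ` tuples m i a = I \<inter> Rd i"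
proof (intro equalityI subsetI)
  fix p assume "p \<in> dotp F m ` tuples m i a"
  then obtain v where v: "p = dotp F m v" "v \<in> tuples m i a" by blast
  have "p = hshift i 0 p"
    unfolding v(1) hshift_dotp unfolding dotp_def using v(2) by (intro sum.cong) (auto simp: tuples_def hshift_shifted)
  then have "p \<in> Rd i" by (metis hshift_def hshift_mem le0 minus_nat.diff_0 shifted_def)
  then show "p \<in> I \<inter> Rd i" using v(1) I by blast
next
  fix p assume p: "p \<in> I \<inter> Rd i"
  then obtain v where v: "p = dotp F m v" using I by blast
  have "p = hshift i 0 p" using p hshift_shifted[of p i 0] by (simp add: shifted_def)
  also have "\<dots> = dotp F m (trunc (\<lambda>j. hshift i (a j) (v j)))"
    unfolding v hshift_dotp by (simp add: dotp_def trunc_def)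
  finally show "p \<in> dotp F m ` tuples m i a"
    by (intro image_eqI[where x = "trunc (\<lambda>j. hshift i (a j) (v j))"]) (simp_all add: tuples_def trunc_def)
qed

lemma kernel_dotp:
  "{v \<in> tuples m i a. dotp F m v = 0} = (\<lambda>w. trunc (mv \<Phi> m w)) ` tuples m i (\<lambda>j. M - a j)"
proof (intro equalityI subsetI)
  fix v assume "v \<in> {v \<in> tuples m i a. dotp F m v = 0}"
  then have v: "v \<in> tuples m i a" "dotp F m v = 0" by auto
  obtain w where w: "\<And>k. k < m \<Longrightarrow> v k = mv \<Phi> m w k" using e1[OF v(2)] by blast
  have "v = trunc (mv \<Phi> m (trunc (\<lambda>j. hshift i (M - a j) (w j))))"
  proof
    fix k
    show "v k = trunc (mv \<Phi> m (trunc (\<lambda>j. hshift i (M - a j) (w j)))) k"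
    proof (cases "k < m")
      case True
      have "v k = hshift i (a k) (v k)" using v(1) True by (simp add: tuples_def hshift_shifted)
      also have "\<dots> = mv \<Phi> m (\<lambda>j. hshift i (M - a j) (w j)) k" unfolding w[OF True] by (rule hshift_mv[OF True])
      finally show ?thesis using True by (simp add: trunc_def mv_def)
    next
      case False
      then show ?thesis using v(1) by (simp add: tuples_def trunc_def)
    qed
  qed
  then show "v \<in> (\<lambda>w. trunc (mv \<Phi> m w)) ` tuples m i (\<lambda>j. M - a j)"
    by (intro image_eqI[where x = "trunc (\<lambda>j. hshift i (M - a j) (w j))"]) (simp_all add: tuples_def trunc_def)
next
  fix v assume "v \<in> (\<lambda>w. trunc (mv \<Phi> m w)) ` tuples m i (\<lambda>j. M - a j)"
  then obtain w where w: "v = trunc (mv \<Phi> m w)" "w \<in> tuples m i (\<lambda>j. M - a j)" by blast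
  have "dotp F m v = dotp F m (mv \<Phi> m w)" by (simp add: w(1) dotp_def trunc_def)
  then have "dotp F m v = 0" by (simp add: c1)
  moreover have "v k \<in> shifted i (a k)" if k: "k < m" for k
  proof -
    have "mv \<Phi> m w k = mv \<Phi> m (\<lambda>j. hshift i (M - a j) (w j)) k"
      unfolding mv_def using w(2) by (intro sum.cong) (auto simp: tuples_def hshift_shifted)
    then have "mv \<Phi> m w k = hshift i (a k) (mv \<Phi> m w k)" using hshift_mv[OF k] by metis
    then have "mv \<Phi> m w k \<in> shifted i (a k)" by (metis hshift_mem)
    then show ?thesis using k by (simp add: w(1) trunc_def)
  qed
  ultimately show "v \<in> {v \<in> tuples m i a. dotp F m v = 0}" by (simp add: tuples_def w(1) trunc_def)
qed

lemma kernel_mv: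
  "{w \<in> tuples m i (\<lambda>j. M - a j). trunc (mv \<Phi> m w) = 0} = (\<lambda>c. trunc (\<lambda>j. c * F j)) ` shifted i M"
proof (intro equalityI subsetI)
  fix w assume "w \<in> {w \<in> tuples m i (\<lambda>j. M - a j). trunc (mv \<Phi> m w) = 0}"
  then have w: "w \<in> tuples m i (\<lambda>j. M - a j)" "trunc (mv \<Phi> m w) = 0" by auto
  have "mv \<Phi> m w k = 0" if "k < m" for k using fun_cong[OF w(2), of k] that by (simp add: trunc_def)
  then obtain c where c: "\<And>k. k < m \<Longrightarrow> w k = c * F k" using e2 by blast
  have "w = trunc (\<lambda>j. hshift i M c * F j)"
  proof
    fix k
    show "w k = trunc (\<lambda>j. hshift i M c * F j) k"
    proof (cases "k < m")
      case True
      have "w k = hshift i (M - a k) (w k)" using w(1) True by (simp add: tuples_def hshift_shifted)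
      also have "\<dots> = hshift i (M - a k) (F k * c)" by (simp add: c[OF True] mult.commute)
      also have "\<dots> = F k * hshift i (M - a k + a k) c" by (rule hshift_mult[OF F[OF True]])
      finally show ?thesis using True aM[OF True] by (simp add: trunc_def mult.commute)
    next
      case False
      then show ?thesis using w(1) by (simp add: tuples_def trunc_def)
    qed
  qed
  then show "w \<in> (\<lambda>c. trunc (\<lambda>j. c * F j)) ` shifted i M" by (rule image_eqI) simp
next
  fix w assume "w \<in> (\<lambda>c. trunc (\<lambda>j. c * F j)) ` shifted i M"
  then obtain c where c: "w = trunc (\<lambda>j. c * F j)" "c \<in> shifted i M" by blast
  have "mv \<Phi> m w k = 0" if k: "k < m" for k
  proof -
    have "mv \<Phi> m w k = mv \<Phi> m (\<lambda>j. c * F j) k" by (simp add: c(1) mv_def trunc_def)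
    then show ?thesis using c2[OF k] by (simp add: mv_scale)
  qed
  then have "trunc (mv \<Phi> m w) = 0" by (auto simp: trunc_def fun_eq_iff)
  moreover have "w k \<in> shifted i (M - a k)" if k: "k < m" for k
  proof -
    have "F k * hshift i (M - a k + a k) c = hshift i (M - a k) (F k * c)" by (rule hshift_mult[OF F[OF k], symmetric])
    then have "F k * c = hshift i (M - a k) (F k * c)" using aM[OF k] c(2) by (simp add: hshift_shifted)
    then have "F k * c \<in> shifted i (M - a k)" by (metis hshift_mem)
    then show ?thesis using k by (simp add: c(1) trunc_def mult.commute)
  qed
  ultimately show "w \<in> {w \<in> tuples m i (\<lambda>j. M - a j). trunc (mv \<Phi> m w) = 0}"
    by (simp add: tuples_def c(1) trunc_def)
qed

lemma kernel_F: "{c \<in> shifted i M. trunc (\<lambda>j. c * F j) = 0} = {0}"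
proof (intro equalityI subsetI)
  fix c assume "c \<in> {c \<in> shifted i M. trunc (\<lambda>j. c * F j) = 0}"
  then have c: "trunc (\<lambda>j. c * F j) = 0" by simp
  have "c * F k = 0" if "k < m" for k using fun_cong[OF c, of k] that by (simp add: trunc_def)
  then show "c \<in> {0}" using e3 by blast
qed (auto simp: trunc_def fun_eq_iff)

text \<open>The alternating sum of dimensions in degree \<open>i\<close>, obtained by rank-nullity
  at each map, with the negative terms moved to the other side.\<close>

lemma hilbert_function_resolution:
  "hilbert_function I i + (\<Sum>j<m. dimR TYPE('n) i (a j)) + dimR TYPE('n) i M
    = dimR TYPE('n) i 0 + (\<Sum>j<m. dimR TYPE('n) i (M - a j))"
  using rank_nullity(1)[of i] rank_nullity(2)[of i "\<lambda>j. M - a j"] rank_nullity(3)[of i M]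
    hilbert_function_add[of I i] dim_Rd[of i, where 'n = 'n and 'k = 'k]
  unfolding image_dotp kernel_dotp kernel_mv kernel_F dim_zero_subspace by (simp add: dimR_def)

end

section \<open>Iterated partial sums\<close>

text \<open>Multiplication of the generating function by 1/(1 - z). Adjoining a linear form that is
  regular modulo the ideal undoes one such step for the Hilbert function.\<close>

definition psum :: "(nat \<Rightarrow> nat) \<Rightarrow> nat \<Rightarrow> nat" where
  "psum f i = (\<Sum>j\<le>i. f j)"

lemma psum_inject: "psum f = psum g \<Longrightarrow> f = g"
proof
  fix i assume eq: "psum f = psum g"
  show "f i = g i"
  proof (cases i)
    case 0
    then show ?thesis using fun_cong[OF eq, of 0] by (simp add: psum_def)
  next
    case (Suc k)
    then show ?thesis using fun_cong[OF eq, of k] fun_cong[OF eq, of "Suc k"] by (simp add: psum_def)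
  qed
qed

lemma psum_pow_inject: "(psum ^^ d) f = (psum ^^ d) g \<Longrightarrow> f = g"
  by (induction d) (auto dest: psum_inject)

lemma psum_pow_add: "(psum ^^ d) (\<lambda>i. f i + g i) = (\<lambda>i. (psum ^^ d) f i + (psum ^^ d) g i)"
  by (induction d) (simp_all add: psum_def sum.distrib fun_eq_iff)

lemma psum_pow_mult: "(psum ^^ d) (\<lambda>i. c * f i) = (\<lambda>i. c * (psum ^^ d) f i)"
  by (induction d) (simp_all add: psum_def sum_distrib_left fun_eq_iff)

text \<open>The binomials are the coefficients of (1 - z)^(-e-1).\<close>

lemma psum_pow_eq: "(psum ^^ Suc e) h i = (\<Sum>j\<le>i. h j * ((i - j + e) choose e))"
proof (induction e arbitrary: i)
  case 0
  then show ?case by (simp add: psum_def)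
next
  case (Suc e)
  have "psum (\<lambda>i. \<Sum>j\<le>i. h j * ((i - j + e) choose e)) i = (\<Sum>j\<le>i. h j * ((i - j + Suc e) choose Suc e))"
  proof (induction i)
    case 0
    then show ?case by (simp add: psum_def)
  next
    case (Suc i)
    have "(\<Sum>j\<le>i. h j * ((Suc i - j + Suc e) choose Suc e))
      = (\<Sum>j\<le>i. h j * ((Suc i - j + e) choose e) + h j * ((i - j + Suc e) choose Suc e))"
      by (intro sum.cong) (auto simp: Suc_diff_le algebra_simps)
    then show ?case using Suc by (simp add: psum_def sum.distrib)
  qed
  moreover have "(psum ^^ Suc e) h = (\<lambda>i. \<Sum>j\<le>i. h j * ((i - j + e) choose e))" using Suc by auto
  ultimately show ?case by simp
qed

lemma psum_pow_choose:
  "(psum ^^ d) (\<lambda>i. if a \<le> i then (i - a + e) choose e else 0)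
    = (\<lambda>i. if a \<le> i then (i - a + (d + e)) choose (d + e) else 0)"
proof (induction d)
  case (Suc d)
  let ?e = "d + e"
  have "psum (\<lambda>i. if a \<le> i then (i - a + ?e) choose ?e else 0) i
    = (if a \<le> i then (i - a + Suc ?e) choose Suc ?e else 0)" for i
  proof (induction i)
    case 0
    then show ?case by (simp add: psum_def)
  next
    case (Suc i)
    then show ?case by (cases "a \<le> i") (auto simp: psum_def Suc_diff_le le_Suc_eq)
  qed
  then show ?case using Suc by auto
qed (simp add: fun_eq_iff)

lemma hilbert_function_adjoins:
  assumes "hideal I" "\<And>l. l \<in> set ls \<Longrightarrow> homogeneous 1 l" "weakly_regular I ls"
  shows "(psum ^^ length ls) (hilbert_function (adjoins I ls)) = hilbert_function I"
  using assms
proof (induction ls arbitrary: I)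
  case (Cons l ls)
  have l: "homogeneous 1 l" "regular_mod I l" "weakly_regular (adjoin I l) ls"
    using Cons.prems by (auto simp: weakly_regular_Cons)
  have "(psum ^^ length ls) (hilbert_function (adjoins (adjoin I l) ls)) = hilbert_function (adjoin I l)"
    using Cons.prems l by (intro Cons.IH hideal_adjoin) auto
  moreover have "psum (hilbert_function (adjoin I l)) i = hilbert_function I i" for i
  proof (induction i)
    case 0
    then show ?case using hilbert_function_adjoin_0[OF Cons.prems(1) l(1)] by (simp add: psum_def)
  next
    case (Suc i)
    then show ?case using hilbert_function_adjoin_regular_iff[OF Cons.prems(1) l(1)] l(2) by (simp add: psum_def)
  qed
  ultimately show ?case by (auto simp: adjoins_Cons)
qed simp

section \<open>The h-vector\<close>

declare upt_Suc [simp del]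

definition hvec :: "nat \<Rightarrow> nat \<Rightarrow> nat list" where
  "hvec s r = map (\<lambda>k. k choose 2) [2..<s + 1] @ replicate (r + 1) ((s + 1) choose 2) @
     rev (map (\<lambda>k. k choose 2) [2..<s + 1])"

definition hfun :: "nat \<Rightarrow> nat \<Rightarrow> nat \<Rightarrow> nat" where
  "hfun s r i = (if i < length (hvec s r) then hvec s r ! i else 0)"

lemma two_choose_two: "2 * int (n choose 2) = int n * (int n - 1)"
proof (induction n)
  case (Suc n)
  have "Suc n choose 2 = (n choose 2) + n" by (simp add: numeral_2_eq_2)
  then show ?case using Suc by (simp add: algebra_simps)
qed simp

text \<open>The Hilbert function of a polynomial ring in three variables, shifted by
  \<open>a\<close>: what remains of \<open>dimR\<close> after cutting by \<open>d\<close>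
  forms.\<close>

definition tri :: "nat \<Rightarrow> nat \<Rightarrow> nat" where
  "tri a i = (if a \<le> i then (i - a + 2) choose 2 else 0)"

text \<open>The quadratic polynomial also vanishes at \<open>i = a - 1\<close>, so the formula holds
  one step early; the ranges in \<open>hfun_tri\<close> rely on this. Doubling avoids
  division.\<close>

lemma two_tri:
  "a \<le> i + 1 \<Longrightarrow> 2 * int (tri a i) = (int i - int a + 2) * (int i - int a + 1)"
  by (cases "a \<le> i") (auto simp: tri_def two_choose_two of_nat_diff algebra_simps le_Suc_eq)

lemma tri_zero: "i < a \<Longrightarrow> tri a i = 0"
  by (simp add: tri_def)

lemma length_hvec: "1 \<le> s \<Longrightarrow> length (hvec s r) = s + r + s - 1"
  by (auto simp: hvec_def)

lemma hfun_cases: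
  assumes "1 \<le> s"
  shows "i < s \<Longrightarrow> hfun s r i = (i + 2) choose 2"
    and "s \<le> i \<Longrightarrow> i < s + r \<Longrightarrow> hfun s r i = (s + 1) choose 2"
    and "s + r \<le> i \<Longrightarrow> i < s + r + s \<Longrightarrow> hfun s r i = (s + (s + r) - i) choose 2"
    and "s + r + s \<le> i \<Longrightarrow> hfun s r i = 0"
proof -
  show "i < s \<Longrightarrow> hfun s r i = (i + 2) choose 2"
    using assms by (cases "i = s - 1") (auto simp: hfun_def length_hvec hvec_def nth_append add.commute)
  show "s \<le> i \<Longrightarrow> i < s + r \<Longrightarrow> hfun s r i = (s + 1) choose 2"
    using assms by (auto simp: hfun_def length_hvec hvec_def nth_append)
  show "s + r + s \<le> i \<Longrightarrow> hfun s r i = 0"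
    using assms by (simp add: hfun_def length_hvec)
  assume i: "s + r \<le> i" "i < s + r + s"
  show "hfun s r i = (s + (s + r) - i) choose 2"
  proof (cases "i = s + r + s - 1")
    case True
    then have "s + (s + r) - i = 1" using assms by simp
    then show ?thesis using assms True by (simp add: hfun_def length_hvec)
  next
    case False
    then have i': "i - (s + r) < s - 1" using i by simp
    have "hvec s r ! i = rev (map (\<lambda>k. k choose 2) [2..<s + 1]) ! (i - (s + r))"
      using assms i by (auto simp: hvec_def nth_append simp del: rev_map)
    also have "\<dots> = (2 + (s - 1 - Suc (i - (s + r)))) choose 2"
      using i' by (subst rev_nth) auto
    also have "2 + (s - 1 - Suc (i - (s + r))) = s + (s + r) - i" using i i' by simp
    finally show ?thesis using i i' by (simp add: hfun_def length_hvec)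
  qed
qed

text \<open>The Euler characteristic of the resolution after reduction to three variables. On each
  of the four ranges all terms are polynomials in \<open>i\<close>, and the identity is an algebraic
  one.\<close>

lemma hfun_tri:
  assumes s: "1 \<le> s" and r: "1 \<le> r" and t: "t = s + r"
  shows "hfun s r i + (s + 1) * tri s i + s * tri t i + tri (t + s + 1) i
    = tri 0 i + (s + 1) * tri (t + 1) i + s * tri (s + 1) i"
proof -
  have "2 * int (hfun s r i) + (int s + 1) * (2 * int (tri s i)) + int s * (2 * int (tri t i)) + 2 * int (tri (t + s + 1) i)
    = 2 * int (tri 0 i) + (int s + 1) * (2 * int (tri (t + 1) i)) + int s * (2 * int (tri (s + 1) i))"
  proof -
    consider "i < s" | "s \<le> i" "i < t" | "t \<le> i" "i < t + s" | "t + s \<le> i" by linarith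
    then show ?thesis
    proof cases
      case 1
      then show ?thesis using r
        by (simp add: hfun_cases(1)[OF s] two_choose_two two_tri[of 0] tri_zero t algebra_simps)
    next
      case 2
      then show ?thesis using r
        by (simp add: hfun_cases(2)[OF s] two_choose_two two_tri tri_zero t algebra_simps)
    next
      case 3
      then have h: "2 * int (hfun s r i) = (int s + int t - int i) * (int s + int t - int i - 1)"
        by (simp add: hfun_cases(3)[OF s] two_choose_two t of_nat_diff)
      show ?thesis unfolding h using 3 r
        by (simp add: two_tri tri_zero t algebra_simps)
    next
      case 4
      then show ?thesis using r
        by (simp add: hfun_cases(4)[OF s] two_tri t algebra_simps)
    qed
  qed
  then have "int (2 * (hfun s r i + (s + 1) * tri s i + s * tri t i + tri (t + s + 1) i))
    = int (2 * (tri 0 i + (s + 1) * tri (t + 1) i + s * tri (s + 1) i))"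
    by (simp add: algebra_simps)
  then show ?thesis by (simp only: of_nat_eq_iff mult_cancel1) simp
qed

lemma dimR_tri:
  assumes "CARD('n::finite) = d + 3" shows "dimR TYPE('n) i a = (psum ^^ d) (tri a) i"
proof -
  have "(i - a + (d + 2)) choose (i - a) = (i - a + (d + 2)) choose (d + 2)"
    using binomial_symmetric[of "i - a" "i - a + (d + 2)"] by simp
  moreover have "i - a + CARD('n) - 1 = i - a + (d + 2)" using assms by simp
  ultimately show ?thesis unfolding tri_def[abs_def] psum_pow_choose dimR_def by (simp only:)
qed

lemma hilbert_function_hfun:
  assumes "CARD('n::finite) = d + 3" "1 \<le> s" "1 \<le> r" "t = s + r"
    and "\<And>i. H i + ((s + 1) * dimR TYPE('n) i s + s * dimR TYPE('n) i t) + dimR TYPE('n) i (t + s + 1)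
      = dimR TYPE('n) i 0 + ((s + 1) * dimR TYPE('n) i (t + 1) + s * dimR TYPE('n) i (s + 1))"
  shows "H = (psum ^^ d) (hfun s r)"
proof
  fix i
  have "(\<lambda>i. hfun s r i + (s + 1) * tri s i + s * tri t i + tri (t + s + 1) i)
    = (\<lambda>i. tri 0 i + (s + 1) * tri (t + 1) i + s * tri (s + 1) i)"
    using hfun_tri[OF assms(2-4)] by blast
  from fun_cong[OF arg_cong[OF this, of "psum ^^ d"], of i]
  show "H i = (psum ^^ d) (hfun s r) i"
    using assms(5)[of i] by (simp only: psum_pow_add psum_pow_mult dimR_tri[OF assms(1)])
qed

lemma sum_list_choose_two: "sum_list (map (\<lambda>k. k choose 2) [2..<s + 1]) = (s + 1) choose 3"
proof (induction s)
  case (Suc s)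
  show ?case
  proof (cases "s = 0")
    case False
    then have "[2..<Suc s + 1] = [2..<s + 1] @ [s + 1]" by (simp add: upt_Suc)
    then show ?thesis using Suc by (simp add: numeral_3_eq_3 numeral_2_eq_2)
  qed simp
qed simp

lemma sum_list_hvec:
  assumes "1 \<le> r"
  shows "sum_list (hvec s r) = 2 * ((s + 2) choose 3) + (r - 1) * ((s + 1) choose 2)"
proof -
  have "sum_list (hvec s r) = 2 * ((s + 1) choose 3) + (r + 1) * ((s + 1) choose 2)"
    using sum_list_choose_two[of s] by (simp add: hvec_def sum_list_replicate)
  moreover have "(s + 2) choose 3 = ((s + 1) choose 3) + ((s + 1) choose 2)"
    by (simp add: numeral_3_eq_3 numeral_2_eq_2)
  moreover have "r + 1 = (r - 1) + 2" using assms by simp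
  ultimately show ?thesis by (simp only: add_mult_distrib add_mult_distrib2)
qed

section \<open>The Hilbert polynomial\<close>

lemma hilbert_polynomial_eqI:
  assumes "\<forall>\<^sub>F i in sequentially. of_nat (hilbert_function X i) = poly P (of_nat i :: rat)"
  shows "hilbert_polynomial X = P"
  unfolding hilbert_polynomial_def
proof (rule the_equality)
  show "\<forall>\<^sub>F i in sequentially. of_nat (hilbert_function X i) = poly P (of_nat i :: rat)" by (rule assms)
  fix Q assume Q: "\<forall>\<^sub>F i in sequentially. of_nat (hilbert_function X i) = poly Q (of_nat i :: rat)"
  from assms Q have "\<forall>\<^sub>F i in sequentially. poly (Q - P) (of_nat i :: rat) = 0"
    by eventually_elim simp
  then obtain N where N: "\<And>i. N \<le> i \<Longrightarrow> poly (Q - P) (of_nat i :: rat) = 0"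
    by (auto simp: eventually_sequentially)
  have "infinite ((of_nat :: nat \<Rightarrow> rat) ` {N..})"
    by (simp add: finite_image_iff inj_on_def infinite_Ici)
  moreover have "(of_nat :: nat \<Rightarrow> rat) ` {N..} \<subseteq> {x. poly (Q - P) x = 0}" using N by auto
  ultimately have "Q - P = 0" using poly_roots_finite[of "Q - P"] finite_subset by blast
  then show "Q = P" by simp
qed

text \<open>The polynomial in \<open>i\<close> that agrees with the binomial coefficient of
  \<open>i - j + e\<close> over \<open>e\<close> for \<open>i >= j\<close>.\<close>

definition binomial_poly :: "nat \<Rightarrow> nat \<Rightarrow> rat poly" where
  "binomial_poly e j = Polynomial.smult (1 / fact e) (\<Prod>i = 0..<e. [:of_nat e - of_nat j - of_nat i, 1:])"

lemma poly_binomial_poly: "j \<le> i \<Longrightarrow> poly (binomial_poly e j) (of_nat i) = of_nat ((i - j + e) choose e)"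
  by (simp add: binomial_poly_def poly_prod binomial_gbinomial gbinomial_prod_rev of_nat_diff algebra_simps)

lemma degree_binomial_poly: "degree (binomial_poly e j) = e"
  by (simp add: binomial_poly_def degree_prod_eq_sum_degree)

lemma coeff_binomial_poly: "coeff (binomial_poly e j) e = 1 / fact e"
proof -
  have "coeff (\<Prod>i = 0..<e. [:of_nat e - of_nat j - of_nat i, 1:] :: rat poly) e = 1"
    using lead_coeff_prod[of "\<lambda>i. [:of_nat e - of_nat j - of_nat i, 1:] :: rat poly" "{0..<e}"]
    by (simp add: degree_prod_eq_sum_degree)
  then show ?thesis by (simp add: binomial_poly_def)
qed

text \<open>Every \<open>h j\<close> contributes that multiple of a polynomial of degree
  \<open>e\<close> with leading coefficient 1/e!; positivity of the sum ensures that the degree is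
  exactly \<open>e\<close>.\<close>

lemma lead_coeff_hilbert_polynomial:
  assumes H: "hilbert_function X = (psum ^^ Suc e) h" and h: "\<And>j. N \<le> j \<Longrightarrow> h j = 0"
    and pos: "0 < (\<Sum>j<N. h j)"
  shows "lead_coeff (hilbert_polynomial X) = of_nat (\<Sum>j<N. h j) / fact e"
proof -
  define P where "P = (\<Sum>j<N. Polynomial.smult (of_nat (h j)) (binomial_poly e j))"
  have "of_nat (hilbert_function X i) = poly P (of_nat i)" if i: "N \<le> i" for i
  proof -
    have "hilbert_function X i = (\<Sum>j\<le>i. h j * ((i - j + e) choose e))"
      unfolding H by (rule psum_pow_eq)
    also have "\<dots> = (\<Sum>j<N. h j * ((i - j + e) choose e))"
      using i h by (intro sum.mono_neutral_right) auto
    finally show ?thesis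
      using i by (simp add: P_def poly_sum poly_binomial_poly del: sum.lessThan_Suc)
  qed
  then have P: "hilbert_polynomial X = P"
    by (intro hilbert_polynomial_eqI eventually_sequentiallyI[of N])
  have c: "coeff P e = of_nat (\<Sum>j<N. h j) / fact e"
    by (simp add: P_def coeff_sum coeff_binomial_poly sum_divide_distrib)
  have "degree P \<le> e" unfolding P_def
    by (intro degree_sum_le) (auto simp: degree_binomial_poly intro: order.trans[OF degree_smult_le])
  moreover have "(of_nat (\<Sum>j<N. h j) :: rat) \<noteq> 0" using pos by (simp only: of_nat_eq_0_iff)
  then have "coeff P e \<noteq> 0" unfolding c by (metis divide_eq_0_iff fact_nonzero)
  ultimately have "degree P = e" by (simp add: le_degree order.antisym)
  then show ?thesis using c P by simp
qed

section \<open>The minimal free resolution\<close>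

context graded_resolution
begin

definition res_mod :: "nat \<Rightarrow> int list" where
  "res_mod k = (if k = 0 then [0] else if k = 1 then map (\<lambda>j. int (a j)) [0..<m]
     else if k = 2 then map (\<lambda>j. int M - int (a j)) [0..<m] else [int M])"

text \<open>The third map is the transpose of the first, as expected of a Gorenstein ideal of
  codimension 3.\<close>

definition res_map :: "nat \<Rightarrow> ('n, 'k) mpoly mat" where
  "res_map k = (if k = 1 then mat 1 m (\<lambda>(i, j). F j)
     else if k = 2 then mat m m (\<lambda>(i, j). \<Phi> i j) else mat m 1 (\<lambda>(i, j). F i))"

lemma res_mod_simps: "res_mod 0 = [0]" "res_mod (Suc 0) = map (\<lambda>j. int (a j)) [0..<m]"
  "res_mod 2 = map (\<lambda>j. int M - int (a j)) [0..<m]" "res_mod 3 = [int M]"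
  by (simp_all add: res_mod_def)

lemma res_map_simps: "res_map (Suc 0) = mat (Suc 0) m (\<lambda>(i, j). F j)"
  "res_map 2 = mat m m (\<lambda>(i, j). \<Phi> i j)" "res_map 3 = mat m (Suc 0) (\<lambda>(i, j). F i)"
  by (simp_all add: res_map_def)

lemma row_mult: "v \<in> carrier_vec m \<Longrightarrow> (mat (Suc 0) m (\<lambda>(i, j). F j) *\<^sub>v v) $ 0 = dotp F m (($) v)"
  by (simp add: scalar_prod_def dotp_def lessThan_atLeast0)

lemma square_mult: "v \<in> carrier_vec m \<Longrightarrow> i < m \<Longrightarrow> (mat m m (\<lambda>(i, j). \<Phi> i j) *\<^sub>v v) $ i = mv \<Phi> m (($) v) i"
  by (simp add: scalar_prod_def mv_def lessThan_atLeast0)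

lemma col_mult: "v \<in> carrier_vec (Suc 0) \<Longrightarrow> i < m \<Longrightarrow> (mat m (Suc 0) (\<lambda>(i, j). F i) *\<^sub>v v) $ i = v $ 0 * F i"
  by (simp add: scalar_prod_def mult.commute)

lemma mv_vec: "mv \<Phi> m (($) (vec m v)) = mv \<Phi> m v" and dotp_vec: "dotp F m (($) (vec m v)) = dotp F m v"
  by (auto simp: mv_def dotp_def)

lemma minimal_resolution:
  assumes \<Phi>_mem: "\<And>i j. i < m \<Longrightarrow> j < m \<Longrightarrow> \<Phi> i j \<in> mmax" and a: "\<And>j. j < m \<Longrightarrow> 0 < a j"
  shows "minimal_graded_free_resolution I 3 res_mod res_map"
proof -
  have "graded_map (res_mod (Suc 0)) (res_mod 0) (res_map (Suc 0))"
    using F by (auto simp: graded_map_def res_mod_simps res_map_simps)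
  moreover have "graded_map (res_mod 2) (res_mod (Suc 0)) (res_map 2)"
    unfolding graded_map_def
  proof (intro conjI allI impI)
    show "res_map 2 \<in> carrier_mat (length (res_mod (Suc 0))) (length (res_mod 2))"
      by (simp add: res_mod_simps res_map_simps)
    fix i j assume "i < length (res_mod (Suc 0))" "j < length (res_mod 2)"
    then have ij: "i < m" "j < m" by (simp_all add: res_mod_simps)
    show "res_map 2 $$ (i, j) = 0 \<or>
      (\<exists>d. int d = res_mod 2 ! j - res_mod (Suc 0) ! i \<and> homogeneous d (res_map 2 $$ (i, j)))"
    proof (cases "\<Phi> i j = 0")
      case False
      with \<Phi>[OF ij] have "a i + a j \<le> M" "homogeneous (M - a j - a i) (\<Phi> i j)" by auto
      then show ?thesis using ij
        by (intro disjI2 exI[of _ "M - a j - a i"]) (simp add: res_mod_simps res_map_simps)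
    qed (simp add: res_map_simps ij)
  qed
  moreover have "graded_map (res_mod 3) (res_mod 2) (res_map 3)"
    using F by (auto simp: graded_map_def res_mod_simps res_map_simps)
  moreover have "{(res_map (Suc 0) *\<^sub>v v) $ 0 | v. v \<in> carrier_vec (length (res_mod (Suc 0)))} = I"
  proof (intro equalityI subsetI)
    fix p assume "p \<in> {(res_map (Suc 0) *\<^sub>v v) $ 0 | v. v \<in> carrier_vec (length (res_mod (Suc 0)))}"
    then obtain v where "p = (res_map (Suc 0) *\<^sub>v v) $ 0" "v \<in> carrier_vec m" by (auto simp: res_mod_simps)
    then show "p \<in> I" unfolding I res_map_simps using row_mult[of v] by simp
  next
    fix p assume "p \<in> I"
    then obtain v where "p = dotp F m v" unfolding I by blast
    then have "p = (res_map (Suc 0) *\<^sub>v vec m v) $ 0" unfolding res_map_simps row_mult[OF vec_carrier] dotp_vec .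
    then show "p \<in> {(res_map (Suc 0) *\<^sub>v v) $ 0 | v. v \<in> carrier_vec (length (res_mod (Suc 0)))}"
      by (intro CollectI exI[of _ "vec m v"]) (simp add: res_mod_simps)
  qed
  moreover have "{v \<in> carrier_vec (length (res_mod (Suc 0))). res_map (Suc 0) *\<^sub>v v = 0\<^sub>v (length (res_mod 0))}
      = {res_map 2 *\<^sub>v w | w. w \<in> carrier_vec (length (res_mod 2))}"
  proof (intro equalityI subsetI)
    fix v assume "v \<in> {v \<in> carrier_vec (length (res_mod (Suc 0))). res_map (Suc 0) *\<^sub>v v = 0\<^sub>v (length (res_mod 0))}"
    then have v: "v \<in> carrier_vec m" "res_map (Suc 0) *\<^sub>v v = 0\<^sub>v (Suc 0)" by (simp_all add: res_mod_simps)
    then have "dotp F m (($) v) = 0" using row_mult[OF v(1)] by (simp add: res_map_simps)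
    then obtain w where w: "\<And>i. i < m \<Longrightarrow> v $ i = mv \<Phi> m w i" using e1 by blast
    have "v = res_map 2 *\<^sub>v vec m w"
      using v(1) by (intro eq_vecI) (simp_all add: res_map_simps square_mult w mv_vec del: index_mult_mat_vec)
    then show "v \<in> {res_map 2 *\<^sub>v w | w. w \<in> carrier_vec (length (res_mod 2))}"
      by (intro CollectI exI[of _ "vec m w"]) (simp add: res_mod_simps)
  next
    fix v assume "v \<in> {res_map 2 *\<^sub>v w | w. w \<in> carrier_vec (length (res_mod 2))}"
    then obtain w where w: "v = res_map 2 *\<^sub>v w" "w \<in> carrier_vec m" by (auto simp: res_mod_simps)
    have v: "v \<in> carrier_vec m" unfolding w(1) res_map_simps by (rule carrier_vecI) simp
    have "dotp F m (($) v) = dotp F m (mv \<Phi> m (($) w))"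
      unfolding dotp_def by (intro sum.cong) (simp_all add: w res_map_simps square_mult del: index_mult_mat_vec)
    then have "(mat (Suc 0) m (\<lambda>(i, j). F j) *\<^sub>v v) $ 0 = 0" using row_mult[OF v] c1 by simp
    then have "res_map (Suc 0) *\<^sub>v v = 0\<^sub>v (Suc 0)" by (intro eq_vecI) (simp_all add: res_map_simps del: index_mult_mat_vec)
    then show "v \<in> {v \<in> carrier_vec (length (res_mod (Suc 0))). res_map (Suc 0) *\<^sub>v v = 0\<^sub>v (length (res_mod 0))}"
      using v by (simp add: res_mod_simps)
  qed
  moreover have "{v \<in> carrier_vec (length (res_mod 2)). res_map 2 *\<^sub>v v = 0\<^sub>v (length (res_mod (Suc 0)))}
      = {res_map 3 *\<^sub>v w | w. w \<in> carrier_vec (length (res_mod 3))}"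
  proof (intro equalityI subsetI)
    fix v assume "v \<in> {v \<in> carrier_vec (length (res_mod 2)). res_map 2 *\<^sub>v v = 0\<^sub>v (length (res_mod (Suc 0)))}"
    then have v: "v \<in> carrier_vec m" "res_map 2 *\<^sub>v v = 0\<^sub>v m" by (simp_all add: res_mod_simps)
    have "mv \<Phi> m (($) v) i = 0" if i: "i < m" for i
      using square_mult[OF v(1) i] v(2) i by (simp add: res_map_simps del: index_mult_mat_vec)
    then obtain c where c: "\<And>i. i < m \<Longrightarrow> v $ i = c * F i" using e2 by blast
    have "v = res_map 3 *\<^sub>v vec (Suc 0) (\<lambda>_. c)"
      using v(1) by (intro eq_vecI) (simp_all add: res_map_simps col_mult c del: index_mult_mat_vec)
    then show "v \<in> {res_map 3 *\<^sub>v w | w. w \<in> carrier_vec (length (res_mod 3))}"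
      by (intro CollectI exI[of _ "vec (Suc 0) (\<lambda>_. c)"]) (simp add: res_mod_simps)
  next
    fix v assume "v \<in> {res_map 3 *\<^sub>v w | w. w \<in> carrier_vec (length (res_mod 3))}"
    then obtain w where w: "v = res_map 3 *\<^sub>v w" "w \<in> carrier_vec (Suc 0)" by (auto simp: res_mod_simps)
    have v: "v \<in> carrier_vec m" unfolding w(1) res_map_simps by (rule carrier_vecI) simp
    have "mv \<Phi> m (($) v) i = w $ 0 * mv \<Phi> m F i" for i
      unfolding mv_scale[symmetric] unfolding mv_def
      by (intro sum.cong) (simp_all add: w res_map_simps col_mult del: index_mult_mat_vec)
    then have "res_map 2 *\<^sub>v v = 0\<^sub>v m"
      by (intro eq_vecI) (simp_all add: res_map_simps square_mult[OF v] c2 del: index_mult_mat_vec)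
    then show "v \<in> {v \<in> carrier_vec (length (res_mod 2)). res_map 2 *\<^sub>v v = 0\<^sub>v (length (res_mod (Suc 0)))}"
      using v by (simp add: res_mod_simps)
  qed
  moreover have "v = 0\<^sub>v (Suc 0)" if v: "v \<in> carrier_vec (Suc 0)" "res_map 3 *\<^sub>v v = 0\<^sub>v m" for v
  proof -
    have "v $ 0 * F i = 0" if i: "i < m" for i
      using col_mult[OF v(1) i] v(2) i by (simp add: res_map_simps del: index_mult_mat_vec)
    then have "v $ 0 = 0" by (rule e3)
    then show ?thesis using v(1) by (intro eq_vecI) auto
  qed
  moreover have "elements_mat (res_map 2) \<subseteq> irrelevant_ideal"
    using \<Phi>_mem by (auto simp: res_map_simps irrelevant_ideal_eq elements_mat_def)
  moreover have "elements_mat (res_map 3) \<subseteq> irrelevant_ideal"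
    using homogeneous_in_mmax[OF F a] by (auto simp: res_map_simps irrelevant_ideal_eq elements_mat_def)
  moreover have "{1..3} = {1, 2, 3 :: nat}" "{1..<3} = {1, 2 :: nat}" "{2..3} = {2, 3 :: nat}" by auto
  ultimately show ?thesis unfolding minimal_graded_free_resolution_def
    by (simp add: res_mod_simps numeral_2_eq_2[symmetric])
qed

end

section \<open>The block matrix as the middle map of the resolution\<close>

definition append_fun :: "nat \<Rightarrow> (nat \<Rightarrow> 'a) \<Rightarrow> (nat \<Rightarrow> 'a) \<Rightarrow> nat \<Rightarrow> 'a" where
  "append_fun k f g j = (if j < k then f j else g (j - k))"

lemma append_fun_simps [simp]: "j < k \<Longrightarrow> append_fun k f g j = f j" "append_fun k f g (k + j) = g j"
  "append_fun (Suc i) f g (Suc (i + j)) = g j"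
  by (simp_all add: append_fun_def)

lemma sum_lessThan_add: "(\<Sum>j<k + l. h j) = (\<Sum>j<k. h j) + (\<Sum>j<l. h (k + j))" for h :: "nat \<Rightarrow> 'a::comm_monoid_add"
  by (induction l) (simp_all add: ac_simps)

definition pfaffian_map :: "nat \<Rightarrow> (nat \<Rightarrow> nat \<Rightarrow> 'a::comm_ring_1) \<Rightarrow> (nat \<Rightarrow> nat \<Rightarrow> 'a) \<Rightarrow> nat \<Rightarrow> nat \<Rightarrow> 'a" where
  "pfaffian_map s N S = append_fun (Suc s) (\<lambda>i. append_fun (Suc s) (S i) (N i))
     (\<lambda>k. append_fun (Suc s) (\<lambda>j. - N j k) (\<lambda>_. 0))"

lemma less_add_cases:
  assumes "i < k + (l::nat)" obtains "i < k" | j where "i = k + j" "j < l"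
  using assms by (metis add_diff_inverse_nat nat_add_left_cancel_less)

lemma dotp_append_fun: "dotp (append_fun k f g) (k + l) v = dotp f k v + dotp g l (\<lambda>j. v (k + j))"
  by (simp add: dotp_def sum_lessThan_add)

context pfaffian_data
begin

abbreviation "cat \<equiv> append_fun (Suc s)"

lemma mv_pfaffian_map:
  "i < Suc s \<Longrightarrow> mv (pfaffian_map s N S) (Suc s + s) v i = SV v i + NV (\<lambda>j. v (Suc s + j)) i"
  "mv (pfaffian_map s N S) (Suc s + s) v (Suc s + k) = - NT v k"
  unfolding mv_def sum_lessThan_add by (simp_all add: pfaffian_map_def sum_negf)

lemmas mv_pfaffian_map_Suc = mv_pfaffian_map[unfolded add_Suc]

lemma I_eq_range: "I = range (dotp (cat f g) (Suc s + s))"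
proof (intro equalityI subsetI)
  fix p assume "p \<in> I"
  then obtain u v where p: "p = fd u + gd v" by (auto simp: I_def)
  have "fd (cat u v) = fd u" by (simp add: dotp_def)
  then have "p = dotp (cat f g) (Suc s + s) (cat u v)" unfolding dotp_append_fun p by simp
  then show "p \<in> range (dotp (cat f g) (Suc s + s))" by blast
next
  fix p assume "p \<in> range (dotp (cat f g) (Suc s + s))"
  then obtain v where "p = dotp (cat f g) (Suc s + s) v" by blast
  then show "p \<in> I" unfolding dotp_append_fun using I_mem by simp
qed

end

text \<open>With t = s + r, the last twist M = s + t + 1 fits the blocks: M - 2 s = r + 1 is the
  degree of \<open>S\<close> and M - s - t = 1 that of \<open>N\<close>. The block for two
  generators from \<open>g\<close> is zero.\<close>

lemma graded_resolution_pfaffian: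
  fixes f g :: "nat \<Rightarrow> ('n::finite, 'k::field) mpoly"
  assumes ac: "pfaffian_acyclic s N S f g {0} p q w"
    and hom: "\<And>i. i < Suc s \<Longrightarrow> homogeneous s (f i)" "\<And>j. j < s \<Longrightarrow> homogeneous (s + r) (g j)"
      "\<And>i j. i < Suc s \<Longrightarrow> j < s \<Longrightarrow> homogeneous 1 (N i j)"
      "\<And>i j. i < Suc s \<Longrightarrow> j < Suc s \<Longrightarrow> homogeneous (r + 1) (S i j)"
  shows "graded_resolution (Suc s + s) (s + r + s + 1) (append_fun (Suc s) (\<lambda>_. s) (\<lambda>_. s + r))
    (append_fun (Suc s) f g) (pfaffian_map s N S) (pfaffian_data.I s f g)"
proof -
  interpret ac: pfaffian_acyclic s N S f g "{0}" p q w by (rule ac)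
  let ?m = "Suc s + s" and ?M = "s + r + s + 1" and ?a = "append_fun (Suc s) (\<lambda>_. s) (\<lambda>_. s + r)"
  let ?F = "append_fun (Suc s) f g" and ?\<Phi> = "pfaffian_map s N S"
  show ?thesis
  proof
    show "ac.I = range (dotp ?F ?m)" by (rule ac.I_eq_range)
    show "homogeneous (?a j) (?F j)" if j: "j < ?m" for j
      using j hom(1,2) by (cases rule: less_add_cases) auto
    show "?a j \<le> ?M" if j: "j < ?m" for j by (simp add: append_fun_def)
    show "?\<Phi> i j = 0 \<or> (?a i + ?a j \<le> ?M \<and> homogeneous (?M - ?a j - ?a i) (?\<Phi> i j))"
      if i: "i < ?m" and j: "j < ?m" for i j
    proof (rule less_add_cases[case_product less_add_cases, OF i j])
      assume "i < Suc s" "j < Suc s"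
      then show ?thesis using hom(4)[of i j] by (simp add: pfaffian_map_def)
    next
      fix j' assume "i < Suc s" "j = Suc s + j'" "j' < s"
      then show ?thesis using hom(3)[of i j'] by (simp add: pfaffian_map_def)
    next
      fix i' assume "i = Suc s + i'" "i' < s" "j < Suc s"
      then show ?thesis using hom(3)[of j i'] by (simp add: pfaffian_map_def homogeneous_uminus)
    next
      fix i' j' assume "i = Suc s + i'" "j = Suc s + j'"
      then show ?thesis by (simp add: pfaffian_map_def)
    qed
    show "dotp ?F ?m (mv ?\<Phi> ?m w) = 0" for w
    proof -
      have "dotp ?F ?m (mv ?\<Phi> ?m w) = ac.fd (\<lambda>i. ac.SV w i + ac.NV (\<lambda>j. w (Suc s + j)) i) + ac.gd (\<lambda>k. - ac.NT w k)"
        unfolding dotp_append_fun ac.mv_pfaffian_map(2) by (simp add: dotp_def ac.mv_pfaffian_map_Suc(1))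
      then show ?thesis by (simp add: dotp_add dotp_uminus ac.fd_SV ac.fd_NV)
    qed
    show "mv ?\<Phi> ?m ?F i = 0" if i: "i < ?m" for i
      using i
    proof (cases rule: less_add_cases)
      case 1
      have "ac.SV ?F i = ac.SV f i" "ac.NV (\<lambda>j. ?F (Suc s + j)) i = ac.NV g i"
        unfolding mv_def by (intro sum.cong; simp)+
      then show ?thesis using 1 by (simp add: ac.mv_pfaffian_map_Suc(1) ac.SV_f)
    next
      case (2 k)
      have "ac.NT ?F k = ac.NT f k" unfolding mv_def by (intro sum.cong) simp_all
      then show ?thesis unfolding 2(1) ac.mv_pfaffian_map(2) using ac.NT_f[OF 2(2)] by simp
    qed
    show "\<exists>w. \<forall>i<?m. v i = mv ?\<Phi> ?m w i" if v: "dotp ?F ?m v = 0" for v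
    proof -
      obtain x y where xy: "\<And>i. i < Suc s \<Longrightarrow> v i - (ac.SV x i + ac.NV y i) \<in> {0}"
        "\<And>j. j < s \<Longrightarrow> v (Suc s + j) + ac.NT x j \<in> {0}"
        using ac.exact1[of v "\<lambda>j. v (Suc s + j)"] v unfolding dotp_append_fun by (metis singleton_iff)
      let ?w = "append_fun (Suc s) x y"
      have *: "ac.SV ?w i = ac.SV x i" "ac.NV (\<lambda>j. ?w (Suc s + j)) i = ac.NV y i" "ac.NT ?w i = ac.NT x i" for i
        unfolding mv_def by (intro sum.cong; simp)+
      have "v i = mv ?\<Phi> ?m ?w i" if i: "i < ?m" for i
        using i
      proof (cases rule: less_add_cases)
        case 1
        then show ?thesis using xy(1)[OF 1] by (simp only: ac.mv_pfaffian_map(1) *) simp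
      next
        case (2 k)
        then show ?thesis using xy(2)[OF 2(2)] unfolding 2(1) ac.mv_pfaffian_map(2) * by (simp add: eq_neg_iff_add_eq_0)
      qed
      then show ?thesis by blast
    qed
    show "\<exists>c. \<forall>i<?m. w i = c * ?F i" if w: "\<And>i. i < ?m \<Longrightarrow> mv ?\<Phi> ?m w i = 0" for w
    proof -
      have 1: "ac.SV w i + ac.NV (\<lambda>j. w (Suc s + j)) i \<in> {0}" if i: "i < Suc s" for i
        using w[of i] i by (simp add: ac.mv_pfaffian_map_Suc(1))
      have 2: "ac.NT w j \<in> {0}" if j: "j < s" for j
        using w[of "Suc s + j"] j by (simp add: ac.mv_pfaffian_map_Suc(2))
      obtain c where c: "\<And>i. i < Suc s \<Longrightarrow> w i - c * f i \<in> {0}" "\<And>j. j < s \<Longrightarrow> w (Suc s + j) - c * g j \<in> {0}"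
        using ac.exact2[OF 1 2] by metis
      have "w i = c * ?F i" if i: "i < ?m" for i
        using i c by (cases rule: less_add_cases) auto
      then show ?thesis by blast
    qed
    show "c = 0" if c: "\<And>i. i < ?m \<Longrightarrow> c * ?F i = 0" for c
    proof -
      have "f i * c \<in> {0}" if i: "i < Suc s" for i using c[of i] i by (simp add: mult.commute)
      then show ?thesis using ac.exact3[of c] by blast
    qed
  qed
qed

section \<open>Numerical invariants from a linear regular sequence\<close>

lemma linear_regular_sequence_iff:
  assumes "rideal I"
  shows "linear_regular_sequence I ls \<longleftrightarrow> (\<forall>l\<in>set ls. homogeneous 1 l) \<and>
    enat (length ls) = krull_dim (class_ring Quot I) \<and> weakly_regular I ls \<and> adjoins I ls \<noteq> UNIV"
  using regular_sequence_Quot[OF assms] by (simp add: linear_regular_sequence_def coset_def[abs_def])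

text \<open>All linear regular sequences have the same length, and iterated \<open>psum\<close> is
  injective; so the Hilbert function of \<open>I\<close> determines that of every Artinian
  reduction.\<close>

lemma has_h_vectorI:
  assumes I: "hideal I" "I \<subseteq> mmax" and ls: "weakly_regular I ls" "\<And>l. l \<in> set ls \<Longrightarrow> homogeneous 1 l"
    and dim: "krull_dim (class_ring Quot I) = enat (length ls)"
    and H: "hilbert_function I = (psum ^^ length ls) (\<lambda>i. if i < length h then h ! i else 0)"
  shows "has_h_vector I h"
proof -
  note R = hideal_rideal[OF I(1)]
  have "adjoins I ls \<noteq> UNIV" using adjoins_in_mmax[OF I(2) ls(2)] mmax_ne_UNIV by blast
  then have "linear_regular_sequence I ls" using ls dim by (simp add: linear_regular_sequence_iff[OF R])
  moreover have "hilbert_function (Idl\<^bsub>class_ring\<^esub> (I \<union> set ls')) i = (if i < length h then h ! i else 0)"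
    if "linear_regular_sequence I ls'" for ls' i
  proof -
    have ls': "\<And>l. l \<in> set ls' \<Longrightarrow> homogeneous 1 l" "length ls' = length ls" "weakly_regular I ls'"
      using that dim by (simp_all add: linear_regular_sequence_iff[OF R])
    have "(psum ^^ length ls) (hilbert_function (adjoins I ls')) =
        (psum ^^ length ls) (\<lambda>i. if i < length h then h ! i else 0)"
      using hilbert_function_adjoins[OF I(1) ls'(1,3)] H ls'(2) by simp
    from fun_cong[OF psum_pow_inject[OF this], of i] show ?thesis
      by (simp add: Idl_Un_eq_adjoins[OF R])
  qed
  ultimately show ?thesis unfolding has_h_vector_def by blast
qed

text \<open>The scheme has dimension \<open>e\<close>, one less than the Krull dimension, and the
  factorial cancels the denominator of the leading coefficient.\<close>

lemma scheme_degreeI: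
  assumes dim: "krull_dim (class_ring Quot I) = enat (Suc e)"
    and H: "hilbert_function I = (psum ^^ Suc e) (\<lambda>i. if i < length h then h ! i else 0)"
    and pos: "0 < sum_list h"
  shows "scheme_degree I = of_nat (sum_list h)"
proof -
  have sum: "(\<Sum>j<length h. if j < length h then h ! j else 0) = sum_list h"
    by (simp add: sum_list_sum_nth lessThan_atLeast0)
  have "lead_coeff (hilbert_polynomial I) = of_nat (sum_list h) / fact e"
    using lead_coeff_hilbert_polynomial[OF H, of "length h"] pos unfolding sum by simp
  moreover have "scheme_dim I = enat e" by (simp add: scheme_dim_def dim one_enat_def)
  ultimately show ?thesis by (simp add: scheme_degree_def)
qed

section \<open>The intersection ideal\<close>

lemma homogeneous_sign: "homogeneous d p \<Longrightarrow> homogeneous d ((-1) ^ k * p)"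
  by (cases "even k") (simp_all add: homogeneous_uminus)

text \<open>\<open>X\<close> is the sum of the two ideals before saturation and \<open>Z\<close> the
  ideal of the smaller matrix. The bounds on prime chains, \<open>d'\<close> for \<open>X\<close>
  and \<open>d' + 1\<close> for \<open>Z\<close>, fix how many forms
  \<open>linear_parameters_exist\<close> uses for each.\<close>

locale linear_block_data = block_data s r N U B
  for s r :: nat and N U B :: "nat \<Rightarrow> nat \<Rightarrow> ('n::finite, 'k::field_char_0) mpoly" +
  fixes d' :: nat and X Z :: "('n, 'k) mpoly set"
  assumes s: "1 \<le> s" and d': "1 \<le> d'" and card: "CARD('n) = d' + 3"
    and N: "\<And>i j. i < Suc s \<Longrightarrow> j < s \<Longrightarrow> homogeneous 1 (N i j)"
    and U: "\<And>i j. i < Suc s \<Longrightarrow> j < Suc r \<Longrightarrow> homogeneous 1 (U i j)"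
    and B: "\<And>i j. i < r - 1 \<Longrightarrow> j < Suc r \<Longrightarrow> homogeneous 1 (B i j)"
    and X: "X = {a + b | a b. a \<in> range (dotp d (Suc t)) \<and> b \<in> Z}"
    and Z: "Z = range (dotp f (Suc s))"
    and hideals: "hideal X" "hideal Z"
    and dims: "\<not> prime_chain X (Suc d')" "\<not> prime_chain Z (Suc (Suc d'))"
begin

lemma f_homogeneous: "i < Suc s \<Longrightarrow> homogeneous s (f i)"
  by (rule homogeneous_sminor[OF N])

lemma d_homogeneous:
  assumes "j < Suc t" shows "homogeneous t (d j)"
  unfolding d_def
proof (rule homogeneous_sminor)
  show "homogeneous 1 (A j i)" if ij: "i < Suc t" "j < t" for i j
    using N[of j "i - Suc r"] U[of j i] B[of "j - Suc s" i] ij by (auto simp: A_def)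
qed (use assms in simp)

lemma g_homogeneous: "j < s \<Longrightarrow> homogeneous t (g j)"
  unfolding g_def by (rule d_homogeneous) simp

lemma S_homogeneous:
  assumes "i < Suc s" "k < Suc s" shows "homogeneous (r + 1) (S i k)"
proof -
  have "homogeneous (Suc r) (det (Q (U k) (U i)))"
    using assms U B by (intro homogeneous_det Q_carrier) (auto simp: Q_def)
  then show ?thesis unfolding S_def by (intro homogeneous_sign) simp
qed

lemma X_subset_mmax: "X \<subseteq> mmax"
proof -
  have "dotp d (Suc t) a + dotp f (Suc s) b \<in> mmax" for a b
    unfolding dotp_def
    using s by (intro rideal_add rideal_sum rideal_mult_right rideal_mmax homogeneous_in_mmax[OF f_homogeneous]
        homogeneous_in_mmax[OF d_homogeneous]) auto
  then show ?thesis unfolding X Z by blast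
qed

lemma parameters:
  obtains p q w ls where "length ls = CARD('n)" "\<And>l. l \<in> set ls \<Longrightarrow> homogeneous 1 l" "weakly_regular {0} ls"
    "p \<in> Z" "q \<in> Z" "w \<in> X" "\<And>i. i \<le> d' \<Longrightarrow> regular3 (adjoins {0} (take i ls)) p q w"
proof -
  note R = hideal_rideal[OF hideals(1)] hideal_rideal[OF hideals(2)]
  obtain ls where ls: "length ls = CARD('n)" "\<And>l. l \<in> set ls \<Longrightarrow> homogeneous 1 l"
      "\<And>i. i < CARD('n) \<Longrightarrow> ls ! i \<notin> adjoins {0} (take i ls)"
      "\<not> prime_chain (adjoins X (take d' ls)) 1" "\<not> prime_chain (adjoins Z (take (Suc d') ls)) 1"
    using linear_parameters_exist[OF infinite_UNIV_char_0 R dims] card by auto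
  have reg: "weakly_regular {0} ls" using independent_linear_forms_regular(1)[OF ls(2,1,3)] .
  show thesis
    using regular_triple_exists[OF hideals card ls(1)[unfolded card] ls(2) reg ls(4,5)] that[OF ls(1,2) reg]
    by metis
qed

text \<open>The member \<open>p\<close> of the regular sequence, taken modulo \<open>{0}\<close>, is
  the nonzerodivisor that \<open>d_expansion\<close> cancels. That expansion also puts the minors
  \<open>d j\<close> with \<open>j <= r\<close> into the ideal of \<open>f\<close>, so the sum is
  (f, g).\<close>

lemma pfaffian_data_and_X:
  "pfaffian_data s N S f g" "X = {dotp f (Suc s) a + dotp g s b | a b. True}"
proof -
  obtain p q w ls where p: "p \<in> Z"
    and reg: "\<And>i. i \<le> d' \<Longrightarrow> regular3 (adjoins {0} (take i ls)) p q w" by (rule parameters) blast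
  obtain c where c: "p = dotp f (Suc s) c" using p Z by blast
  have cancel: "x = 0" if "p * x = 0" for x
    using reg[of 0] that by (simp add: regular3_def regular_mod_def)
  show "pfaffian_data s N S f g" by (rule pfaffian_data[OF c[unfolded dotp_def] cancel])
  show "X = {dotp f (Suc s) a + dotp g s b | a b. True}"
  proof (intro equalityI subsetI)
    fix x assume "x \<in> X"
    then obtain y b where x: "x = dotp d (Suc t) y + dotp f (Suc s) b" unfolding X Z by blast
    define a where "a i = (-1) ^ (Suc r * s) * det (Q (U i) y)" for i
    have "dotp d (Suc t) y = (\<Sum>j<Suc t. y j * d j)" unfolding dotp_def by (intro sum.cong) (simp_all add: mult.commute)
    also have "\<dots> = (\<Sum>j<Suc r. y j * d j) + (\<Sum>j<s. y (Suc r + j) * g j)" by (rule sum_d_split)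
    also have "(\<Sum>j<Suc r. y j * d j) = (-1) ^ (Suc r * s) * (\<Sum>i<Suc s. f i * det (Q (U i) y))"
      using cancel by (rule d_expansion[OF c[unfolded dotp_def]])
    also have "\<dots> = dotp f (Suc s) a"
      unfolding dotp_def sum_distrib_left a_def by (intro sum.cong) (simp_all add: ac_simps)
    also have "(\<Sum>j<s. y (Suc r + j) * g j) = dotp g s (\<lambda>j. y (Suc r + j))"
      unfolding dotp_def by (intro sum.cong) (simp_all add: ac_simps)
    finally have "x = dotp f (Suc s) (\<lambda>i. a i + b i) + dotp g s (\<lambda>j. y (Suc r + j))"
      unfolding x dotp_add by (simp only: ac_simps)
    then show "x \<in> {dotp f (Suc s) a + dotp g s b | a b. True}" by blast
  next
    fix x assume "x \<in> {dotp f (Suc s) a + dotp g s b | a b. True}"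
    then obtain a b where x: "x = dotp f (Suc s) a + dotp g s b" by blast
    have "dotp d (Suc t) (append_fun (Suc r) (\<lambda>_. 0) b) = dotp g s b"
    proof -
      have "Suc t = Suc r + s" by simp
      then show ?thesis unfolding dotp_def by (simp only: sum_lessThan_add) (simp add: g_def)
    qed
    then have "x = dotp d (Suc t) (append_fun (Suc r) (\<lambda>_. 0) b) + dotp f (Suc s) a" using x by simp
    then show "x \<in> X" unfolding X Z by blast
  qed
qed

text \<open>The triple stays regular modulo the first \<open>i\<close> forms for all
  \<open>i <= d'\<close>. Exactness modulo the first \<open>i + 1\<close> forms makes form
  \<open>i\<close> regular on the quotient by \<open>X\<close> and its predecessors.\<close>

lemma acyclic_and_regular:
  obtains p q w ls where "pfaffian_acyclic s N S f g {0} p q w" "length ls = d'"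
    "\<And>l. l \<in> set ls \<Longrightarrow> homogeneous 1 l" "weakly_regular X ls"
proof -
  obtain p q w ls where ls: "length ls = CARD('n)" "\<And>l. l \<in> set ls \<Longrightarrow> homogeneous 1 l"
      and reg: "weakly_regular {0} ls" and pqw: "p \<in> Z" "q \<in> Z" "w \<in> X"
        "\<And>i. i \<le> d' \<Longrightarrow> regular3 (adjoins {0} (take i ls)) p q w" by (rule parameters) blast
  define L where "L i = adjoins {0} (take i ls)" for i
  have L0: "L 0 = {0}" by (simp add: L_def)
  interpret pd: pfaffian_data s N S f g by (rule pfaffian_data_and_X)
  have IJ: "pd.I = X" "pd.J = Z" by (simp_all add: pd.I_def pd.J_def pfaffian_data_and_X(2) Z)
  have RL: "rideal (L i)" for i
    unfolding L_def by (intro rideal_adjoins hideal_rideal[OF hideal_zero])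
  have ac: "pfaffian_acyclic s N S f g (L i) p q w" if "i \<le> d'" for i
    using pqw(1-3) pqw(4)[OF that] RL by unfold_locales (simp_all add: IJ regular3_def L_def)
  have "regular_mod (adjoins X (take i ls)) (ls ! i)" if i: "i < d'" for i
  proof -
    have len: "i < length ls" using i ls(1) card by simp
    have "L (Suc i) = adjoin (L i) (ls ! i)"
      using len by (simp add: L_def take_Suc_conv_app_nth adjoins_snoc)
    then have "pfaffian_acyclic s N S f g (adjoin (L i) (ls ! i)) p q w" using ac[of "Suc i"] i by simp
    moreover have "regular_mod (L i) (ls ! i)" using reg len by (simp add: weakly_regular_def L_def)
    ultimately have "regular_mod {x + y | x y. x \<in> L i \<and> y \<in> X} (ls ! i)"
      using pd.regular_mod_lift[OF RL] unfolding IJ by blast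
    moreover have "{x + y | x y. x \<in> L i \<and> y \<in> X} = adjoins X (take i ls)"
      unfolding adjoins_decompose[OF hideal_rideal[OF hideals(1)]] L_def[symmetric] by (metis (no_types, opaque_lifting) add.commute)
    ultimately show ?thesis by simp
  qed
  then have "weakly_regular X (take d' ls)" using ls(1) card by (simp add: weakly_regular_def min_def)
  moreover have "homogeneous 1 l" if "l \<in> set (take d' ls)" for l using ls(2) that by (meson in_set_takeD)
  ultimately show thesis using that[of p q w "take d' ls"] ac[of 0] ls(1) card by (simp add: L0)
qed

lemma invariants:
  "subscheme X" "arithmetically_Gorenstein X" "scheme_codim X = 3" "has_h_vector X (hvec s r)"
  "scheme_degree X = of_nat (sum_list (hvec s r))" "saturation X = X"
proof -
  obtain p q w ls where ac: "pfaffian_acyclic s N S f g {0} p q w" and ls: "length ls = d'"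
    "\<And>l. l \<in> set ls \<Longrightarrow> homogeneous 1 l" "weakly_regular X ls" by (rule acyclic_and_regular) blast
  interpret ac: pfaffian_acyclic s N S f g "{0}" p q w by (rule ac)
  have IX: "ac.I = X" by (simp add: ac.I_def pfaffian_data_and_X(2))
  let ?a = "append_fun (Suc s) (\<lambda>_. s) (\<lambda>_. t)"
  interpret res: graded_resolution "Suc s + s" "t + s + 1" ?a "append_fun (Suc s) f g" "pfaffian_map s N S" X
    unfolding IX[symmetric]
    by (rule graded_resolution_pfaffian[OF ac f_homogeneous g_homogeneous N S_homogeneous])
  \<comment> \<open>As \<open>d'\<close> is positive, some linear form is regular modulo
    \<open>X\<close>, which forces \<open>X\<close> to be saturated.\<close>
  have "regular_mod (adjoins X (take 0 ls)) (ls ! 0)"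
    using ls(3) d' ls(1) unfolding weakly_regular_def by (metis less_eq_Suc_le One_nat_def)
  then have reg: "regular_mod X (ls ! 0)" by simp
  have "ls ! 0 \<in> set ls" using ls(1) d' by (intro nth_mem) simp
  then show sat: "saturation X = X"
    using saturation_eq_if_regular[OF hideal_rideal[OF hideals(1)] ls(2) reg] by blast
  have ne: "X \<noteq> UNIV" using X_subset_mmax mmax_ne_UNIV by blast
  have krull: "krull_dim (class_ring Quot X) = enat (length ls)"
    "\<And>P. P \<in> minimal_primes X \<Longrightarrow> krull_dim (class_ring Quot P) = enat (length ls)"
    using krull_dim_if_regular[OF hideals(1) ne ls(3,2)] ls(1) d' dims(1) by simp_all
  show "subscheme X"
    by (simp add: subscheme_def closed_subscheme_def homogeneous_ideal_iff hideals sat equidimensional_def krull(2))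
  show codim: "scheme_codim X = 3"
    by (simp add: scheme_codim_def krull(1) ls(1) card numeral_eq_enat)
  have "minimal_graded_free_resolution X 3 res.res_mod res.res_map"
  proof (rule res.minimal_resolution)
    have N': "N i j \<in> mmax" if "i < Suc s" "j < s" for i j using homogeneous_in_mmax[OF N] that by simp
    have S': "S i j \<in> mmax" if "i < Suc s" "j < Suc s" for i j using homogeneous_in_mmax[OF S_homogeneous] that by simp
    show "pfaffian_map s N S i j \<in> mmax" if i: "i < Suc s + s" and j: "j < Suc s + s" for i j
    proof (rule less_add_cases[case_product less_add_cases, OF i j])
      assume "i < Suc s" "j < Suc s"
      then show ?thesis using S' by (simp add: pfaffian_map_def)
    next
      fix j' assume "i < Suc s" "j = Suc s + j'" "j' < s"
      then show ?thesis using N' by (simp add: pfaffian_map_def)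
    next
      fix i' assume "i = Suc s + i'" "i' < s" "j < Suc s"
      then show ?thesis using N' by (simp add: pfaffian_map_def rideal_uminus[OF rideal_mmax])
    next
      fix i' j' assume "i = Suc s + i'" "j = Suc s + j'"
      then show ?thesis by (simp add: pfaffian_map_def rideal_zero[OF rideal_mmax])
    qed
    show "0 < ?a j" for j using s by (simp add: append_fun_def)
  qed
  then show "arithmetically_Gorenstein X"
    unfolding arithmetically_Gorenstein_def using codim res.res_mod_simps(4)
    by (intro exI[of _ 3] exI[of _ res.res_mod] exI[of _ res.res_map] exI[of _ "int (t + s + 1)"])
      (simp add: numeral_eq_enat)
  have "hilbert_function X = (psum ^^ length ls) (hfun s r)"
  proof (unfold ls(1), rule hilbert_function_hfun[OF card s r refl])
    show "hilbert_function X i + ((s + 1) * dimR TYPE('n) i s + s * dimR TYPE('n) i t) + dimR TYPE('n) i (t + s + 1)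
      = dimR TYPE('n) i 0 + ((s + 1) * dimR TYPE('n) i (t + 1) + s * dimR TYPE('n) i (s + 1))" for i
      using res.hilbert_function_resolution[of i] unfolding sum_lessThan_add by (simp add: add.commute[of r s])
  qed
  then have H: "hilbert_function X = (psum ^^ length ls) (\<lambda>i. if i < length (hvec s r) then hvec s r ! i else 0)"
    by (simp add: hfun_def[abs_def])
  show "has_h_vector X (hvec s r)"
    by (rule has_h_vectorI[OF hideals(1) X_subset_mmax ls(3,2) krull(1) H])
  obtain e where e: "length ls = Suc e" using ls(1) d' by (cases "length ls") auto
  have "0 < sum_list (hvec s r)" unfolding sum_list_hvec[OF r] using s by simp
  then show "scheme_degree X = of_nat (sum_list (hvec s r))"
    using scheme_degreeI krull(1) H unfolding e by blast
qed

end

text \<open>Positivity of \<open>c\<close> excludes truncation in the codimension: an infinite or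
  too large Krull dimension would give codimension 0.\<close>

lemma not_prime_chain_if_codim:
  fixes X :: "('n::finite, 'k::field) mpoly set"
  assumes X: "rideal X" and codim: "scheme_codim X = enat c" and n: "CARD('n) = d + c" and d: "0 < d" and c: "0 < c"
  shows "\<not> prime_chain X (Suc d)"
proof -
  have "krull_dim (class_ring Quot X) = enat d"
  proof (cases "krull_dim (class_ring Quot X)")
    case (enat k)
    then have "CARD('n) - k = c" using codim by (simp add: scheme_codim_def)
    then show ?thesis using n c enat by simp
  qed (use codim c in \<open>simp add: scheme_codim_def zero_enat_def\<close>)
  then show ?thesis using krull_dim_Quot_eq_iff[OF X d] by simp
qed

text \<open>Without common components, the dimension bound for the sum of the ideals drops from n -
  1 to n - 2. The condition \<open>n \<ge> 3\<close> keeps n - 2 positive, so that a linear form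
  remains to prove that the sum is saturated.\<close>

theorem proposition3p3:
  fixes n t r :: nat
    and X_t X_tr Y :: "('n::finite, 'k::{alg_closed_field, field_char_0}) mpoly set"
    and M_t M_tr M_upper M_lower :: "('n, 'k) mpoly mat"
  assumes "CARD('n) = n + 1" and "n \<ge> 3"
    and "t \<ge> 2" and "1 \<le> r" and "r \<le> t - 1"
    and "M_t \<in> carrier_mat t (t + 1)" and "linear_entries M_t"
    and "M_tr \<in> carrier_mat (t - r) (t - r + 1)" and "linear_entries M_tr"
    and "subscheme X_t" and "arithmetically_CM X_t" and "scheme_codim X_t = 2"
    and "defined_by_maximal_minors X_t M_t"
    and "subscheme X_tr" and "arithmetically_CM X_tr" and "scheme_codim X_tr = 2"
    and "defined_by_maximal_minors X_tr M_tr"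
    and "M_upper \<in> carrier_mat (t - r + 1) (r + 1)" and "M_lower \<in> carrier_mat (r - 1) (r + 1)"
    and "M_t = four_block_mat M_upper (transpose_mat M_tr) M_lower (0\<^sub>m (r - 1) (t - r))"
    and "no_common_component X_t X_tr"
    and "Y = scheme_inter X_t X_tr"
  shows "subscheme Y \<and> arithmetically_Gorenstein Y \<and> scheme_codim Y = 3 \<and>
    has_h_vector Y
      (map (\<lambda>k. k choose 2) [2..<t - r + 1] @
       replicate (r + 1) ((t - r + 1) choose 2) @
       rev (map (\<lambda>k. k choose 2) [2..<t - r + 1])) \<and>
    scheme_degree Y =
      of_nat (2 * ((t + 2 - r) choose 3) + (r - 1) * ((t + 1 - r) choose 2))"
proof -
  define s where "s = t - r"
  have t: "t = s + r" and s: "1 \<le> s" using assms(3-5) by (simp_all add: s_def)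
  have car: "M_t \<in> carrier_mat (s + r) (Suc (s + r))" "M_tr \<in> carrier_mat s (Suc s)"
    "M_upper \<in> carrier_mat (Suc s) (Suc r)" "M_lower \<in> carrier_mat (r - 1) (Suc r)"
    using assms(6,8,18,19) by (simp_all add: t)
  define N where "N = (\<lambda>i j. M_tr $$ (j, i))"
  define U where "U = (\<lambda>i j. M_upper $$ (i, j))"
  define B where "B = (\<lambda>i j. M_lower $$ (i, j))"
  interpret bd: block_data s r N U B using assms(4) by unfold_locales
  have M_t: "M_t $$ (i, j) = bd.A i j" if "i < s + r" "j < Suc (s + r)" for i j
    unfolding bd.A_def using that car assms(4) unfolding assms(20) N_def U_def B_def
    by (auto simp: t less_Suc_eq_le)
  have lin: "homogeneous 1 (M_t $$ (i, j))" if "i < s + r" "j < Suc (s + r)" for i j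
    using assms(7) elements_matI[OF car(1) that refl] by (simp add: linear_entries_def)
  have X_tr: "X_tr = range (dotp (sminor s N) (Suc s))"
    using assms(17) Idl_maximal_minors[OF car(2)] by (simp add: defined_by_maximal_minors_def N_def)
  have "dotp (sminor (s + r) (\<lambda>j i. M_t $$ (i, j))) (Suc (s + r)) = dotp bd.d (Suc (s + r))"
    unfolding dotp_def bd.d_def fun_eq_iff
    by (intro allI sum.cong refl arg_cong2[of _ _ _ _ "(*)"] sminor_cong) (simp_all add: M_t)
  then have X_t: "X_t = range (dotp bd.d (Suc (s + r)))"
    using assms(13) Idl_maximal_minors[OF car(1)] by (simp add: defined_by_maximal_minors_def)
  define X where "X = {a + b | a b. a \<in> X_t \<and> b \<in> X_tr}"
  have hideals: "hideal X_t" "hideal X_tr"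
    using assms(10,14) by (simp_all add: subscheme_def closed_subscheme_def homogeneous_ideal_iff)
  have n: "n - 1 = Suc (n - 2)" using assms(2) by simp
  have dims: "\<not> prime_chain X_t (Suc (n - 1))" "\<not> prime_chain X_tr (Suc (n - 1))"
    using assms(1,2,12,16) hideals by (intro not_prime_chain_if_codim[where c = 2]; simp add: hideal_rideal numeral_eq_enat)+
  interpret linear_block_data s r N U B "n - 2" X X_tr
  proof unfold_locales
    show "1 \<le> s" "1 \<le> n - 2" "CARD('n) = n - 2 + 3" using s assms(1,2) by simp_all
    show "homogeneous 1 (N i j)" if "i < Suc s" "j < s" for i j
      using assms(9) elements_matI[OF car(2) that(2,1) refl] by (simp add: linear_entries_def N_def)
    show "homogeneous 1 (U i j)" if "i < Suc s" "j < Suc r" for i j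
      using lin[of i j] M_t[of i j] that assms(4) by (simp add: bd.A_def)
    show "homogeneous 1 (B i j)" if "i < r - 1" "j < Suc r" for i j
      using lin[of "Suc s + i" j] M_t[of "Suc s + i" j] that by (simp add: bd.A_def)
    show "X = {a + b | a b. a \<in> range (dotp bd.d (Suc (s + r))) \<and> b \<in> X_tr}"
      unfolding X_def X_t ..
    show "X_tr = range (dotp (sminor s N) (Suc s))" by (rule X_tr)
    show "hideal X" "hideal X_tr" unfolding X_def by (intro hideal_set_add hideals)+
    show "\<not> prime_chain X (Suc (n - 2))"
      unfolding X_def n[symmetric] by (intro prime_chain_set_add hideal_rideal hideals dims assms(21))
    show "\<not> prime_chain X_tr (Suc (Suc (n - 2)))" using dims(2) unfolding n .
  qed
  have "Y = X" unfolding assms(22) scheme_inter_def set_add_class_ring X_def[symmetric] by (rule invariants(6))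
  moreover have "sum_list (hvec s r) = 2 * ((t + 2 - r) choose 3) + (r - 1) * ((t + 1 - r) choose 2)"
    using sum_list_hvec[OF assms(4)] by (simp add: t)
  ultimately show ?thesis using invariants(1-5) unfolding s_def[symmetric] hvec_def by simp
qed

end
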